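(* Let $n\ge1$ and $\beta<n+4$. Let $f\in H^{s_1}(\mathbf{T}^n)$ and $g\in H^{s_2}(\mathbf{T}^n)$ for some $s_1,s_2\in\mathbb{R}$. For $\delta>0$ and $t\ge0$ let $U^{\delta,\beta}(t)$ be the solution of the nonlocal wave equation $\frac{d^2}{dt^2}U=L^{\delta,\beta}U$, $U(0)=f$, $\frac{d}{dt}U(0)=g$, given by $$U^{\delta,\beta}(t)=(\hat f_0+\hat g_0t)+\sum_{0\ne k\in\mathbb{Z}^n}\left[\hat f_k\cos(\sqrt{-m_k}\,t)+\frac{\hat g_k}{\sqrt{-m_k}}\sin(\sqrt{-m_k}\,t)\right]e^{ik\cdot x}\in H^{s'}(\mathbf{T}^n),$$ and let $U^0(t)$ be the solution of the local wave equation $\frac{d^2}{dt^2}U^0=\Delta U^0$, $U^0(0)=f$, $\frac{d}{dt}U^0(0)=g$, given by $$U^0(t)=(\hat f_0+\hat g_0t)+\sum_{0\ne k\in\mathbb{Z}^n}\left[\hat f_k\cos(\|k\|t)+\frac{\hat g_k}{\|k\|}\sin(\|k\|t)\right]e^{ik\cdot x}\in H^{s}(\mathbf{T}^n),$$ where $s=\min\{s_1,s_2+1\}$ and $s'=\min\{s_1,s_2+\theta\}$ with $\theta=\max\{0,\frac{\beta-n}{2}\}$. Let $t\ge0$. Then, when $\beta\le n+2$, $$\lim_{\delta\to0^+}U^{\delta,\beta}(t)=U^0(t)\quad\text{in }H^{s'}(\mathbf{T}^n),$$ and when $n+2<\beta<n+4$, $$\lim_{\delta\to0^+}U^{\delta,\beta}(t)=U^0(t)\quad\text{in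 }H^{s}(\mathbf{T}^n).$$
   Context: For $k\in\mathbb{Z}^n$, $m_k=m^{\delta,\beta}(k)$, where for $\nu\in\mathbb{R}^n$ $$m^{\delta,\beta}(\nu)=-\|\nu\|^2\,{}_2F_3\!\left(1,\tfrac{n+2-\beta}{2};2,\tfrac{n+2}{2},\tfrac{n+4-\beta}{2};-\tfrac14\|\nu\|^2\delta^2\right),$$ ${}_2F_3(a_1,a_2;b_1,b_2,b_3;z)=\sum_{j\ge0}\frac{(a_1)_j(a_2)_j}{(b_1)_j(b_2)_j(b_3)_j}\frac{z^j}{j!}$, $(a)_j=a(a+1)\cdots(a+j-1)$. For $\beta<n+4$ one has $m_k<0$ for all $k\neq0$. The nonlocal Laplacian acts on periodic distributions by $L^{\delta,\beta}\big(\sum_k\hat T_ke^{ik\cdot x}\big)=\sum_km_k\hat T_ke^{ik\cdot x}$. $\mathbf{T}^n=\prod_{j=1}^n[0,2\pi]$ is the periodic torus; a periodic distribution $g$ is written $g=\sum_{k\in\mathbb{Z}^n}\hat g_ke^{ik\cdot x}$ with Fourier coefficients $\hat g_k$; for $q\in\mathbb{R}$, $H^q(\mathbf{T}^n)$ is the space of periodic distributions with $\|g\|_{H^q(\mathbf{T}^n)}^2=\sum_{k\in\mathbb{Z}^n}(1+\|k\|^2)^q|\hat g_k|^2<\infty$. *)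

theory Defs
  imports "HOL-Analysis.Analysis"
begin

section \<open>Periodic test functions and periodic distributions\<close>

definition partial_deriv :: "'n::finite \<Rightarrow> (real^'n \<Rightarrow> complex) \<Rightarrow> real^'n \<Rightarrow> complex" where
  "partial_deriv j \<phi> x = vector_derivative (\<lambda>h. \<phi> (x + h *\<^sub>R axis j 1)) (at 0)"

definition iter_partial :: "'n::finite list \<Rightarrow> (real^'n \<Rightarrow> complex) \<Rightarrow> real^'n \<Rightarrow> complex" where
  "iter_partial js \<phi> = foldr partial_deriv js \<phi>"

text \<open>\<open>C\<^sup>\<infinity>\<close>: all iterated partial derivatives exist and are continuous.\<close>

definition smooth :: "(real^'n::finite \<Rightarrow> complex) \<Rightarrow> bool" where
  "smooth \<phi> \<longleftrightarrow>
     (\<forall>js. continuous_on UNIV (iter_partial js \<phi>) \<and>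
        (\<forall>j x. (\<lambda>h. iter_partial js \<phi> (x + h *\<^sub>R axis j 1)) differentiable at (0::real)))"

definition test_functions :: "(real^'n::finite \<Rightarrow> complex) set" where
  "test_functions =
     {\<phi>. smooth \<phi> \<and> (\<forall>j x. \<phi> (x + (2 * pi) *\<^sub>R axis j 1) = \<phi> x)}"

definition test_norm :: "nat \<Rightarrow> (real^'n::finite \<Rightarrow> complex) \<Rightarrow> real" where
  "test_norm N \<phi> = (\<Sum>js | length js \<le> N. SUP x. norm (iter_partial js \<phi> x))"

type_synonym 'n distr = "(real^'n \<Rightarrow> complex) \<Rightarrow> complex"

text \<open>
  The continuous linear functionals on the Frechet space of test functions. A functional
  is normalised to be 0 on arguments that are not test functions, so that equality
  of distributions is equality in HOL.
\<close>

definition periodic_distributions :: "('n::finite) distr set" where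
  "periodic_distributions =
     {T. (\<forall>\<phi>. \<phi> \<notin> test_functions \<longrightarrow> T \<phi> = 0) \<and>
         (\<forall>\<phi>\<in>test_functions. \<forall>\<psi>\<in>test_functions. \<forall>a b.
            T (\<lambda>x. a * \<phi> x + b * \<psi> x) = a * T \<phi> + b * T \<psi>) \<and>
         (\<exists>N C. \<forall>\<phi>\<in>test_functions. norm (T \<phi>) \<le> C * test_norm N \<phi>)}"


section \<open>Fourier series\<close>

definition real_vec :: "int^'n::finite \<Rightarrow> real^'n" where
  "real_vec k = (\<chi> j. real_of_int (k $ j))"

definition fourier_mode :: "int^'n::finite \<Rightarrow> real^'n \<Rightarrow> complex" where
  "fourier_mode k x = exp (\<i> * complex_of_real (real_vec k \<bullet> x))"

definition torus :: "(real^'n::finite) set" where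
  "torus = cbox 0 (\<chi> j. 2 * pi)"

definition fourier_coeff :: "('n::finite) distr \<Rightarrow> int^'n \<Rightarrow> complex" where
  "fourier_coeff T k = T (fourier_mode (- k)) / complex_of_real ((2 * pi) ^ CARD('n))"

text \<open>
  The distribution \<open>\<Sum>\<^sub>k c\<^sub>k e\<^sup>i\<^sup>k\<^sup>x\<close>, where the function
  \<open>e\<^sup>i\<^sup>k\<^sup>x\<close> acts on a test function by integration over the torus.
\<close>

definition fourier_series :: "(int^'n::finite \<Rightarrow> complex) \<Rightarrow> 'n distr" where
  "fourier_series c =
     (\<lambda>\<phi>. if \<phi> \<in> test_functions
          then \<Sum>\<^sub>\<infinity>k. c k * integral torus (\<lambda>x. fourier_mode k x * \<phi> x)
          else 0)"


section \<open>Sobolev spaces\<close>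

definition sobolev :: "real \<Rightarrow> ('n::finite) distr set" where
  "sobolev q =
     {T \<in> periodic_distributions.
        (\<lambda>k. (1 + (norm (real_vec k))\<^sup>2) powr q * (norm (fourier_coeff T k))\<^sup>2) summable_on UNIV}"

definition sobolev_norm :: "real \<Rightarrow> ('n::finite) distr \<Rightarrow> real" where
  "sobolev_norm q T =
     sqrt (\<Sum>\<^sub>\<infinity>k. (1 + (norm (real_vec k))\<^sup>2) powr q * (norm (fourier_coeff T k))\<^sup>2)"

text \<open>
  Membership is part of the definition because the infinite sum in the norm is 0 by convention
  when it diverges.
\<close>

definition sobolev_tendsto ::
  "real \<Rightarrow> ('a \<Rightarrow> ('n::finite) distr) \<Rightarrow> 'n distr \<Rightarrow> 'a filter \<Rightarrow> bool" where
  "sobolev_tendsto q U L F \<longleftrightarrow>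
     L \<in> sobolev q \<and> (\<forall>\<^sub>F d in F. U d \<in> sobolev q) \<and>
     ((\<lambda>d. sobolev_norm q (\<lambda>\<phi>. U d \<phi> - L \<phi>)) \<longlongrightarrow> 0) F"


section \<open>The local and the nonlocal Laplacian\<close>

definition hyp2F3 :: "real \<Rightarrow> real \<Rightarrow> real \<Rightarrow> real \<Rightarrow> real \<Rightarrow> real \<Rightarrow> real" where
  "hyp2F3 a1 a2 b1 b2 b3 z =
     (\<Sum>j. (pochhammer a1 j * pochhammer a2 j)
           / (pochhammer b1 j * pochhammer b2 j * pochhammer b3 j) * (z ^ j / fact j))"

definition multiplier :: "real \<Rightarrow> real \<Rightarrow> real^'n::finite \<Rightarrow> real" where
  "multiplier \<delta> \<beta> \<nu> =
     - (norm \<nu>)\<^sup>2 *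
       hyp2F3 1 ((real CARD('n) + 2 - \<beta>) / 2)
              2 ((real CARD('n) + 2) / 2) ((real CARD('n) + 4 - \<beta>) / 2)
              (- (1 / 4) * (norm \<nu>)\<^sup>2 * \<delta>\<^sup>2)"

definition nonlocal_laplacian :: "real \<Rightarrow> real \<Rightarrow> ('n::finite) distr \<Rightarrow> 'n distr" where
  "nonlocal_laplacian \<delta> \<beta> T =
     fourier_series (\<lambda>k. complex_of_real (multiplier \<delta> \<beta> (real_vec k)) * fourier_coeff T k)"

text \<open>The distributional Laplacian; the two sign changes of the transposition cancel.\<close>

definition laplacian :: "('n::finite) distr \<Rightarrow> 'n distr" where
  "laplacian T =
     (\<lambda>\<phi>. if \<phi> \<in> test_functions
          then T (\<lambda>x. \<Sum>j\<in>UNIV. partial_deriv j (partial_deriv j \<phi>) x)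
          else 0)"


section \<open>The wave equations\<close>

text \<open>
  Time derivatives are taken in the topology of pointwise convergence on test functions;
  at time 0 they are one-sided.
\<close>

definition has_time_derivative ::
  "(real \<Rightarrow> ('n::finite) distr) \<Rightarrow> (real \<Rightarrow> 'n distr) \<Rightarrow> bool" where
  "has_time_derivative U V \<longleftrightarrow>
     (\<forall>t\<ge>0. \<forall>\<phi>\<in>test_functions.
        ((\<lambda>\<tau>. U \<tau> \<phi>) has_vector_derivative V t \<phi>) (at t within {0..}))"

definition wave_solution ::
  "(('n::finite) distr \<Rightarrow> 'n distr) \<Rightarrow> 'n distr \<Rightarrow> 'n distr \<Rightarrow> (real \<Rightarrow> 'n distr) \<Rightarrow> bool" where
  "wave_solution A f g U \<longleftrightarrow>
     (\<forall>t\<ge>0. U t \<in> periodic_distributions) \<and>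
     (\<exists>V. (\<forall>t\<ge>0. V t \<in> periodic_distributions) \<and>
          has_time_derivative U V \<and>
          has_time_derivative V (\<lambda>t. A (U t)) \<and>
          U 0 = f \<and> V 0 = g)"

definition nonlocal_wave ::
  "real \<Rightarrow> real \<Rightarrow> ('n::finite) distr \<Rightarrow> 'n distr \<Rightarrow> real \<Rightarrow> 'n distr" where
  "nonlocal_wave \<delta> \<beta> f g t =
     fourier_series (\<lambda>k.
       if k = 0 then fourier_coeff f 0 + fourier_coeff g 0 * complex_of_real t
       else let \<omega> = sqrt (- multiplier \<delta> \<beta> (real_vec k)) in
            fourier_coeff f k * complex_of_real (cos (\<omega> * t)) +
            fourier_coeff g k / complex_of_real \<omega> * complex_of_real (sin (\<omega> * t)))"

definition local_wave :: "('n::finite) distr \<Rightarrow> 'n distr \<Rightarrow> real \<Rightarrow> 'n distr" where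
  "local_wave f g t =
     fourier_series (\<lambda>k.
       if k = 0 then fourier_coeff f 0 + fourier_coeff g 0 * complex_of_real t
       else let \<omega> = norm (real_vec k) in
            fourier_coeff f k * complex_of_real (cos (\<omega> * t)) +
            fourier_coeff g k / complex_of_real \<omega> * complex_of_real (sin (\<omega> * t)))"

end

theory Submission
  imports Defs
begin

text \<open>
  Everything is diagonal in the Fourier basis, so the theorem reduces to the multiplier. Up to the
  factor \<open>-\<parallel>\<nu>\<parallel>\<^sup>2\<close> it is a power series \<open>H\<close> in \<open>v = \<parallel>\<nu>\<parallel>\<^sup>2\<delta>\<^sup>2/4\<close> that satisfies
  \<open>v H' + a H = a \<phi>\<close> with \<open>a = (n + 2 - \<beta>)/2 > -1\<close> and \<open>\<phi>(v) = (n/2) (1 - K(v)) / v\<close>, where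
  \<open>K\<close> is the normalised Bessel function \<open>\<^sub>0F\<^sub>1(; n/2; -v)\<close>. A decreasing energy gives \<open>\<bar>K\<bar> \<le> 1\<close>,
  hence \<open>0 \<le> \<phi> \<le> 1\<close> and \<open>\<phi> \<rightarrow> 0\<close>; the monotonicity of \<open>v\<^sup>a (H - c)\<close> for suitable constants \<open>c\<close> turns
  this into \<open>H(v) \<ge> c (1 + v)\<^sup>-\<^sup>a\<close>, and into \<open>H \<ge> 1\<close> if \<open>a \<le> 0\<close>. These bounds control
  \<open>sin (\<omega>t) / \<omega>\<close> uniformly in small \<open>\<delta>\<close>, and the limit follows by dominated convergence over the
  frequencies.

  The initial conditions need that a periodic distribution is the sum of its Fourier series.
  Fourier coefficients of test functions decay rapidly by integration by parts, so the
  Fourier series of a test function converges with all derivatives, and its limit is the function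
  itself because a continuous periodic function with vanishing Fourier coefficients is 0
  (Stone--Weierstrass).
\<close>

section \<open>Bounds for the multiplier\<close>

text \<open>The quotient of the Pochhammer symbols of a and a + 1 is a / (a + j), and v d/dv + a
  multiplies the j-th coefficient by a + j: hence the differential equation. The parameters 1 and 2
  turn 1/j! into 1/(j+1)!, so the right-hand side is a Bessel series stripped of its constant term
  and divided by v. Its parameter n/2 is at least 1/2, which the decrease of the energy requires.

  For a \<le> 0 only c = 1 makes v^a (H - c) vanish at 0, and this uses a > -1; for a > 0 every c
  will do. Hence the case distinctions on the sign of a.

  At fixed \<delta> the lower bound makes -m_k at least of order ||k||^(\<beta> - n), so division by
  \<omega> gains (\<beta> - n)/2 derivatives: the origin of \<theta>. The gain has to survive
  \<delta> \<rightarrow> 0. If a \<ge> 0 it does, since (1 + v)^-a decreases in v. If a < 0, then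
  \<theta> > 1, but the limit frequencies ||k|| gain only one derivative; H \<ge> 1 secures this one
  for all \<delta>, and the convergence is in the space of order s instead of s'.\<close>

definition bessel01 :: "real \<Rightarrow> real \<Rightarrow> real" where
  "bessel01 b v = (\<Sum>i. (- 1) ^ i / (fact i * pochhammer b i) * v ^ i)"

lemma pochhammer_ge_power:
  assumes "b > 0" shows "pochhammer b i \<ge> (b::real) ^ i"
  using assms
proof (induction i)
  case (Suc i)
  have "b ^ i * b \<le> pochhammer b i * (b + real i)"
    using Suc by (intro mult_mono) (auto simp: less_imp_le pochhammer_nonneg)
  then show ?case by (simp add: pochhammer_Suc mult.commute)
qed simp

text \<open>The majorant is \<open>M\<close> times the exponential series at
  \<open>\<bar>v\<bar> / b\<close>.\<close>

lemma summable_dominated_exp: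
  fixes c :: "nat \<Rightarrow> real"
  assumes b: "b > 0" and c: "\<And>i. \<bar>c i\<bar> \<le> M / (fact i * b ^ i)"
  shows "summable (\<lambda>i. c i * v ^ i)"
proof (rule summable_comparison_test)
  show "summable (\<lambda>i. M * (inverse (fact i) * (\<bar>v\<bar> / b) ^ i))"
    by (intro summable_mult summable_exp)
  show "\<exists>N. \<forall>n\<ge>N. norm (c n * v ^ n) \<le> M * (inverse (fact n) * (\<bar>v\<bar> / b) ^ n)"
  proof (intro exI[of _ 0] allI impI)
    fix n
    have "norm (c n * v ^ n) \<le> M / (fact n * b ^ n) * \<bar>v\<bar> ^ n"
      unfolding real_norm_def abs_mult power_abs
      by (intro mult_right_mono c) auto
    then show "norm (c n * v ^ n) \<le> M * (inverse (fact n) * (\<bar>v\<bar> / b) ^ n)"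
      by (simp add: divide_simps power_divide)
  qed
qed

lemma bessel01_summable:
  fixes b v :: real
  assumes "b > 0"
  shows "summable (\<lambda>i. (- 1) ^ i / (fact i * pochhammer b i) * v ^ i)"
proof (rule summable_dominated_exp[OF assms, of _ 1])
  fix i
  show "\<bar>(- 1) ^ i / (fact i * pochhammer b i)\<bar> \<le> 1 / (fact i * b ^ i)"
    using assms pochhammer_ge_power[OF assms, of i] pochhammer_pos[OF assms, of i]
    by (auto simp: abs_mult power_abs intro!: divide_left_mono mult_left_mono mult_pos_pos)
qed

lemma bessel01_0 [simp]: "bessel01 b 0 = 1"
  unfolding bessel01_def by (subst powser_zero) auto

lemma bessel01_deriv:
  assumes b: "b > 0"
  shows "(bessel01 b has_real_derivative - bessel01 (b + 1) v / b) (at v)"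
proof -
  define c where "c = (\<lambda>i. (- 1) ^ i / (fact i * pochhammer b i))"
  have "diffs c i = - (1 / b) * ((- 1) ^ i / (fact i * pochhammer (b + 1) i))" for i
  proof -
    have "pochhammer (b + 1) i \<noteq> 0" using b pochhammer_pos[of "b + 1" i] by simp
    then show ?thesis using b
      unfolding diffs_def c_def by (simp add: pochhammer_rec divide_simps) (simp add: algebra_simps)?
  qed
  then have "(\<Sum>i. diffs c i * v ^ i) = (\<Sum>i. - (1 / b) * ((- 1) ^ i / (fact i * pochhammer (b + 1) i) * v ^ i))"
    by (simp add: mult.assoc)
  also have "\<dots> = - bessel01 (b + 1) v / b"
    unfolding bessel01_def using bessel01_summable[of "b + 1" v] b by (subst suminf_mult) auto
  finally have eq: "(\<Sum>i. diffs c i * v ^ i) = - bessel01 (b + 1) v / b" .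
  have "((\<lambda>v. \<Sum>i. c i * v ^ i) has_real_derivative (\<Sum>i. diffs c i * v ^ i)) (at v)"
    using bessel01_summable[OF b] unfolding c_def by (intro termdiffs_strong_converges_everywhere) auto
  then show ?thesis unfolding eq unfolding bessel01_def c_def .
qed

text \<open>This is the Bessel equation v K'' + b K' + K = 0, with both derivatives expressed by
  \<open>bessel01_deriv\<close> through the parameters b + 1 and b + 2.\<close>

lemma bessel01_contiguous:
  assumes b: "b > 0"
  shows "v / (b + 1) * bessel01 (b + 2) v = b * (bessel01 (b + 1) v - bessel01 b v)"
proof -
  define c where "c = (\<lambda>b i. (- 1) ^ i / (fact i * pochhammer (b::real) i))"
  have S: "summable (\<lambda>i. c b' i * v ^ i)" if "b' > 0" for b'
    using bessel01_summable[OF that] unfolding c_def by simp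
  have K: "bessel01 b' v = (\<Sum>i. c b' i * v ^ i)" for b' unfolding bessel01_def c_def ..
  have "b * (bessel01 (b + 1) v - bessel01 b v) = (\<Sum>i. b * (c (b + 1) i * v ^ i - c b i * v ^ i))"
    unfolding K using S[of "b + 1"] S[of b] b
    by (subst suminf_mult) (auto simp: suminf_diff intro: summable_diff)
  \<comment> \<open>Both series start with 1, so the terms of order 0 cancel and a factor
    \<open>v\<close> can be taken out of the rest.\<close>
  also have "\<dots> = (\<Sum>i. b * (c (b + 1) (Suc i) * v ^ Suc i - c b (Suc i) * v ^ Suc i)) + b * (c (b + 1) 0 * v ^ 0 - c b 0 * v ^ 0)"
    using S[of "b + 1"] S[of b] b
    by (subst suminf_split_head) (auto intro!: summable_mult summable_diff)
  also have "\<dots> = (\<Sum>i. b * (c (b + 1) (Suc i) * v ^ Suc i - c b (Suc i) * v ^ Suc i))"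
    by (simp add: c_def)
  also have "\<dots> = (\<Sum>i. v / (b + 1) * (c (b + 2) i * v ^ i))"
  proof (intro suminf_cong)
    fix i
    have p: "pochhammer (b + 2) i > 0" using b by (intro pochhammer_pos) auto
    have 1: "pochhammer (b + 1) (Suc i) = (b + 1) * pochhammer (b + 2) i"
      by (simp add: pochhammer_rec add.assoc)
    have "pochhammer b (Suc (Suc i)) = b * pochhammer (b + 1) (Suc i)"
      by (rule pochhammer_rec)
    then have "pochhammer b (Suc i) * (b + (real i + 1)) = b * ((b + 1) * pochhammer (b + 2) i)"
      unfolding 1 pochhammer_Suc[of b "Suc i"] by (simp add: algebra_simps)
    then have 2: "pochhammer b (Suc i) = b * ((b + 1) * pochhammer (b + 2) i) / (b + (real i + 1))"
      using b by (simp add: field_simps)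
    show "b * (c (b + 1) (Suc i) * v ^ Suc i - c b (Suc i) * v ^ Suc i) = v / (b + 1) * (c (b + 2) i * v ^ i)"
      using b p unfolding c_def 1 2
      apply (simp add: divide_simps add_pos_nonneg)
      apply (simp add: algebra_simps)
      done
  qed
  also have "\<dots> = v / (b + 1) * bessel01 (b + 2) v"
    unfolding K using S[of "b + 2"] b by (subst suminf_mult) auto
  finally show ?thesis ..
qed

lemma bessel01_abs_le_1:
  assumes b: "b \<ge> 1 / 2" and v: "v \<ge> 0"
  shows "\<bar>bessel01 b v\<bar> \<le> 1"
proof -
  txt \<open>\<open>b\<^sup>2\<close> times the energy \<open>K\<^sup>2 + v K'\<^sup>2\<close> of the Bessel equation \<open>v K'' + b K' + K = 0\<close>.\<close>
  define E where "E = (\<lambda>v. b\<^sup>2 * (bessel01 b v)\<^sup>2 + v * (bessel01 (b + 1) v)\<^sup>2)"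
  have b0: "b > 0" using b by simp
  have "E v \<le> E 0"
  proof (rule DERIV_nonpos_imp_nonincreasing[OF v])
    fix x :: real assume x: "0 \<le> x" "x \<le> v"
    define p q where "p = bessel01 b x" "q = bessel01 (b + 1) x"
    define r where "r = bessel01 (b + 1 + 1) x / (b + 1)"
    have r: "x * r = b * (q - p)"
      using bessel01_contiguous[OF b0] by (simp add: p_q_def r_def add.assoc)
    have "(bessel01 b has_real_derivative - q / b) (at x)"
      "(bessel01 (b + 1) has_real_derivative - r) (at x)"
      unfolding p_q_def r_def using b0 bessel01_deriv[of b x] bessel01_deriv[of "b + 1" x] by auto
    then have "(E has_real_derivative b\<^sup>2 * (2 * p * (- q / b)) + (q\<^sup>2 + x * (2 * q * - r))) (at x)"
      unfolding E_def p_q_def by (auto intro!: derivative_eq_intros)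
    moreover have "b\<^sup>2 * (2 * p * (- q / b)) + (q\<^sup>2 + x * (2 * q * - r)) =
        - 2 * b * p * q + q\<^sup>2 - 2 * q * (x * r)"
      using b0 by (simp add: power2_eq_square)
    \<comment> \<open>Inserting the contiguous relation for \<open>x * r\<close> cancels the mixed
      term. The sign of what remains is where b \<ge> 1/2 enters.\<close>
    moreover have "\<dots> = (1 - 2 * b) * q\<^sup>2"
      unfolding r by (simp add: algebra_simps power2_eq_square)
    moreover have "\<dots> \<le> 0"
      using b by (intro mult_nonpos_nonneg) auto
    ultimately show "\<exists>y. (E has_real_derivative y) (at x) \<and> y \<le> 0" by metis
  qed
  then have "b\<^sup>2 * (bessel01 b v)\<^sup>2 + v * (bessel01 (b + 1) v)\<^sup>2 \<le> b\<^sup>2 * 1"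
    unfolding E_def by simp
  moreover have "v * (bessel01 (b + 1) v)\<^sup>2 \<ge> 0" using v by simp
  ultimately have "b\<^sup>2 * (bessel01 b v)\<^sup>2 \<le> b\<^sup>2 * 1" by linarith
  then have "(bessel01 b v)\<^sup>2 \<le> 1" using b0 by (subst (asm) mult_le_cancel_left_pos) auto
  then show ?thesis using abs_le_square_iff[of "bessel01 b v" 1] by simp
qed

section \<open>The right-hand side \<phi> of the differential equation\<close>

definition hyp_ratio :: "real \<Rightarrow> real \<Rightarrow> real" where
  "hyp_ratio b v = (\<Sum>j. (- 1) ^ j / (fact (Suc j) * pochhammer b j) * v ^ j)"

lemma hyp_ratio_coeff_bound:
  fixes b :: real
  assumes "b > 0"
  shows "\<bar>(- 1) ^ j / (fact (Suc j) * pochhammer b j)\<bar> \<le> 1 / (fact j * b ^ j)"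
proof -
  have "fact j * b ^ j \<le> fact (Suc j) * pochhammer b j"
    using pochhammer_ge_power[OF assms, of j] assms
    by (intro mult_mono fact_mono) auto
  then show ?thesis using assms pochhammer_pos[OF assms, of j]
    by (auto simp: abs_mult power_abs intro!: divide_left_mono mult_pos_pos
             simp del: fact_Suc)
qed

lemma hyp_ratio_summable:
  fixes b v :: real
  assumes "b > 0"
  shows "summable (\<lambda>j. (- 1) ^ j / (fact (Suc j) * pochhammer b j) * v ^ j)"
  by (rule summable_dominated_exp[OF assms hyp_ratio_coeff_bound[OF assms]])

lemma hyp_ratio_0 [simp]: "hyp_ratio b 0 = 1"
  unfolding hyp_ratio_def by (subst powser_zero) auto

text \<open>The series of 1 - K starts at order 1; shifting its index by one divides it by v and
  raises the parameter from b to b + 1. The multiplied form is meaningful at v = 0 as well.\<close>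

lemma hyp_ratio_bessel01:
  assumes b: "b > 0"
  shows "v * hyp_ratio (b + 1) v = b * (1 - bessel01 b v)"
proof -
  have "bessel01 b v = (\<Sum>i. (- 1) ^ Suc i / (fact (Suc i) * pochhammer b (Suc i)) * v ^ Suc i) + 1"
    unfolding bessel01_def using bessel01_summable[OF b] by (subst suminf_split_head) auto
  also have "(\<Sum>i. (- 1) ^ Suc i / (fact (Suc i) * pochhammer b (Suc i)) * v ^ Suc i)
     = (\<Sum>i. - (v / b) * ((- 1) ^ i / (fact (Suc i) * pochhammer (b + 1) i) * v ^ i))"
    using b by (intro suminf_cong) (simp add: pochhammer_rec mult_ac)
  also have "\<dots> = - (v / b) * hyp_ratio (b + 1) v"
    unfolding hyp_ratio_def using hyp_ratio_summable[of "b + 1"] b by (subst suminf_mult) auto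
  finally show ?thesis using b by (simp add: field_simps)
qed

text \<open>Comes from K \<le> 1. The threshold 3/2 is the 1/2 of the energy bound, raised by the
  parameter shift of \<open>hyp_ratio_bessel01\<close>.\<close>

lemma hyp_ratio_nonneg:
  assumes b: "b \<ge> 3 / 2" and v: "v \<ge> 0"
  shows "hyp_ratio b v \<ge> 0"
proof (cases "v = 0")
  case False
  have "v * hyp_ratio (b - 1 + 1) v \<ge> 0"
    using bessel01_abs_le_1[of "b - 1" v] b v by (subst hyp_ratio_bessel01) auto
  then show ?thesis using False v by (simp add: zero_le_mult_iff)
qed auto

text \<open>Comes from the other half of the Bessel bound, K \<ge> -1.\<close>

lemma hyp_ratio_le_inverse:
  assumes b: "b \<ge> 3 / 2" and v: "v > 0"
  shows "hyp_ratio b v \<le> 2 * b / v"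
proof -
  have "v * hyp_ratio (b - 1 + 1) v \<le> (b - 1) * 2"
    using bessel01_abs_le_1[of "b - 1" v] b v
    by (subst hyp_ratio_bessel01) (auto simp only: intro!: mult_left_mono; linarith)+
  then show ?thesis using v b by (simp add: field_simps)
qed

text \<open>The derivative of K is again a Bessel function, so the energy bound at the next
  parameter gives K' \<ge> -1/b0. Hence K(v) \<ge> 1 - v/b0, which is the claim.\<close>

lemma hyp_ratio_le_1:
  assumes b: "b \<ge> 3 / 2" and v: "v \<ge> 0"
  shows "hyp_ratio b v \<le> 1"
proof (cases "v = 0")
  case False
  define b0 where "b0 = b - 1"
  have b0: "b0 \<ge> 1 / 2" "b = b0 + 1" using b by (auto simp: b0_def)
  have "bessel01 b0 0 + 0 / b0 \<le> bessel01 b0 v + v / b0"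
  proof (rule DERIV_nonneg_imp_nondecreasing[OF v])
    fix x assume x: "0 \<le> x" "x \<le> v"
    have "((\<lambda>v. bessel01 b0 v + v / b0) has_real_derivative - bessel01 (b0 + 1) x / b0 + 1 / b0) (at x)"
      using b0 by (auto intro!: derivative_eq_intros bessel01_deriv)
    moreover have "- bessel01 (b0 + 1) x / b0 + 1 / b0 \<ge> 0"
      using bessel01_abs_le_1[of "b0 + 1" x] b0 x by (simp add: field_simps)
    ultimately show "\<exists>y. ((\<lambda>v. bessel01 b0 v + v / b0) has_real_derivative y) (at x) \<and> 0 \<le> y"
      by blast
  qed
  then have "b0 * (1 - bessel01 b0 v) \<le> v * 1" using b0 by (simp add: field_simps)
  then have "v * hyp_ratio b v \<le> v * 1" using b0 by (simp add: hyp_ratio_bessel01)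
  then show ?thesis using v False by simp
qed auto

lemma hyp_ratio_continuous:
  assumes "b > 0"
  shows "isCont (hyp_ratio b) v"
  unfolding hyp_ratio_def[abs_def]
  by (rule isCont_powser_converges_everywhere[OF hyp_ratio_summable[OF assms]])

section \<open>The series H: differential equation, lower and upper bounds\<close>

definition hyp_coeff :: "real \<Rightarrow> real \<Rightarrow> nat \<Rightarrow> real" where
  "hyp_coeff a b j = pochhammer a j / pochhammer (a + 1) j * ((- 1) ^ j / (fact (Suc j) * pochhammer b j))"

definition hyp_mult :: "real \<Rightarrow> real \<Rightarrow> real \<Rightarrow> real" where
  "hyp_mult a b v = (\<Sum>j. hyp_coeff a b j * v ^ j)"

lemma hyp2F3_eq_hyp_mult: "hyp2F3 1 a 2 b (a + 1) (- v) = hyp_mult a b v"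
proof -
  have "pochhammer (2::real) j = fact (Suc j)" for j
    by (metis pochhammer_rec pochhammer_fact mult_1 one_add_one)
  moreover have "pochhammer (1::real) j = fact j" for j by (simp add: pochhammer_fact[symmetric])
  moreover have "(- v) ^ j = (-1) ^ j * v ^ j" for j by (rule power_minus)
  ultimately show ?thesis unfolding hyp2F3_def hyp_mult_def hyp_coeff_def
    by (intro suminf_cong) (simp add: mult_ac del: fact_Suc)
qed

text \<open>Stated without division by \<open>a + j\<close>: for \<open>a = 0\<close> and \<open>j = 0\<close> the quotient is 1, but \<open>a / (a + j)\<close> is \<open>0/0 = 0\<close>.\<close>

lemma pochhammer_quotient:
  assumes "a > (- 1 :: real)"
  shows "(a + real j) * (pochhammer a j / pochhammer (a + 1) j) = a"
proof -
  have "pochhammer (a + 1) j > 0" using assms by (intro pochhammer_pos) auto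
  moreover have "pochhammer a j * (a + real j) = a * pochhammer (a + 1) j"
    using pochhammer_rec[of a j] by (simp add: pochhammer_Suc)
  ultimately show ?thesis by (simp add: field_simps)
qed

lemma hyp_mult_summable:
  assumes a: "a > - 1" and b: "b > 0"
  shows "summable (\<lambda>j. hyp_coeff a b j * v ^ j)"
proof (rule summable_dominated_exp[OF b, of _ "1 + \<bar>a\<bar> / (a + 1)"])
  fix j
  define r where "r = pochhammer a j / pochhammer (a + 1) j"
  \<comment> \<open>The summand 1 is for j = 0, where r = 1. For j \<ge> 1 the denominator of a / (a
    + j) is at least a + 1 > 0.\<close>
  have r: "\<bar>r\<bar> \<le> 1 + \<bar>a\<bar> / (a + 1)"
  proof (cases "j = 0")
    case False
    have "(a + 1) * \<bar>r\<bar> \<le> (a + real j) * \<bar>r\<bar>" using False by (intro mult_right_mono) auto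
    also have "\<dots> = \<bar>(a + real j) * r\<bar>" using a False by (simp add: abs_mult)
    also have "\<dots> = \<bar>a\<bar>" using pochhammer_quotient[OF a] by (simp add: r_def)
    finally show ?thesis using a by (simp add: field_simps)
  qed (use a in \<open>simp add: r_def\<close>)
  have "\<bar>hyp_coeff a b j\<bar> \<le> (1 + \<bar>a\<bar> / (a + 1)) * (1 / (fact j * b ^ j))"
    unfolding hyp_coeff_def abs_mult[of "_ / pochhammer (a+1) j"]
    using r hyp_ratio_coeff_bound[OF b, of j] a unfolding r_def
    by (intro mult_mono) auto
  then show "\<bar>hyp_coeff a b j\<bar> \<le> (1 + \<bar>a\<bar> / (a + 1)) / (fact j * b ^ j)" by simp
qed

lemma hyp_mult_0 [simp]: "hyp_mult a b 0 = 1"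
  unfolding hyp_mult_def hyp_coeff_def by (subst powser_zero) auto

text \<open>Compares coefficients: v d/dv + a multiplies the j-th one by a + j, which
  \<open>pochhammer_quotient\<close> cancels.\<close>

lemma hyp_mult_ode:
  assumes a: "a > - 1" and b: "b > 0"
  obtains D where "(hyp_mult a b has_real_derivative D) (at v)"
    and "v * D = a * hyp_ratio b v - a * hyp_mult a b v"
proof
  define D where "D = (\<Sum>i. diffs (hyp_coeff a b) i * v ^ i)"
  note S = hyp_mult_summable[OF a b]
  show "(hyp_mult a b has_real_derivative D) (at v)"
    unfolding D_def hyp_mult_def[abs_def] using S
    by (intro termdiffs_strong_converges_everywhere) auto
  have SD: "summable (\<lambda>i. diffs (hyp_coeff a b) i * v ^ i)"
    using S by (intro termdiff_converges_all)
  have "v * D = (\<Sum>i. v * (diffs (hyp_coeff a b) i * v ^ i))"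
    unfolding D_def using SD by (rule suminf_mult[symmetric])
  also have "\<dots> = (\<Sum>i. real (Suc i) * hyp_coeff a b (Suc i) * v ^ Suc i)"
    by (intro suminf_cong) (simp add: diffs_def algebra_simps)
  also have "\<dots> = (\<Sum>i. real i * hyp_coeff a b i * v ^ i)"
  proof -
    have "summable (\<lambda>i. v * (diffs (hyp_coeff a b) i * v ^ i))" using SD by (rule summable_mult)
    then have "summable (\<lambda>i. real (Suc i) * hyp_coeff a b (Suc i) * v ^ Suc i)"
      by (simp add: diffs_def algebra_simps)
    then have "summable (\<lambda>i. real i * hyp_coeff a b i * v ^ i)"
      by (subst (asm) summable_Suc_iff)
    from suminf_split_head[OF this] show ?thesis by simp
  qed
  also have "\<dots> = (\<Sum>i. a * ((- 1) ^ i / (fact (Suc i) * pochhammer b i) * v ^ i) - a * (hyp_coeff a b i * v ^ i))"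
  proof (intro suminf_cong)
    fix i
    have "(a + real i) * hyp_coeff a b i = a * ((- 1) ^ i / (fact (Suc i) * pochhammer b i))"
      unfolding hyp_coeff_def using pochhammer_quotient[OF a, of i] by (simp only: mult.assoc[symmetric])
    then have "(a + real i) * hyp_coeff a b i * v ^ i = a * ((- 1) ^ i / (fact (Suc i) * pochhammer b i)) * v ^ i"
      by simp
    then show "real i * hyp_coeff a b i * v ^ i =
         a * ((- 1) ^ i / (fact (Suc i) * pochhammer b i) * v ^ i) - a * (hyp_coeff a b i * v ^ i)"
      by (simp only: mult.assoc[symmetric]) (simp add: algebra_simps)
  qed
  also have "\<dots> = a * hyp_ratio b v - a * hyp_mult a b v"
    unfolding hyp_ratio_def hyp_mult_def using S hyp_ratio_summable[OF b]
    by (subst suminf_diff[symmetric]) (auto intro!: summable_mult simp only: suminf_mult)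
  finally show "v * D = a * hyp_ratio b v - a * hyp_mult a b v" .
qed

lemma hyp_mult_continuous:
  assumes "a > - 1" "b > 0"
  shows "isCont (hyp_mult a b) v"
  using hyp_mult_ode[OF assms, of v] DERIV_isCont by metis

text \<open>v^a is the integrating factor. A constant c solves the equation with right-hand side c
  in place of \<phi>, so subtracting it from H subtracts it from \<phi>.\<close>

lemma hyp_mult_weighted_deriv:
  assumes a: "a > - 1" and b: "b > 0" and v: "v > 0"
  shows "((\<lambda>v. v powr a * (hyp_mult a b v - c)) has_real_derivative
           v powr (a - 1) * (a * (hyp_ratio b v - c))) (at v)"
proof -
  obtain D where D: "(hyp_mult a b has_real_derivative D) (at v)"
    and ode: "v * D = a * hyp_ratio b v - a * hyp_mult a b v"
    using hyp_mult_ode[OF a b] by blast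
  have p: "v powr a = v powr (a - 1) * v" using v by (simp add: powr_diff)
  have "((\<lambda>v. v powr a * (hyp_mult a b v - c)) has_real_derivative
      a * v powr (a - 1) * (hyp_mult a b v - c) + v powr a * D) (at v)"
    using v by (auto intro!: derivative_eq_intros D)
  also have "a * v powr (a - 1) * (hyp_mult a b v - c) + v powr a * D
     = v powr (a - 1) * (a * (hyp_mult a b v - c) + v * D)"
    unfolding p by (simp add: algebra_simps)
  also have "\<dots> = v powr (a - 1) * (a * (hyp_ratio b v - c))"
    unfolding ode by (simp add: algebra_simps)
  finally show ?thesis .
qed

lemma hyp_mult_weighted_mono:
  assumes a: "a > - 1" and b: "b > 0" and u: "0 < u" "u \<le> v"
    and "\<And>x. u \<le> x \<Longrightarrow> x \<le> v \<Longrightarrow> a * (hyp_ratio b x - c) \<ge> 0"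
  shows "u powr a * (hyp_mult a b u - c) \<le> v powr a * (hyp_mult a b v - c)"
proof (rule DERIV_nonneg_imp_nondecreasing[OF u(2)])
  fix x assume "u \<le> x" "x \<le> v"
  then show "\<exists>y. ((\<lambda>v. v powr a * (hyp_mult a b v - c)) has_real_derivative y) (at x) \<and> 0 \<le> y"
    using hyp_mult_weighted_deriv[OF a b, of x c] assms by fastforce
qed

text \<open>H - 1 is of order v, so the product is of order v^(a + 1). This is where \<beta> < n + 4
  is decisive.\<close>

lemma hyp_mult_weighted_tendsto_0:
  assumes a: "a > - 1" and b: "b > 0"
  shows "((\<lambda>v. v powr a * (hyp_mult a b v - 1)) \<longlongrightarrow> 0) (at_right 0)"
proof -
  obtain D where "(hyp_mult a b has_real_derivative D) (at 0)" using hyp_mult_ode[OF a b] by blast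
  then have "((\<lambda>v. (hyp_mult a b v - 1) / v) \<longlongrightarrow> D) (at_right 0)"
    by (auto simp: has_field_derivative_iff intro: tendsto_within_subset)
  moreover have "((\<lambda>v::real. v powr (a + 1)) \<longlongrightarrow> 0) (at_right 0)"
    using a eventually_at_right_less[of "0::real"]
    by (intro tendsto_zero_powrI[where b = "a + 1"]) (auto elim: eventually_mono)
  ultimately have "((\<lambda>v. v powr (a + 1) * ((hyp_mult a b v - 1) / v)) \<longlongrightarrow> 0 * D) (at_right 0)"
    by (intro tendsto_mult)
  moreover have "\<forall>\<^sub>F v in at_right 0. v powr (a + 1) * ((hyp_mult a b v - 1) / v)
      = v powr a * (hyp_mult a b v - 1)"
    using eventually_at_right_less[of "0::real"] by eventually_elim (simp add: powr_add)
  ultimately show ?thesis by (simp add: filterlim_cong)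
qed

text \<open>Here v^a itself tends to 0, so the constant is free.\<close>

lemma hyp_mult_weighted_tendsto_0_pos:
  assumes a: "a > 0" and b: "b > 0"
  shows "((\<lambda>v. v powr a * (hyp_mult a b v - c)) \<longlongrightarrow> 0) (at_right 0)"
proof -
  have "(hyp_mult a b \<longlongrightarrow> hyp_mult a b 0) (at_right 0)"
    using hyp_mult_continuous[of a b 0] a b by (auto simp: isCont_def intro: tendsto_within_subset)
  then have "((\<lambda>v. hyp_mult a b v - c) \<longlongrightarrow> 1 - c) (at_right 0)"
    by (auto intro!: tendsto_eq_intros)
  moreover have "((\<lambda>v::real. v powr a) \<longlongrightarrow> 0) (at_right 0)"
    using a eventually_at_right_less[of "0::real"]
    by (intro tendsto_zero_powrI[where b = "a"]) (auto elim: eventually_mono)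
  ultimately have "((\<lambda>v. v powr a * (hyp_mult a b v - c)) \<longlongrightarrow> 0 * (1 - c)) (at_right 0)"
    by (intro tendsto_mult)
  then show ?thesis by simp
qed

text \<open>The weighted difference increases from its limit 0 at the origin, hence is nonnegative
  at \<open>v\<close>.\<close>

lemma hyp_mult_ge:
  assumes a: "a > - 1" and b: "b > 0" and v: "v > 0"
    and lim: "((\<lambda>v. v powr a * (hyp_mult a b v - c)) \<longlongrightarrow> 0) (at_right 0)"
    and ge: "\<And>x. 0 < x \<Longrightarrow> x \<le> v \<Longrightarrow> a * (hyp_ratio b x - c) \<ge> 0"
  shows "hyp_mult a b v \<ge> c"
proof -
  have "0 \<le> v powr a * (hyp_mult a b v - c)"
  proof (rule tendsto_upperbound[OF lim])
    show "\<forall>\<^sub>F x in at_right 0. x powr a * (hyp_mult a b x - c) \<le> v powr a * (hyp_mult a b v - c)"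
      using eventually_at_right_real[OF v]
    proof eventually_elim
      case (elim x)
      then show ?case by (intro hyp_mult_weighted_mono[OF a b] ge) auto
    qed
  qed auto
  then show ?thesis using v by (simp add: zero_le_mult_iff)
qed

lemma hyp_mult_ge_1:
  assumes a: "a > - 1" "a \<le> 0" and b: "b \<ge> 3 / 2" and v: "v \<ge> 0"
  shows "hyp_mult a b v \<ge> 1"
proof (cases "v = 0")
  case False
  then show ?thesis using a b v
    by (intro hyp_mult_ge hyp_mult_weighted_tendsto_0 mult_nonpos_nonpos)
       (auto simp: hyp_ratio_le_1)
qed simp

text \<open>For a > 0, c = 1/2 gives H \<ge> 1/2 as long as \<phi> \<ge> 1/2; from there on c = 0
  bounds v^a H below by its value at \<open>v0\<close>. For a \<le> 0, once \<phi> \<le> 1/2 the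
  choice c = 1/2 makes v^a (H - 1/2) increase, and H \<ge> 1 makes its starting value positive; c =
  0 would give the wrong sign.\<close>

lemma hyp_mult_lower:
  assumes a: "a > - 1" and b: "b \<ge> 3 / 2"
  obtains c where "c > 0" "\<And>v. v \<ge> 0 \<Longrightarrow> c * (1 + v) powr (- a) \<le> hyp_mult a b v"
proof (cases "a > 0")
  case True
  have b0: "b > 0" using b by simp
  have "\<forall>\<^sub>F x in nhds 0. hyp_ratio b x > 1 / 2"
    using hyp_ratio_continuous[OF b0, of 0] tendsto_at_iff_tendsto_nhds[of "hyp_ratio b" 0]
    by (intro order_tendstoD(1)[where y = 1]) (auto simp: isCont_def)
  then obtain d where d: "d > 0" "\<And>x. dist x 0 < d \<Longrightarrow> hyp_ratio b x > 1 / 2"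
    unfolding eventually_nhds_metric by auto
  define v0 where "v0 = d / 2"
  have v0: "v0 > 0" "\<And>x. 0 \<le> x \<Longrightarrow> x \<le> v0 \<Longrightarrow> hyp_ratio b x \<ge> 1 / 2"
    using d by (auto simp: v0_def dist_real_def less_imp_le)
  have near: "hyp_mult a b v \<ge> 1 / 2" if "0 < v" "v \<le> v0" for v
    using True that v0 b0 by (intro hyp_mult_ge hyp_mult_weighted_tendsto_0_pos) auto
  have far: "hyp_mult a b v \<ge> v0 powr a / 2 * v powr (- a)" if "v \<ge> v0" for v
  proof -
    have "v0 powr a * (hyp_mult a b v0 - 0) \<le> v powr a * (hyp_mult a b v - 0)"
      using True v0 that b b0 by (intro hyp_mult_weighted_mono) (auto simp: hyp_ratio_nonneg)
    moreover have "v0 powr a * (1 / 2) \<le> v0 powr a * hyp_mult a b v0"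
      using near[of v0] v0 by (intro mult_left_mono) auto
    ultimately have "v0 powr a / 2 \<le> v powr a * hyp_mult a b v" unfolding diff_zero by linarith
    then show ?thesis using that v0 by (simp add: powr_minus field_simps)
  qed
  show ?thesis
  proof
    show "min (1 / 2) (v0 powr a / 2) > 0" using v0 by simp
    fix v :: real assume v: "v \<ge> 0"
    show "min (1 / 2) (v0 powr a / 2) * (1 + v) powr (- a) \<le> hyp_mult a b v"
    proof (cases "v \<le> v0")
      case le: True
      have "(1 + v) powr (- a) \<le> 1" using v True
        by (simp add: powr_minus ge_one_powr_ge_zero inverse_le_1_iff)
      then have "min (1 / 2) (v0 powr a / 2) * (1 + v) powr (- a) \<le> 1 / 2 * 1"
        by (intro mult_mono) auto
      also have "\<dots> \<le> hyp_mult a b v" using near[of v] le v by (cases "v = 0") auto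
      finally show ?thesis .
    next
      case False
      have "(1 + v) powr (- a) \<le> v powr (- a)" using False v0 True
        by (intro powr_mono2') auto
      then have "min (1 / 2) (v0 powr a / 2) * (1 + v) powr (- a) \<le> v0 powr a / 2 * v powr (- a)"
        by (intro mult_mono) auto
      also have "\<dots> \<le> hyp_mult a b v" using far[of v] False by simp
      finally show ?thesis .
    qed
  qed
next
  case False
  have b0: "b > 0" using b by simp
  \<comment> \<open>Beyond 4b the bound 2b/v on \<phi> is at most 1/2.\<close>
  define v1 where "v1 = 4 * b"
  have v1: "v1 \<ge> 1" "\<And>x. x \<ge> v1 \<Longrightarrow> hyp_ratio b x \<le> 1 / 2"
  proof -
    fix x assume "x \<ge> v1"
    then show "hyp_ratio b x \<le> 1 / 2"
      using b by (intro order_trans[OF hyp_ratio_le_inverse]) (auto simp: v1_def field_simps)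
  qed (use b in \<open>simp add: v1_def\<close>)
  have ge1: "hyp_mult a b v \<ge> 1" if "v \<ge> 0" for v
    using hyp_mult_ge_1[OF a _ b that] False by simp
  have far: "hyp_mult a b v \<ge> v1 powr a / 2 * v powr (- a)" if "v \<ge> v1" for v
  proof -
    have "v1 powr a * (hyp_mult a b v1 - 1 / 2) \<le> v powr a * (hyp_mult a b v - 1 / 2)"
      using False v1 that b0 by (intro hyp_mult_weighted_mono[OF a] mult_nonpos_nonpos) auto
    moreover have "v1 powr a * (1 / 2) \<le> v1 powr a * (hyp_mult a b v1 - 1 / 2)"
      using ge1[of v1] v1 by (intro mult_left_mono) auto
    ultimately have "v1 powr a / 2 \<le> v powr a * hyp_mult a b v"
      using powr_ge_zero[of v a] unfolding right_diff_distrib by linarith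
    then show ?thesis using that v1 by (simp add: powr_minus field_simps)
  qed
  show ?thesis
  proof
    \<comment> \<open>\<open>(1 + v1) powr a\<close> normalises the bound to at most 1 for v \<le>
      v1. \<open>(1 / 2) powr (- a)\<close> replaces 1 + v by (1 + v)/2, which is at most v for v
      \<ge> v1 \<ge> 1.\<close>
    show "(1 + v1) powr a * (1 / 2) powr (- a) / 2 > 0" using v1 by simp
    fix v :: real assume v: "v \<ge> 0"
    have h: "(1 / 2 :: real) powr (- a) \<le> 1" using False by (intro powr_le1) auto
    show "(1 + v1) powr a * (1 / 2) powr (- a) / 2 * (1 + v) powr (- a) \<le> hyp_mult a b v"
    proof (cases "v \<le> v1")
      case True
      have "(1 + v) powr (- a) \<le> (1 + v1) powr (- a)"
        using v True False by (intro powr_mono2) auto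
      then have "(1 + v1) powr a * (1 / 2) powr (- a) / 2 * (1 + v) powr (- a)
         \<le> (1 + v1) powr a * 1 / 1 * (1 + v1) powr (- a)"
        using h by (intro mult_mono frac_le) auto
      also have "\<dots> = 1" using v1 by (simp add: powr_minus)
      finally show ?thesis using ge1[OF v] by simp
    next
      case far': False
      have "(1 / 2) powr (- a) * (1 + v) powr (- a) = ((1 + v) / 2) powr (- a)"
        using v by (simp flip: powr_mult)
      also have "\<dots> \<le> v powr (- a)" using far' v1 False by (intro powr_mono2) auto
      finally have 1: "(1 / 2) powr (- a) * (1 + v) powr (- a) \<le> v powr (- a)" .
      have 2: "(1 + v1) powr a \<le> v1 powr a" using v1 False by (intro powr_mono2') auto
      have "(1 + v1) powr a * (1 / 2) powr (- a) / 2 * (1 + v) powr (- a)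
         = (1 + v1) powr a / 2 * ((1 / 2) powr (- a) * (1 + v) powr (- a))" by simp
      also have "\<dots> \<le> v1 powr a / 2 * v powr (- a)"
        using 1 2 by (intro mult_mono) auto
      also have "\<dots> \<le> hyp_mult a b v" using far far' by simp
      finally show ?thesis .
    qed
  qed
qed

text \<open>Linear growth is enough, as the frequencies need only be polynomially bounded. Beyond v
  = 1: for a \<ge> 0, \<phi> \<le> 1 keeps v^a (H - 1) from increasing; for a < 0, \<phi> \<ge> 0
  does so for v^a H, and -a < 1 bounds v^-a by v.\<close>

lemma hyp_mult_upper:
  assumes a: "a > - 1" and b: "b \<ge> 3 / 2"
  obtains C where "\<And>v. v \<ge> 0 \<Longrightarrow> hyp_mult a b v \<le> C * (1 + v)"
proof -
  have b0: "b > 0" using b by simp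
  have "compact (hyp_mult a b ` {0..1})"
    using hyp_mult_continuous[OF a b0]
    by (intro compact_continuous_image continuous_at_imp_continuous_on) auto
  then have "bounded (hyp_mult a b ` {0..1})" by (rule compact_imp_bounded)
  then obtain M where M: "\<And>v. 0 \<le> v \<Longrightarrow> v \<le> 1 \<Longrightarrow> \<bar>hyp_mult a b v\<bar> \<le> M"
    unfolding bounded_iff by (metis atLeastAtMost_iff imageI real_norm_def)
  have M1: "\<bar>hyp_mult a b 1\<bar> \<le> M" using M[of 1] by simp
  have far: "hyp_mult a b v \<le> (1 + M) * (1 + v)" if v: "v \<ge> 1" for v
  proof (cases "a \<ge> 0")
    case True
    have "v powr a * (1 - hyp_mult a b v) \<ge> 1 powr a * (1 - hyp_mult a b 1)"
    proof (rule DERIV_nonneg_imp_nondecreasing[OF v])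
      fix x :: real assume x: "1 \<le> x" "x \<le> v"
      have "((\<lambda>v. - (v powr a * (hyp_mult a b v - 1))) has_real_derivative
         - (x powr (a - 1) * (a * (hyp_ratio b x - 1)))) (at x)"
        using x by (intro DERIV_minus hyp_mult_weighted_deriv[OF a b0]) auto
      moreover have "- (x powr (a - 1) * (a * (hyp_ratio b x - 1))) \<ge> 0"
        using True hyp_ratio_le_1[OF b, of x] x
        by (simp add: mult_nonneg_nonpos)
      ultimately show "\<exists>y. ((\<lambda>v. v powr a * (1 - hyp_mult a b v)) has_real_derivative y) (at x) \<and> 0 \<le> y"
        by (intro exI[of _ "- (x powr (a - 1) * (a * (hyp_ratio b x - 1)))"]) (simp add: algebra_simps)
    qed
    then have le: "v powr a * (hyp_mult a b v - 1) \<le> M" using M1 by (simp add: algebra_simps)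
    show ?thesis
    proof (cases "hyp_mult a b v \<le> 1")
      case True
      have "1 * 1 \<le> (1 + M) * (1 + v)" using v M1 by (intro mult_mono) auto
      then show ?thesis using True by linarith
    next
      case False
      have "1 * (hyp_mult a b v - 1) \<le> v powr a * (hyp_mult a b v - 1)"
        using v \<open>a \<ge> 0\<close> False by (intro mult_right_mono ge_one_powr_ge_zero) auto
      then have "hyp_mult a b v \<le> (1 + M) * 1" using le by simp
      also have "\<dots> \<le> (1 + M) * (1 + v)" using v M1 by (intro mult_left_mono) auto
      finally show ?thesis .
    qed
  next
    case False
    have "v powr a * hyp_mult a b v \<le> 1 powr a * hyp_mult a b 1"
    proof (rule DERIV_nonpos_imp_nonincreasing[OF v])
      fix x :: real assume x: "1 \<le> x" "x \<le> v"
      have "((\<lambda>v. v powr a * hyp_mult a b v) has_real_derivative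
         x powr (a - 1) * (a * hyp_ratio b x)) (at x)"
        using x hyp_mult_weighted_deriv[OF a b0, of x 0] by simp
      moreover have "x powr (a - 1) * (a * hyp_ratio b x) \<le> 0"
        using False hyp_ratio_nonneg[OF b, of x] x
        by (simp add: mult_nonneg_nonpos mult_nonpos_nonneg)
      ultimately show "\<exists>y. ((\<lambda>v. v powr a * hyp_mult a b v) has_real_derivative y) (at x) \<and> y \<le> 0"
        by blast
    qed
    then have "hyp_mult a b v \<le> hyp_mult a b 1 * v powr (- a)"
      using v by (simp add: powr_minus field_simps)
    also have "\<dots> \<le> (1 + M) * (1 + v)"
    proof (intro mult_mono)
      have "v powr (- a) \<le> v powr 1" using v a by (intro powr_mono) auto
      then show "v powr (- a) \<le> 1 + v" using v by simp
    qed (use M1 v in auto)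
    finally show ?thesis .
  qed
  show ?thesis
  proof
    fix v :: real assume v: "v \<ge> 0"
    show "hyp_mult a b v \<le> (1 + M) * (1 + v)"
    proof (cases "v \<le> 1")
      case True
      have "hyp_mult a b v \<le> (1 + M) * 1" using M[OF v True] by simp
      also have "\<dots> \<le> (1 + M) * (1 + v)" using v M1 by (intro mult_left_mono) auto
      finally show ?thesis .
    qed (use far in auto)
  qed
qed

lemma multiplier_eq:
  "multiplier \<delta> \<beta> (\<nu> :: real^'n::finite) =
     - (norm \<nu>)\<^sup>2 * hyp_mult ((real CARD('n) + 2 - \<beta>) / 2) ((real CARD('n) + 2) / 2) ((norm \<nu>)\<^sup>2 * \<delta>\<^sup>2 / 4)"
proof -
  have "(real CARD('n) + 4 - \<beta>) / 2 = (real CARD('n) + 2 - \<beta>) / 2 + 1" by (simp add: field_simps)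
  moreover have "- (1 / 4) * (norm \<nu>)\<^sup>2 * \<delta>\<^sup>2 = - ((norm \<nu>)\<^sup>2 * \<delta>\<^sup>2 / 4)" by simp
  ultimately show ?thesis unfolding multiplier_def by (simp only: hyp2F3_eq_hyp_mult)
qed

section \<open>Fourier series of test functions and distributions\<close>

lemma real_vec_nth [simp]: "real_vec k $ j = real_of_int (k $ j)"
  by (simp add: real_vec_def)

lemma real_vec_0 [simp]: "real_vec 0 = 0"
  by (simp add: vec_eq_iff)

lemma real_vec_minus [simp]: "real_vec (- k) = - real_vec k"
  by (simp add: vec_eq_iff)

lemma real_vec_add [simp]: "real_vec (k + l) = real_vec k + real_vec l"
  by (simp add: vec_eq_iff)

lemma real_vec_eq_0_iff [simp]: "real_vec k = 0 \<longleftrightarrow> k = 0"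
  by (simp add: vec_eq_iff)

lemma fourier_mode_0 [simp]: "fourier_mode 0 x = 1"
  by (simp add: fourier_mode_def)

lemma fourier_mode_add: "fourier_mode (k + l) x = fourier_mode k x * fourier_mode l x"
  by (simp add: fourier_mode_def inner_add_left distrib_left exp_add)

lemma norm_fourier_mode [simp]: "norm (fourier_mode k x) = 1"
  by (simp add: fourier_mode_def)

lemma continuous_on_fourier_mode [continuous_intros]: "continuous_on S (fourier_mode k)"
  unfolding fourier_mode_def[abs_def] by (intro continuous_intros)

lemma has_vector_derivative_fourier_mode:
  "((\<lambda>h. fourier_mode k (x + h *\<^sub>R axis j 1)) has_vector_derivative
     \<i> * of_int (k $ j) * fourier_mode k x) (at 0)"
proof -
  have "((\<lambda>h. real_vec k \<bullet> (x + h *\<^sub>R axis j 1)) has_real_derivative of_int (k $ j)) (at 0)"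
    by (auto simp: inner_add_right inner_axis intro!: derivative_eq_intros)
  from has_vector_derivative_of_real[OF this]
  have "((\<lambda>h. complex_of_real (real_vec k \<bullet> (x + h *\<^sub>R axis j 1))) has_vector_derivative of_int (k $ j)) (at 0)"
    by simp
  then have "((\<lambda>h. \<i> * of_real (real_vec k \<bullet> (x + h *\<^sub>R axis j 1))) has_vector_derivative \<i> * of_int (k $ j)) (at 0)"
    by (rule has_vector_derivative_mult_right)
  from field_vector_diff_chain_at[OF this, of exp "exp (\<i> * of_real (real_vec k \<bullet> x))"]
  show ?thesis by (auto simp: fourier_mode_def o_def intro: DERIV_exp)
qed

lemma periodic_lattice:
  fixes \<phi> :: "real^'n::finite \<Rightarrow> 'a"
  assumes per: "\<And>j x. \<phi> (x + (2 * pi) *\<^sub>R axis j 1) = \<phi> x"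
  shows "\<phi> (x + (2 * pi) *\<^sub>R real_vec k) = \<phi> x"
proof -
  have nat: "\<phi> (x + (2 * pi * real m) *\<^sub>R axis j 1) = \<phi> x" for m j x
  proof (induction m)
    case (Suc m)
    have "x + (2 * pi * real (Suc m)) *\<^sub>R axis j 1 = (x + (2 * pi * real m) *\<^sub>R axis j 1) + (2 * pi) *\<^sub>R axis j 1"
      by (simp add: algebra_simps)
    then show ?case using Suc per by metis
  qed simp
  have int: "\<phi> (x + (2 * pi * of_int m) *\<^sub>R axis j 1) = \<phi> x" for m j x
  proof (cases "m \<ge> 0")
    case True
    then show ?thesis using nat[of x "nat m" j] by simp
  next
    case False
    \<comment> \<open>From the translated point, \<open>- m\<close> periods lead back to
      \<open>x\<close>.\<close>
    then show ?thesis using nat[of "x + (2 * pi * of_int m) *\<^sub>R axis j 1" "nat (- m)" j]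
      by (simp add: algebra_simps)
  qed
  have fin: "\<phi> (x + (\<Sum>j\<in>J. (2 * pi * of_int (k $ j)) *\<^sub>R axis j 1)) = \<phi> x" if "finite J" for J
    using that
  proof induction
    case (insert j J)
    then show ?case
      using int[of "x + (\<Sum>j\<in>J. (2 * pi * of_int (k $ j)) *\<^sub>R axis j 1)" "k $ j" j]
      by (simp add: add_ac)
  qed simp
  have "(\<Sum>j\<in>UNIV. (2 * pi * of_int (k $ j)) *\<^sub>R axis j 1) = (2 * pi) *\<^sub>R real_vec k"
    by (simp add: vec_eq_iff axis_def if_distrib cong: if_cong)
  then show ?thesis using fin[of UNIV] by simp
qed

lemma torus_representative:
  obtains y k where "y \<in> torus" "x = y + (2 * pi) *\<^sub>R real_vec k"
proof
  define k :: "int^'a" where "k = (\<chi> j. \<lfloor>x $ j / (2 * pi)\<rfloor>)"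
  show "x = (x - (2 * pi) *\<^sub>R real_vec k) + (2 * pi) *\<^sub>R real_vec k" by simp
  show "x - (2 * pi) *\<^sub>R real_vec k \<in> torus"
    unfolding torus_def mem_box_cart
  proof
    fix j
    have "of_int \<lfloor>x $ j / (2 * pi)\<rfloor> \<le> x $ j / (2 * pi)" "x $ j / (2 * pi) \<le> of_int \<lfloor>x $ j / (2 * pi)\<rfloor> + 1"
      by linarith+
    then have "of_int \<lfloor>x $ j / (2 * pi)\<rfloor> * (2 * pi) \<le> x $ j" "x $ j \<le> (of_int \<lfloor>x $ j / (2 * pi)\<rfloor> + 1) * (2 * pi)"
      by (simp_all only: pos_le_divide_eq pos_divide_le_eq pi_gt_zero mult_pos_pos zero_less_numeral)
    then show "0 $ j \<le> (x - (2 * pi) *\<^sub>R real_vec k) $ j \<and> (x - (2 * pi) *\<^sub>R real_vec k) $ j \<le> (\<chi> j. 2 * pi) $ j"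
      by (simp add: k_def algebra_simps)
  qed
qed

lemma compact_torus [simp]: "compact torus"
  by (simp add: torus_def)

lemma measure_torus: "measure lborel (torus :: (real^'n::finite) set) = (2 * pi) ^ CARD('n)"
proof -
  have "(torus :: (real^'n) set) \<noteq> {}"
    by (simp add: torus_def interval_ne_empty_cart)
  then show ?thesis unfolding torus_def by (subst content_cbox_cart) auto
qed

lemma integrable_on_torus:
  "continuous_on UNIV \<phi> \<Longrightarrow> (\<phi> :: real^'n::finite \<Rightarrow> complex) integrable_on torus"
  unfolding torus_def by (rule integrable_continuous) (blast intro: continuous_on_subset)

lemma norm_integral_torus_le:
  assumes "continuous_on UNIV (\<phi> :: real^'n::finite \<Rightarrow> complex)" "\<And>x. norm (\<phi> x) \<le> B"
  shows "norm (integral torus \<phi>) \<le> B * (2 * pi) ^ CARD('n)"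
proof -
  have "B \<ge> 0" using assms(2)[of 0] norm_ge_zero order_trans by blast
  then show ?thesis
    unfolding measure_torus [symmetric] unfolding torus_def
    using has_integral_bound[OF _ integrable_integral[OF integrable_on_torus[OF assms(1)], unfolded torus_def]] assms(2)
    by blast
qed

lemma periodic_bounded:
  fixes \<phi> :: "real^'n::finite \<Rightarrow> 'a::real_normed_vector"
  assumes "continuous_on UNIV \<phi>" and per: "\<And>j x. \<phi> (x + (2 * pi) *\<^sub>R axis j 1) = \<phi> x"
  obtains B where "\<And>x. norm (\<phi> x) \<le> B"
proof -
  have "compact (\<phi> ` torus)"
    by (intro compact_continuous_image compact_torus) (blast intro: assms(1) continuous_on_subset)
  then have "bounded (\<phi> ` torus)" by (rule compact_imp_bounded)
  then obtain B where B: "\<And>y. y \<in> torus \<Longrightarrow> norm (\<phi> y) \<le> B" unfolding bounded_iff by blast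
  show ?thesis
  proof
    fix x
    obtain y :: "real^'n" and k where "y \<in> torus" "x = y + (2 * pi) *\<^sub>R real_vec k" by (rule torus_representative)
    then show "norm (\<phi> x) \<le> B" using B periodic_lattice[of \<phi>, OF per] by metis
  qed
qed

text \<open>The shifted box sticks out beyond 2 pi in direction \<open>j\<close>. Cut there and
  moved back by one period, the overhang fills exactly the gap between 0 and
  \<open>h\<close>.\<close>

lemma integral_torus_translate:
  fixes \<psi> :: "real^'n::finite \<Rightarrow> complex"
  assumes cont: "continuous_on UNIV \<psi>" and per: "\<And>x. \<psi> (x + (2 * pi) *\<^sub>R axis j 1) = \<psi> x"
    and h: "0 \<le> h" "h \<le> 2 * pi"
  shows "integral torus (\<lambda>x. \<psi> (x + h *\<^sub>R axis j 1)) = integral torus \<psi>"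
proof -
  let ?e = "axis j (1::real) :: real^'n"
  define b :: "real^'n" where "b = (\<chi> i. 2 * pi)"
  have int: "\<psi> integrable_on cbox u v" for u v
    by (rule integrable_continuous) (blast intro: cont continuous_on_subset)
  have le: "cbox u v \<inter> {x. x \<bullet> ?e \<le> c} = cbox u (\<chi> i. if i = j then min (v $ j) c else v $ i)"
    and ge: "cbox u v \<inter> {x. x \<bullet> ?e \<ge> c} = cbox (\<chi> i. if i = j then max (u $ j) c else u $ i) v"
    for u v :: "real^'n" and c
    using interval_split_cart[where a = u and b = v and c = c and k = j] by (simp_all add: inner_axis interval_cbox_cart)
  have split: "integral (cbox u v) \<psi> =
      integral (cbox u (\<chi> i. if i = j then min (v $ j) c else v $ i)) \<psi>
      + integral (cbox (\<chi> i. if i = j then max (u $ j) c else u $ i) v) \<psi>" for u v c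
    using has_integral_split[of \<psi> _ u v ?e c, unfolded le ge, OF integrable_integral integrable_integral, OF int int]
    by (intro integral_unique) (auto simp: axis_in_Basis_iff)
  have shift: "integral (cbox u v) (\<lambda>x. \<psi> (x + c *\<^sub>R ?e)) = integral (cbox (u + c *\<^sub>R ?e) (v + c *\<^sub>R ?e)) \<psi>" for u v c
    using integral_shift_cbox_plus[of u v \<psi> "c *\<^sub>R ?e"] by (simp add: o_def add.commute)
  have "integral torus (\<lambda>x. \<psi> (x + h *\<^sub>R ?e)) = integral (cbox (h *\<^sub>R ?e) (b + h *\<^sub>R ?e)) \<psi>"
    unfolding torus_def using shift[of 0 b h] by (simp add: b_def)
  also have "\<dots> = integral (cbox (h *\<^sub>R ?e) b) \<psi> + integral (cbox ((2 * pi) *\<^sub>R ?e) (b + h *\<^sub>R ?e)) \<psi>"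
  proof -
    have "(\<chi> i. if i = j then min ((b + h *\<^sub>R ?e) $ j) (2 * pi) else (b + h *\<^sub>R ?e) $ i) = b"
      "(\<chi> i. if i = j then max ((h *\<^sub>R ?e) $ j) (2 * pi) else (h *\<^sub>R ?e) $ i) = (2 * pi) *\<^sub>R ?e"
      using h by (auto simp: vec_eq_iff b_def axis_def)
    then show ?thesis using split[of "h *\<^sub>R ?e" "b + h *\<^sub>R ?e" "2 * pi"] by simp
  qed
  also have "integral (cbox ((2 * pi) *\<^sub>R ?e) (b + h *\<^sub>R ?e)) \<psi> = integral (cbox 0 (b + (h - 2 * pi) *\<^sub>R ?e)) \<psi>"
    using shift[of 0 "b + (h - 2 * pi) *\<^sub>R ?e" "2 * pi"] unfolding per by (simp add: algebra_simps)
  also have "integral (cbox (h *\<^sub>R ?e) b) \<psi> + integral (cbox 0 (b + (h - 2 * pi) *\<^sub>R ?e)) \<psi> = integral (cbox 0 b) \<psi>"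
  proof -
    have "(\<chi> i. if i = j then min (b $ j) h else b $ i) = b + (h - 2 * pi) *\<^sub>R ?e"
      "(\<chi> i. if i = j then max (0 $ j) h else 0 $ i) = h *\<^sub>R ?e"
      using h by (auto simp: vec_eq_iff b_def axis_def)
    then show ?thesis using split[of 0 b h] by simp
  qed
  finally show ?thesis by (simp add: torus_def b_def)
qed

text \<open>Translating a periodic function does not change its integral over the torus;
  differentiating in the translation parameter kills the integral of a partial derivative.\<close>

lemma integral_torus_partial_deriv:
  fixes \<psi> :: "real^'n::finite \<Rightarrow> complex"
  assumes cont: "continuous_on UNIV \<psi>" and per: "\<And>x. \<psi> (x + (2 * pi) *\<^sub>R axis j 1) = \<psi> x"
    and deriv: "\<And>x. ((\<lambda>h. \<psi> (x + h *\<^sub>R axis j 1)) has_vector_derivative D x) (at 0)"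
    and contD: "continuous_on UNIV D"
  shows "integral torus D = 0"
proof -
  let ?U = "{0..2 * pi}"
  have "((\<lambda>h. \<psi> (x + h *\<^sub>R axis j 1)) has_vector_derivative D (x + h0 *\<^sub>R axis j 1)) (at h0)" for h0 x
  proof -
    have "((\<lambda>h. h - h0) has_vector_derivative 1) (at h0)"
      by (auto intro!: derivative_eq_intros)
    from vector_diff_chain_at[OF this, of "\<lambda>h. \<psi> (x + h0 *\<^sub>R axis j 1 + h *\<^sub>R axis j 1)"]
    show ?thesis using deriv[of "x + h0 *\<^sub>R axis j 1"] by (simp add: o_def algebra_simps)
  qed
  \<comment> \<open>The parameter stays in [0, 2 pi], where \<open>integral_torus_translate\<close>
    applies; the derivative at 0 is therefore one-sided.\<close>
  then have "((\<lambda>h. integral torus (\<lambda>x. \<psi> (x + h *\<^sub>R axis j 1))) has_vector_derivative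
      integral torus (\<lambda>x. D (x + 0 *\<^sub>R axis j 1))) (at 0 within ?U)"
    unfolding torus_def
  proof (intro leibniz_rule_vector_derivative)
    fix h
    have "continuous_on UNIV (\<lambda>x. \<psi> (x + h *\<^sub>R axis j 1))"
      by (intro continuous_on_compose2[OF cont] continuous_intros) auto
    then show "(\<lambda>x. \<psi> (x + h *\<^sub>R axis j 1)) integrable_on cbox 0 (\<chi> j. 2 * pi)"
      using integrable_on_torus unfolding torus_def by blast
  next
    show "continuous_on (?U \<times> cbox 0 (\<chi> j. 2 * pi)) (\<lambda>(h, x). D (x + h *\<^sub>R axis j 1))"
      unfolding case_prod_unfold by (intro continuous_on_compose2[OF contD] continuous_intros) auto
  qed (auto intro: has_vector_derivative_at_within)
  then have "((\<lambda>h. integral torus \<psi>) has_vector_derivative integral torus D) (at 0 within ?U)"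
    unfolding scaleR_zero_left add_0_right
    by (rule has_vector_derivative_transform[rotated 2]) (use integral_torus_translate[of \<psi> j, OF cont per] in auto)
  moreover have "((\<lambda>h. integral torus \<psi>) has_vector_derivative 0) (at 0 within ?U)"
    by simp
  moreover have "at (0::real) within ?U \<noteq> bot"
    by (simp add: trivial_limit_within islimpt_Icc)
  ultimately show ?thesis by (rule vector_derivative_unique_within[rotated])
qed

section \<open>Smooth periodic functions and their iterated derivatives\<close>

lemma smooth_has_vector_derivative:
  assumes "smooth \<phi>"
  shows "((\<lambda>h. iter_partial js \<phi> (x + h *\<^sub>R axis j 1)) has_vector_derivative
           iter_partial (j # js) \<phi> x) (at 0)"
  using assms unfolding smooth_def iter_partial_def
  by (simp add: partial_deriv_def vector_derivative_works)

lemma smooth_continuous: "smooth \<phi> \<Longrightarrow> continuous_on S (iter_partial js \<phi>)"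
  unfolding smooth_def by (blast intro: continuous_on_subset)

lemma iter_partial_Nil [simp]: "iter_partial [] \<phi> = \<phi>"
  by (simp add: iter_partial_def)

lemma iter_partial_append: "iter_partial js (iter_partial ks \<phi>) = iter_partial (js @ ks) \<phi>"
  by (simp add: iter_partial_def)

lemma iter_partial_Cons_eqI:
  assumes "\<And>x. ((\<lambda>h. iter_partial js \<phi> (x + h *\<^sub>R axis j 1)) has_vector_derivative D x) (at 0)"
  shows "iter_partial (j # js) \<phi> = D"
  using assms by (auto simp: iter_partial_def partial_deriv_def fun_eq_iff vector_derivative_at)

text \<open>\<open>D\<close> proposes all iterated derivatives at once and induction on the list
  confirms them. A closure property then needs only continuity and one differentiation rule.\<close>

lemma smoothI:
  assumes "\<And>js. continuous_on UNIV (D js)" "D [] = \<phi>"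
    and deriv: "\<And>j js x. ((\<lambda>h. D js (x + h *\<^sub>R axis j 1)) has_vector_derivative D (j # js) x) (at 0)"
  shows "smooth \<phi>" "iter_partial js \<phi> = D js"
proof -
  have *: "iter_partial js \<phi> = D js" for js
  proof (induction js)
    case (Cons j js)
    then show ?case using deriv by (intro iter_partial_Cons_eqI) simp
  qed (use assms(2) in simp)
  show "smooth \<phi>" "iter_partial js \<phi> = D js"
    unfolding smooth_def * using assms(1) differentiableI_vector[OF deriv] by auto
qed

lemma test_smooth: "\<phi> \<in> test_functions \<Longrightarrow> smooth \<phi>"
  and test_periodic: "\<phi> \<in> test_functions \<Longrightarrow> \<phi> (x + (2 * pi) *\<^sub>R axis j 1) = \<phi> x"
  by (auto simp: test_functions_def)

lemma test_continuous: "\<phi> \<in> test_functions \<Longrightarrow> continuous_on S \<phi>"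
  using smooth_continuous[of \<phi> S "[]"] by (simp add: test_smooth)

lemma iter_partial_periodic:
  assumes "\<And>j x. \<phi> (x + (2 * pi) *\<^sub>R axis j 1) = \<phi> x"
  shows "iter_partial js \<phi> (x + (2 * pi) *\<^sub>R axis j 1) = iter_partial js \<phi> x"
proof (induction js arbitrary: x)
  case (Cons i js)
  have "iter_partial js \<phi> (x + (2 * pi) *\<^sub>R axis j 1 + h *\<^sub>R axis i 1) = iter_partial js \<phi> (x + h *\<^sub>R axis i 1)" for h
    using Cons[of "x + h *\<^sub>R axis i 1"] by (simp add: add_ac)
  then show ?case by (simp add: iter_partial_def partial_deriv_def)
qed (use assms in simp)

lemma test_iter_partial:
  assumes "\<phi> \<in> test_functions"
  shows "iter_partial js \<phi> \<in> test_functions"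
proof -
  have "smooth (iter_partial js \<phi>)"
    using test_smooth[OF assms] unfolding smooth_def iter_partial_append by blast
  then show ?thesis
    using iter_partial_periodic[of \<phi>, OF test_periodic[OF assms]] unfolding test_functions_def by blast
qed

lemma
  fixes \<phi> \<psi> :: "real^'n::finite \<Rightarrow> complex"
  assumes "\<phi> \<in> test_functions" "\<psi> \<in> test_functions"
  shows test_lincomb: "(\<lambda>x. a * \<phi> x + b * \<psi> x) \<in> test_functions"
    and iter_partial_lincomb: "iter_partial js (\<lambda>x. a * \<phi> x + b * \<psi> x) =
         (\<lambda>x. a * iter_partial js \<phi> x + b * iter_partial js \<psi> x)"
proof -
  define D where "D = (\<lambda>js x. a * iter_partial js \<phi> x + b * iter_partial js \<psi> x)"
  have *: "smooth (\<lambda>x. a * \<phi> x + b * \<psi> x)" "iter_partial js (\<lambda>x. a * \<phi> x + b * \<psi> x) = D js"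
    using assms[THEN test_smooth] unfolding D_def
    by (intro smoothI[where D = D, unfolded D_def];
        auto intro!: continuous_intros smooth_continuous smooth_has_vector_derivative
          has_vector_derivative_add has_vector_derivative_mult_right)+
  then show "(\<lambda>x. a * \<phi> x + b * \<psi> x) \<in> test_functions"
    using assms unfolding test_functions_def by auto
  show "iter_partial js (\<lambda>x. a * \<phi> x + b * \<psi> x) =
         (\<lambda>x. a * iter_partial js \<phi> x + b * iter_partial js \<psi> x)"
    using * by (simp add: D_def)
qed

lemma fourier_mode_periodic: "fourier_mode k (x + (2 * pi) *\<^sub>R axis j 1) = fourier_mode k x"
proof -
  have "fourier_mode k (x + (2 * pi) *\<^sub>R axis j 1) =
      exp (\<i> * complex_of_real (real_vec k \<bullet> x) + (of_int (2 * (k $ j)) * pi) * \<i>)"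
    by (simp add: fourier_mode_def inner_add_right inner_axis algebra_simps)
  also have "\<dots> = fourier_mode k x" unfolding fourier_mode_def by (subst exp_eq) blast
  finally show ?thesis .
qed

lemma
  shows test_fourier_mode [simp]: "fourier_mode k \<in> test_functions"
    and iter_partial_fourier_mode: "iter_partial js (fourier_mode k) =
         (\<lambda>x. (\<Prod>j\<leftarrow>js. \<i> * of_int (k $ j)) * fourier_mode k x)"
proof -
  define D where "D = (\<lambda>js x. (\<Prod>j\<leftarrow>js. \<i> * complex_of_int (k $ j)) * fourier_mode k x)"
  have "((\<lambda>h. D js (x + h *\<^sub>R axis j 1)) has_vector_derivative D (j # js) x) (at 0)" for j js x
    using has_vector_derivative_mult_right[OF has_vector_derivative_fourier_mode[of k x j],
        of "\<Prod>j\<leftarrow>js. \<i> * complex_of_int (k $ j)"]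
    unfolding D_def by (simp add: mult_ac)
  then have *: "smooth (fourier_mode k)" "iter_partial js (fourier_mode k) = D js" for js
    by (intro smoothI[where D = D]; auto simp: D_def intro!: continuous_intros)+
  then show "fourier_mode k \<in> test_functions" using fourier_mode_periodic
    unfolding test_functions_def by blast
  show "iter_partial js (fourier_mode k) = (\<lambda>x. (\<Prod>j\<leftarrow>js. \<i> * of_int (k $ j)) * fourier_mode k x)"
    using * by (simp add: D_def)
qed

lemma test_zero: "(\<lambda>x. 0) \<in> test_functions"
  using test_lincomb[OF test_fourier_mode[of 0] test_fourier_mode[of 0], of 0 0] by simp

lemma iter_partial_zero: "iter_partial js (\<lambda>x. 0) = (\<lambda>x. 0)"
  using iter_partial_lincomb[OF test_fourier_mode[of 0] test_fourier_mode[of 0], of js 0 0] by simp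

lemma
  assumes "finite F" "\<And>k. \<phi> k \<in> test_functions"
  shows test_sum: "(\<lambda>x. \<Sum>k\<in>F. c k * \<phi> k x) \<in> test_functions"
    and iter_partial_sum: "iter_partial js (\<lambda>x. \<Sum>k\<in>F. c k * \<phi> k x) =
         (\<lambda>x. \<Sum>k\<in>F. c k * iter_partial js (\<phi> k) x)"
proof -
  have "(\<lambda>x. \<Sum>k\<in>F. c k * \<phi> k x) \<in> test_functions \<and> iter_partial js (\<lambda>x. \<Sum>k\<in>F. c k * \<phi> k x) =
         (\<lambda>x. \<Sum>k\<in>F. c k * iter_partial js (\<phi> k) x)"
    using assms(1)
  proof induction
    case (insert k F)
    then show ?case
      using test_lincomb[OF assms(2)[of k], of "\<lambda>x. \<Sum>k\<in>F. c k * \<phi> k x" "c k" 1]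
        iter_partial_lincomb[OF assms(2)[of k], of "\<lambda>x. \<Sum>k\<in>F. c k * \<phi> k x" js "c k" 1]
      by simp
  qed (simp add: test_zero iter_partial_zero)
  then show "(\<lambda>x. \<Sum>k\<in>F. c k * \<phi> k x) \<in> test_functions"
    "iter_partial js (\<lambda>x. \<Sum>k\<in>F. c k * \<phi> k x) = (\<lambda>x. \<Sum>k\<in>F. c k * iter_partial js (\<phi> k) x)"
    by auto
qed

text \<open>Up to the factor (2 pi)^n this is the Fourier coefficient of \<phi> at -k. The sign is
  that of the pairing in \<open>fourier_series\<close>.\<close>

definition mode_integral :: "(real^'n::finite \<Rightarrow> complex) \<Rightarrow> int^'n \<Rightarrow> complex" where
  "mode_integral \<phi> k = integral torus (\<lambda>x. fourier_mode k x * \<phi> x)"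

lemma mode_integrable:
  "continuous_on UNIV \<phi> \<Longrightarrow> (\<lambda>x. fourier_mode k x * \<phi> x) integrable_on torus"
  by (intro integrable_on_torus continuous_intros)

lemma mode_integral_lincomb:
  assumes "continuous_on UNIV \<phi>" "continuous_on UNIV \<psi>"
  shows "mode_integral (\<lambda>x. a * \<phi> x + b * \<psi> x) k = a * mode_integral \<phi> k + b * mode_integral \<psi> k"
proof -
  have "mode_integral (\<lambda>x. a * \<phi> x + b * \<psi> x) k =
      integral torus (\<lambda>x. a * (fourier_mode k x * \<phi> x) + b * (fourier_mode k x * \<psi> x))"
    by (simp add: mode_integral_def algebra_simps)
  also have "\<dots> = a * mode_integral \<phi> k + b * mode_integral \<psi> k"
    using assms unfolding mode_integral_def
    by (subst integral_add) (auto intro!: integrable_on_mult_right mode_integrable)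
  finally show ?thesis .
qed

text \<open>Integration by parts: the partial derivative of the product of mode and test function
  has integral 0.\<close>

lemma mode_integral_partial_deriv:
  assumes "\<phi> \<in> test_functions"
  shows "mode_integral (partial_deriv j \<phi>) k = - \<i> * of_int (k $ j) * mode_integral \<phi> k"
proof -
  have pd: "partial_deriv j \<phi> = iter_partial [j] \<phi>" by (simp add: iter_partial_def)
  have c: "continuous_on UNIV \<phi>" "continuous_on UNIV (partial_deriv j \<phi>)"
    unfolding pd by (simp_all add: assms test_continuous test_iter_partial)
  \<comment> \<open>The terms \<open>0 *\<^sub>R axis j 1\<close> stay because the product rule
    delivers its undifferentiated factors in this form.\<close>
  have "integral torus (\<lambda>x. fourier_mode k (x + 0 *\<^sub>R axis j 1) * partial_deriv j \<phi> x
      + \<i> * of_int (k $ j) * fourier_mode k x * \<phi> (x + 0 *\<^sub>R axis j 1)) = 0"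
  proof (rule integral_torus_partial_deriv)
    show "continuous_on UNIV (\<lambda>x. fourier_mode k x * \<phi> x)"
      by (intro continuous_intros c)
    show "((\<lambda>h. fourier_mode k (x + h *\<^sub>R axis j 1) * \<phi> (x + h *\<^sub>R axis j 1)) has_vector_derivative
        fourier_mode k (x + 0 *\<^sub>R axis j 1) * partial_deriv j \<phi> x
        + \<i> * of_int (k $ j) * fourier_mode k x * \<phi> (x + 0 *\<^sub>R axis j 1)) (at 0)" for x
      using smooth_has_vector_derivative[OF test_smooth[OF assms], of "[]" x j]
      by (intro has_vector_derivative_mult has_vector_derivative_fourier_mode) (simp add: pd)
    show "continuous_on UNIV (\<lambda>x. fourier_mode k (x + 0 *\<^sub>R axis j 1) * partial_deriv j \<phi> x
        + \<i> * of_int (k $ j) * fourier_mode k x * \<phi> (x + 0 *\<^sub>R axis j 1))"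
      using c by (auto intro!: continuous_intros)
  qed (simp_all add: fourier_mode_periodic test_periodic assms)
  then have "integral torus (\<lambda>x. fourier_mode k x * partial_deriv j \<phi> x
      + \<i> * of_int (k $ j) * (fourier_mode k x * \<phi> x)) = 0" by (simp add: mult.assoc)
  then have "mode_integral (partial_deriv j \<phi>) k + \<i> * of_int (k $ j) * mode_integral \<phi> k = 0"
    unfolding mode_integral_def using c
    by (subst (asm) integral_add) (auto intro!: integrable_on_mult_right mode_integrable)
  then show ?thesis by (simp add: add_eq_0_iff)
qed

lemma mode_integral_iter_partial:
  assumes "\<phi> \<in> test_functions"
  shows "mode_integral (iter_partial js \<phi>) k = (\<Prod>j\<leftarrow>js. - \<i> * of_int (k $ j)) * mode_integral \<phi> k"
proof (induction js)
  case (Cons j js)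
  have "iter_partial (j # js) \<phi> = partial_deriv j (iter_partial js \<phi>)" by (simp add: iter_partial_def)
  then show ?case using mode_integral_partial_deriv[OF test_iter_partial[OF assms], of j js k] Cons
    by (simp add: mult_ac)
qed simp

lemma integral_fourier_mode:
  "integral torus (fourier_mode (k :: int^'n::finite)) = (if k = 0 then of_real ((2 * pi) ^ CARD('n)) else 0)"
proof (cases "k = 0")
  case True
  have "fourier_mode k = (\<lambda>x. 1)" using True by (simp add: fun_eq_iff)
  then have "integral torus (fourier_mode k) = measure lborel (torus :: (real^'n) set) *\<^sub>R (1::complex)"
    unfolding torus_def by simp
  then show ?thesis using True unfolding measure_torus by (simp add: scaleR_conv_of_real)
next
  case False
  then obtain j where j: "k $ j \<noteq> 0" by (auto simp: vec_eq_iff)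
  \<comment> \<open>Integration by parts against the constant mode: its derivative vanishes, so
    \<open>k $ j\<close> times the integral is 0.\<close>
  have "mode_integral (partial_deriv j (fourier_mode 0)) k = - \<i> * of_int (k $ j) * mode_integral (fourier_mode 0) k"
    by (rule mode_integral_partial_deriv) simp
  moreover have "partial_deriv j (fourier_mode 0) = (\<lambda>x. 0)"
    using iter_partial_fourier_mode[of "[j]" 0] by (simp add: iter_partial_def)
  ultimately show ?thesis using j False by (simp add: mode_integral_def)
qed

lemma mode_integral_fourier_mode:
  "mode_integral (fourier_mode l) (k :: int^'n::finite) = (if k = - l then of_real ((2 * pi) ^ CARD('n)) else 0)"
proof -
  have "(\<lambda>x. fourier_mode k x * fourier_mode l x) = fourier_mode (k + l)"
    by (simp add: fun_eq_iff fourier_mode_add)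
  moreover have "k + l = 0 \<longleftrightarrow> k = - l" by (rule eq_neg_iff_add_eq_0[symmetric])
  ultimately show ?thesis unfolding mode_integral_def by (simp only: integral_fourier_mode)
qed

section \<open>Trigonometric polynomials and uniqueness of Fourier coefficients\<close>

inductive trig_poly :: "(real^'n::finite \<Rightarrow> complex) \<Rightarrow> bool" where
  mode: "trig_poly (fourier_mode k)"
| scale: "trig_poly p \<Longrightarrow> trig_poly (\<lambda>x. c * p x)"
| add: "trig_poly p \<Longrightarrow> trig_poly q \<Longrightarrow> trig_poly (\<lambda>x. p x + q x)"

lemma trig_poly_mult:
  assumes "trig_poly p" "trig_poly q"
  shows "trig_poly (\<lambda>x. p x * q x)"
  using assms
proof (induction rule: trig_poly.induct)
  case (mode k)
  then show ?case
  proof (induction rule: trig_poly.induct)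
    case (mode l)
    have "(\<lambda>x. fourier_mode k x * fourier_mode l x) = fourier_mode (k + l)"
      by (simp add: fun_eq_iff fourier_mode_add)
    then show ?case by (simp add: trig_poly.mode)
  next
    case (scale p c)
    then show ?case using trig_poly.scale[of "\<lambda>x. fourier_mode k x * p x" c] by (simp add: mult_ac)
  next
    case (add p q)
    then show ?case
      using trig_poly.add[of "\<lambda>x. fourier_mode k x * p x" "\<lambda>x. fourier_mode k x * q x"]
      by (simp add: distrib_left)
  qed
next
  case (scale p c)
  then show ?case using trig_poly.scale[of "\<lambda>x. p x * q x" c] by (simp add: mult_ac)
next
  case (add p r)
  then show ?case
    using trig_poly.add[of "\<lambda>x. p x * q x" "\<lambda>x. r x * q x"]
    by (simp add: distrib_right)
qed

lemma trig_poly_const: "trig_poly (\<lambda>x. c)"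
  using trig_poly.scale[OF trig_poly.mode[of 0], of c] by simp

lemma trig_poly_continuous: "trig_poly p \<Longrightarrow> continuous_on S p"
  by (induction rule: trig_poly.induct) (auto intro!: continuous_intros)

lemma trig_poly_annihilated:
  assumes "trig_poly p" and cont: "continuous_on UNIV \<phi>" and zero: "\<And>k. mode_integral \<phi> k = 0"
  shows "integral torus (\<lambda>x. p x * \<phi> x) = 0"
  using assms(1)
proof (induction rule: trig_poly.induct)
  case (mode k)
  then show ?case using zero unfolding mode_integral_def by blast
next
  case (scale p c)
  then show ?case by (simp add: mult.assoc)
next
  case (add p q)
  have "integral torus (\<lambda>x. (p x + q x) * \<phi> x) = integral torus (\<lambda>x. p x * \<phi> x) + integral torus (\<lambda>x. q x * \<phi> x)"
    unfolding distrib_right using add.hyps[THEN trig_poly_continuous] cont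
    by (intro integral_add integrable_on_torus continuous_intros)
  then show ?case using add by simp
qed

definition circle_map :: "real^'n::finite \<Rightarrow> complex^'n" where
  "circle_map x = (\<chi> j. exp (\<i> * of_real (x $ j)))"

lemma continuous_on_circle_map: "continuous_on S circle_map"
  unfolding circle_map_def[abs_def] by (intro continuous_intros)

lemma circle_map_nth: "circle_map x $ j = fourier_mode (axis j 1) x"
proof -
  have "real_vec (axis j 1) = axis j 1" by (simp add: vec_eq_iff axis_def)
  then show ?thesis by (simp add: circle_map_def fourier_mode_def inner_axis' )
qed

lemma circle_map_eqD:
  assumes "circle_map x = circle_map y"
  obtains k where "x = y + (2 * pi) *\<^sub>R real_vec k"
proof -
  have "\<exists>m::int. x $ j = y $ j + 2 * pi * of_int m" for j
  proof -
    have "exp (\<i> * of_real (x $ j)) = exp (\<i> * of_real (y $ j))"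
      using assms by (simp add: circle_map_def vec_eq_iff)
    then obtain m :: int where "\<i> * of_real (x $ j) = \<i> * of_real (y $ j) + (of_int (2 * m) * pi) * \<i>"
      unfolding exp_eq by blast
    then have "Im (\<i> * of_real (x $ j)) = Im (\<i> * of_real (y $ j) + (of_int (2 * m) * pi) * \<i>)" by simp
    then show ?thesis by (intro exI[of _ m]) simp
  qed
  then obtain m :: "'a \<Rightarrow> int" where "\<And>j. x $ j = y $ j + 2 * pi * of_int (m j)" by metis
  then have "x = y + (2 * pi) *\<^sub>R real_vec (\<chi> j. m j)" by (simp add: vec_eq_iff)
  then show ?thesis by (rule that)
qed

lemma trig_poly_cnj_mode: "trig_poly (\<lambda>x. cnj (fourier_mode k x))"
proof -
  have "(\<lambda>x. cnj (fourier_mode k x)) = fourier_mode (- k)"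
    by (simp add: fun_eq_iff fourier_mode_def exp_cnj)
  then show ?thesis by (simp add: trig_poly.mode)
qed

text \<open>The torus is not separated by trigonometric polynomials, since they agree on opposite
  faces; Stone--Weierstrass is applied to its image in a product of unit circles.\<close>

lemma trig_poly_dense:
  fixes u :: "real^'n::finite \<Rightarrow> real"
  assumes cont: "continuous_on UNIV u" and per: "\<And>j x. u (x + (2 * pi) *\<^sub>R axis j 1) = u x"
    and "e > 0"
  obtains p where "trig_poly p" "\<And>x. x \<in> torus \<Longrightarrow> norm (of_real (u x) - p x) < e"
proof -
  define S :: "(complex^'n) set" where "S = circle_map ` torus"
  \<comment> \<open>\<open>inv_into\<close> picks some preimage; two preimages differ by a lattice
    vector, so by periodicity \<open>u\<close> does not see the choice.\<close>
  define v where "v = (\<lambda>z. u (inv_into torus circle_map z))"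
  define P where "P = (\<lambda>F::complex^'n \<Rightarrow> real. continuous_on S F \<and> trig_poly (\<lambda>x. of_real (F (circle_map x))))"
  have compS: "compact S"
    unfolding S_def by (intro compact_continuous_image continuous_on_circle_map compact_torus)
  have v: "v (circle_map x) = u x" if x: "x \<in> torus" for x
  proof -
    let ?y = "inv_into torus circle_map (circle_map x)"
    have "circle_map ?y = circle_map x" using x by (intro f_inv_into_f) auto
    then obtain k where "?y = x + (2 * pi) *\<^sub>R real_vec k" by (rule circle_map_eqD)
    then show ?thesis unfolding v_def using periodic_lattice[of u, OF per] by metis
  qed
  \<comment> \<open>\<open>circle_map\<close> sends compact sets to compact, hence closed, sets. It
    is a quotient map on the torus, and continuity descends from \<open>u\<close> to
    \<open>v\<close>.\<close>
  have "continuous_on S v"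
    unfolding continuous_on_closed_vimage[OF compact_imp_closed[OF compS]]
  proof (intro allI impI)
    fix B :: "real set" assume "closed B"
    then have "closed (u -` B)" using cont by (intro closed_vimage) auto
    then have "compact (circle_map ` (torus \<inter> u -` B))"
      by (intro compact_continuous_image continuous_on_circle_map compact_Int_closed compact_torus)
    moreover have "v -` B \<inter> S = circle_map ` (torus \<inter> u -` B)"
      using v unfolding S_def by auto
    ultimately show "closed (v -` B \<inter> S)" by (simp add: compact_imp_closed)
  qed
  have "\<exists>F. P F \<and> (\<forall>z\<in>S. \<bar>v z - F z\<bar> < e)"
  proof (rule Stone_Weierstrass_HOL[OF compS])
    show "P (\<lambda>x. c)" for c by (simp add: P_def trig_poly_const)
    show "continuous_on S F" if "P F" for F using that by (simp add: P_def)
    show "P (\<lambda>x. F x + G x)" if "P F \<and> P G" for F G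
      using that unfolding P_def by (auto intro!: continuous_intros trig_poly.add)
    show "P (\<lambda>x. F x * G x)" if "P F \<and> P G" for F G
      using that unfolding P_def by (auto intro!: continuous_intros trig_poly_mult)
    show "\<exists>F. P F \<and> F x \<noteq> F y" if xy: "x \<in> S \<and> y \<in> S \<and> x \<noteq> y" for x y
    proof -
      \<comment> \<open>The approximating functions are real, so points are separated by the real
        and imaginary parts of a coordinate; these are combinations of a mode and its
        conjugate.\<close>
      obtain j where "x $ j \<noteq> y $ j" using xy by (auto simp: vec_eq_iff)
      have "P (\<lambda>z. Re (z $ j))"
      proof -
        have "(\<lambda>x. of_real (Re (circle_map x $ j))) =
            (\<lambda>x. (1 / 2) * (fourier_mode (axis j 1) x + cnj (fourier_mode (axis j 1) x)))"
          by (simp add: fun_eq_iff circle_map_nth complex_add_cnj)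
        moreover have "trig_poly (\<lambda>x. (1 / 2) * (fourier_mode (axis j 1) x + cnj (fourier_mode (axis j 1) x)))"
          by (intro trig_poly.intros trig_poly_cnj_mode)
        ultimately show ?thesis unfolding P_def by (auto intro!: continuous_intros)
      qed
      moreover have "P (\<lambda>z. Im (z $ j))"
      proof -
        have "(\<lambda>x. of_real (Im (circle_map x $ j))) =
            (\<lambda>x. (- \<i> / 2) * (fourier_mode (axis j 1) x + (- 1) * cnj (fourier_mode (axis j 1) x)))"
          by (simp add: fun_eq_iff circle_map_nth complex_eq_iff)
        moreover have "trig_poly (\<lambda>x. (- \<i> / 2) * (fourier_mode (axis j 1) x + (- 1) * cnj (fourier_mode (axis j 1) x)))"
          by (intro trig_poly.intros trig_poly_cnj_mode)
        ultimately show ?thesis unfolding P_def by (auto intro!: continuous_intros)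
      qed
      ultimately show ?thesis using \<open>x $ j \<noteq> y $ j\<close> complex_eqI by blast
    qed
  qed fact+
  then obtain F where F: "P F" "\<And>z. z \<in> S \<Longrightarrow> \<bar>v z - F z\<bar> < e" by blast
  show ?thesis
  proof
    show "trig_poly (\<lambda>x. of_real (F (circle_map x)))" using F by (simp add: P_def)
    show "norm (of_real (u x) - complex_of_real (F (circle_map x))) < e" if "x \<in> torus" for x
      using F(2)[of "circle_map x"] v[OF that] that unfolding S_def
      by (simp flip: of_real_diff)
  qed
qed

text \<open>\<open>u\<close> is a uniform limit of trigonometric polynomials, whose integrals
  against \<phi> vanish; a bound for \<phi> controls the error.\<close>

lemma annihilates_real_periodic:
  fixes u :: "real^'n::finite \<Rightarrow> real"
  assumes u: "continuous_on UNIV u" "\<And>j x. u (x + (2 * pi) *\<^sub>R axis j 1) = u x"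
    and \<phi>: "continuous_on UNIV \<phi>" "\<And>j x. \<phi> (x + (2 * pi) *\<^sub>R axis j 1) = \<phi> x"
    and zero: "\<And>k. mode_integral \<phi> k = 0"
  shows "integral torus (\<lambda>x. of_real (u x) * \<phi> x) = 0"
proof -
  obtain B where B: "\<And>x. norm (\<phi> x) \<le> B" using periodic_bounded[of \<phi>, OF \<phi>] by blast
  have B0: "B \<ge> 0" using B[of 0] norm_ge_zero order_trans by blast
  have bound: "norm (integral torus (\<lambda>x. of_real (u x) * \<phi> x)) \<le> e * (B * (2 * pi) ^ CARD('n))" if e: "e > 0" for e
  proof -
    obtain p where p: "trig_poly p" "\<And>x. x \<in> torus \<Longrightarrow> norm (of_real (u x) - p x) < e"
      using trig_poly_dense[of u, OF u e] by blast
    have int: "(\<lambda>x. of_real (u x) * \<phi> x) integrable_on torus" "(\<lambda>x. p x * \<phi> x) integrable_on torus"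
      by (intro integrable_on_torus continuous_intros u \<phi> trig_poly_continuous p)+
    have "integral torus (\<lambda>x. of_real (u x) * \<phi> x) = integral torus (\<lambda>x. of_real (u x) * \<phi> x - p x * \<phi> x)"
      using trig_poly_annihilated[OF p(1) \<phi>(1) zero] int by (simp add: integral_diff)
    also have "norm \<dots> \<le> (e * B) * measure lborel (torus :: (real^'n) set)"
      unfolding torus_def
    proof (rule has_integral_bound)
      show "((\<lambda>x. of_real (u x) * \<phi> x - p x * \<phi> x) has_integral
          integral (cbox 0 (\<chi> j. 2 * pi)) (\<lambda>x. of_real (u x) * \<phi> x - p x * \<phi> x)) (cbox 0 (\<chi> j. 2 * pi))"
        using int unfolding torus_def by (intro integrable_integral integrable_diff)
      fix x :: "real^'n" assume x: "x \<in> cbox 0 (\<chi> j. 2 * pi)"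
      have "norm (of_real (u x) * \<phi> x - p x * \<phi> x) = norm (of_real (u x) - p x) * norm (\<phi> x)"
        by (simp add: norm_mult flip: left_diff_distrib)
      also have "\<dots> \<le> e * B"
        using p(2)[of x] B[of x] e x unfolding torus_def by (intro mult_mono) auto
      finally show "norm (of_real (u x) * \<phi> x - p x * \<phi> x) \<le> e * B" .
    qed (use e B0 in auto)
    finally show ?thesis unfolding measure_torus by (simp add: mult.assoc)
  qed
  have "norm (integral torus (\<lambda>x. of_real (u x) * \<phi> x)) \<le> 0"
  proof (rule field_le_epsilon)
    fix e :: real assume "e > 0"
    \<comment> \<open>The added 1 keeps the divisor positive when \<open>B = 0\<close>.\<close>
    define K where "K = B * (2 * pi) ^ CARD('n) + 1"
    have "K > 0" using B0 by (simp add: K_def add_nonneg_pos)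
    then have "e / K * (B * (2 * pi) ^ CARD('n)) \<le> e / K * K" using \<open>e > 0\<close>
      by (intro mult_left_mono) (auto simp: K_def)
    then show "norm (integral torus (\<lambda>x. of_real (u x) * \<phi> x)) \<le> 0 + e"
      using bound[of "e / K"] \<open>K > 0\<close> \<open>e > 0\<close> by simp
  qed
  then show ?thesis by simp
qed

text \<open>Tested against its own conjugate, split into real and imaginary part, \<phi> has square
  norm 0 on the torus; periodicity does the rest.\<close>

lemma mode_integral_zero_imp_zero:
  fixes \<phi> :: "real^'n::finite \<Rightarrow> complex"
  assumes \<phi>: "continuous_on UNIV \<phi>" "\<And>j x. \<phi> (x + (2 * pi) *\<^sub>R axis j 1) = \<phi> x"
    and zero: "\<And>k. mode_integral \<phi> k = 0"
  shows "\<phi> x = 0"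
proof -
  have re: "integral torus (\<lambda>x. of_real (Re (\<phi> x)) * \<phi> x) = 0"
    and im: "integral torus (\<lambda>x. of_real (Im (\<phi> x)) * \<phi> x) = 0"
    using \<phi> zero by (intro annihilates_real_periodic continuous_intros; simp)+
  have "integral torus (\<lambda>x. of_real (Re (\<phi> x)) * \<phi> x - \<i> * (of_real (Im (\<phi> x)) * \<phi> x)) = 0"
    using re im \<phi>(1)
    by (subst integral_diff) (auto intro!: integrable_on_torus continuous_intros)
  also have "(\<lambda>x. of_real (Re (\<phi> x)) * \<phi> x - \<i> * (of_real (Im (\<phi> x)) * \<phi> x)) = (\<lambda>x. complex_of_real ((norm (\<phi> x))\<^sup>2))"
  proof
    fix x
    have "of_real (Re (\<phi> x)) * \<phi> x - \<i> * (of_real (Im (\<phi> x)) * \<phi> x) = \<phi> x * cnj (\<phi> x)"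
      by (simp add: complex_eq_iff)
    then show "of_real (Re (\<phi> x)) * \<phi> x - \<i> * (of_real (Im (\<phi> x)) * \<phi> x) = complex_of_real ((norm (\<phi> x))\<^sup>2)"
      by (simp only: complex_norm_square)
  qed
  finally have "integral torus (\<lambda>x. complex_of_real ((norm (\<phi> x))\<^sup>2)) = 0" .
  moreover have intr: "((\<lambda>x. (norm (\<phi> x))\<^sup>2)) integrable_on torus"
    unfolding torus_def by (intro integrable_continuous continuous_intros continuous_on_subset[OF \<phi>(1)]) auto
  moreover have "integral torus (\<lambda>x. complex_of_real ((norm (\<phi> x))\<^sup>2)) = of_real (integral torus (\<lambda>x. (norm (\<phi> x))\<^sup>2))"
    using has_integral_of_real[OF integrable_integral[OF intr], where ?'b = complex]
    by (simp add: integral_unique)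
  ultimately have "integral torus (\<lambda>x. (norm (\<phi> x))\<^sup>2) = 0" by simp
  then have "\<forall>x\<in>cbox 0 (\<chi> j::'n. 2 * pi). (norm (\<phi> x))\<^sup>2 = 0"
    unfolding torus_def
    by (subst (asm) integral_cbox_eq_0_iff)
       (auto intro!: continuous_intros continuous_on_subset[OF \<phi>(1)] simp: interval_ne_empty_cart)
  then have "\<phi> y = 0" if "y \<in> torus" for y using that by (simp add: torus_def)
  moreover obtain y k where "y \<in> torus" "x = y + (2 * pi) *\<^sub>R real_vec k" by (rule torus_representative)
  ultimately show ?thesis using periodic_lattice[of \<phi>, OF \<phi>(2)] by metis
qed

section \<open>Decay of Fourier integrals and summability over the lattice\<close>

definition freq_weight :: "int^'n::finite \<Rightarrow> real" where
  "freq_weight k = 1 + (norm (real_vec k))\<^sup>2"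

lemma freq_weight_ge_1: "freq_weight k \<ge> 1"
  by (simp add: freq_weight_def)

lemma freq_weight_0 [simp]: "freq_weight 0 = 1"
  by (simp add: freq_weight_def)

lemma norm_real_vec_power2: "(norm (real_vec k))\<^sup>2 = (\<Sum>j\<in>UNIV. (of_int (k $ j))\<^sup>2)"
  unfolding power2_norm_eq_inner inner_vec_def by (simp add: power2_eq_square)

lemma norm_real_vec_ge_1:
  assumes "k \<noteq> 0" shows "norm (real_vec k) \<ge> 1"
proof -
  obtain j where j: "k $ j \<noteq> 0" using assms by (auto simp: vec_eq_iff)
  have "1 \<le> \<bar>real_vec k $ j\<bar>" using j by simp
  also have "\<dots> \<le> norm (real_vec k)" by (rule component_le_norm_cart)
  finally show ?thesis .
qed

lemma norm_le_freq_weight: "norm (real_vec k) \<le> freq_weight k"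
proof -
  have "0 \<le> (norm (real_vec k) - 1)\<^sup>2" by simp
  then have "2 * norm (real_vec k) \<le> freq_weight k"
    unfolding freq_weight_def power2_diff by simp
  then show ?thesis using norm_ge_zero[of "real_vec k"] by linarith
qed

lemma abs_component_le_freq_weight: "\<bar>of_int (k $ j)\<bar> \<le> freq_weight k"
  using component_le_norm_cart[of "real_vec k" j] norm_le_freq_weight[of k] by simp

lemma finite_lists_le [simp]: "finite {js :: 'n::finite list. length js \<le> N}"
  using finite_lists_length_le[of "UNIV :: 'n set" N] by simp

lemma iter_partial_le_test_norm:
  fixes \<phi> :: "real^'n::finite \<Rightarrow> complex"
  assumes \<phi>: "\<phi> \<in> test_functions" and "length js \<le> N"
  shows "norm (iter_partial js \<phi> x) \<le> test_norm N \<phi>"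
proof -
  have le: "norm (iter_partial js \<phi> x) \<le> (SUP x. norm (iter_partial js \<phi> x))" for js x
  proof (rule cSUP_upper)
    \<comment> \<open>\<open>SUP\<close> is meaningful only over a bounded set; periodicity provides
      the bound.\<close>
    obtain B where "\<And>x. norm (iter_partial js \<phi> x) \<le> B"
      using periodic_bounded[of "iter_partial js \<phi>"] \<phi>
      by (metis test_continuous test_iter_partial test_periodic)
    then show "bdd_above (range (\<lambda>x. norm (iter_partial js \<phi> x)))" by (auto simp: bdd_above_def)
  qed simp
  have "(SUP x. norm (iter_partial js \<phi> x)) \<le> test_norm N \<phi>"
    unfolding test_norm_def using le[of _ 0] assms(2)
    by (intro member_le_sum) (auto intro: order_trans[OF norm_ge_zero])
  then show ?thesis using le order_trans by blast
qed

lemma test_norm_nonneg: "\<phi> \<in> test_functions \<Longrightarrow> test_norm N \<phi> \<ge> 0"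
  by (rule order_trans[OF norm_ge_zero iter_partial_le_test_norm[of \<phi> "[]" N 0]]) simp_all

lemma norm_prod_list: "norm (prod_list (map f xs)) = prod_list (map (\<lambda>x. norm (f x :: complex)) xs)"
  by (induction xs) (auto simp: norm_mult)

lemma mode_integral_decay_list:
  fixes \<phi> :: "real^'n::finite \<Rightarrow> complex"
  assumes \<phi>: "\<phi> \<in> test_functions" and "length js \<le> N"
  shows "(\<Prod>j\<leftarrow>js. \<bar>of_int (k $ j)\<bar>) * norm (mode_integral \<phi> k) \<le> test_norm N \<phi> * (2 * pi) ^ CARD('n)"
proof -
  have "(\<Prod>j\<leftarrow>js. \<bar>of_int (k $ j)\<bar>) * norm (mode_integral \<phi> k) = norm (mode_integral (iter_partial js \<phi>) k)"
    unfolding mode_integral_iter_partial[OF \<phi>] norm_mult norm_prod_list by (simp add: norm_mult)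
  also have "\<dots> \<le> test_norm N \<phi> * (2 * pi) ^ CARD('n)"
    unfolding mode_integral_def
    using iter_partial_le_test_norm[OF assms]
    by (intro norm_integral_torus_le continuous_intros test_continuous test_iter_partial \<phi>)
       (simp add: norm_mult)
  finally show ?thesis .
qed

text \<open>Only the largest component of \<open>k\<close> counts: 2M derivatives in its direction
  gain its 2M-th power, and the weight is at most n + 1 times the larger of 1 and its square. If
  that square is at most 1, no derivative is taken; this includes k = 0.\<close>

lemma mode_integral_decay:
  fixes \<phi> :: "real^'n::finite \<Rightarrow> complex"
  assumes \<phi>: "\<phi> \<in> test_functions"
  shows "freq_weight k ^ M * norm (mode_integral \<phi> k) \<le>
     (real CARD('n) + 1) ^ M * (2 * pi) ^ CARD('n) * test_norm (2 * M) \<phi>"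
proof -
  define a where "a = (\<lambda>j. (real_of_int (k $ j))\<^sup>2)"
  have "Max (range a) \<in> range a" by (rule Max_in) auto
  then obtain j where j: "\<And>i. a i \<le> a j" by (metis Max_ge finite finite_imageI imageE rangeI)
  have "(norm (real_vec k))\<^sup>2 \<le> real CARD('n) * a j"
    unfolding norm_real_vec_power2 using j sum_bounded_above[of UNIV a "a j"] by (simp add: a_def)
  also have "\<dots> \<le> real CARD('n) * max 1 (a j)" by (intro mult_left_mono) auto
  finally have "freq_weight k \<le> (real CARD('n) + 1) * max 1 (a j)"
    unfolding freq_weight_def distrib_right by simp
  then have "freq_weight k ^ M \<le> ((real CARD('n) + 1) * max 1 (a j)) ^ M"
    using freq_weight_ge_1[of k] by (intro power_mono) auto
  then have "freq_weight k ^ M * norm (mode_integral \<phi> k) \<le>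
      (real CARD('n) + 1) ^ M * (max 1 (a j) ^ M * norm (mode_integral \<phi> k))"
    unfolding power_mult_distrib mult.assoc[symmetric] by (intro mult_right_mono) auto
  also have "max 1 (a j) ^ M * norm (mode_integral \<phi> k) \<le> test_norm (2 * M) \<phi> * (2 * pi) ^ CARD('n)"
  proof (cases "a j \<le> 1")
    case True
    then show ?thesis using mode_integral_decay_list[OF \<phi>, of "[]" "2 * M" k] by (simp add: max_def)
  next
    case False
    have "max 1 (a j) ^ M = \<bar>of_int (k $ j)\<bar> ^ (2 * M)"
      using False by (simp add: max_def a_def power_mult)
    then show ?thesis
      using mode_integral_decay_list[OF \<phi>, of "replicate (2 * M) j" "2 * M" k] by simp
  qed
  finally show ?thesis by (simp add: mult_ac)
qed

lemma summable_on_int_inverse_square: "(\<lambda>m::int. 1 / (1 + (real_of_int m)\<^sup>2)) summable_on UNIV"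
proof -
  have "summable (\<lambda>n::nat. 1 / (1 + (real n)\<^sup>2))"
  proof (rule summable_comparison_test)
    show "summable (\<lambda>n. inverse (real n ^ 2))" by (rule inverse_power_summable) simp
    show "\<exists>N. \<forall>n\<ge>N. norm (1 / (1 + (real n)\<^sup>2)) \<le> inverse (real n ^ 2)"
      \<comment> \<open>The comparison starts at 1 because at 0 the majorant is
        \<open>inverse 0 = 0\<close>.\<close>
      by (intro exI[of _ 1]) (auto simp: inverse_eq_divide intro!: divide_left_mono mult_pos_pos add_pos_nonneg)
  qed
  then have nat: "(\<lambda>n::nat. 1 / (1 + (real n)\<^sup>2)) summable_on UNIV"
    by (intro summable_nonneg_imp_summable_on) auto
  have "(\<lambda>m::int. 1 / (1 + (real_of_int m)\<^sup>2)) summable_on range int"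
    using nat by (subst summable_on_reindex) (auto simp: o_def)
  moreover have "(\<lambda>m::int. 1 / (1 + (real_of_int m)\<^sup>2)) summable_on range (\<lambda>n. - int n)"
    using nat by (subst summable_on_reindex) (auto simp: o_def inj_on_def)
  ultimately have "(\<lambda>m::int. 1 / (1 + (real_of_int m)\<^sup>2)) summable_on range int \<union> range (\<lambda>n. - int n)"
    by (rule summable_on_union)
  moreover have "range int \<union> range (\<lambda>n. - int n) = UNIV"
    by (auto simp: image_iff) (metis int_cases2)
  ultimately show ?thesis by simp
qed

lemma freq_weight_power_ge: "(\<Prod>j\<in>UNIV. 1 + (real_of_int (k $ j))\<^sup>2) \<le> freq_weight (k :: int^'n::finite) ^ CARD('n)"
proof -
  have "1 + (real_of_int (k $ j))\<^sup>2 \<le> freq_weight k" for j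
    using member_le_sum[of j UNIV "\<lambda>j. (real_of_int (k $ j))\<^sup>2"]
    unfolding freq_weight_def norm_real_vec_power2 by simp
  then have "(\<Prod>j\<in>UNIV. 1 + (real_of_int (k $ j))\<^sup>2) \<le> (\<Prod>j\<in>(UNIV :: 'n set). freq_weight k)"
    by (intro prod_mono) auto
  then show ?thesis by simp
qed

text \<open>The n-th power of the weight dominates the product of the factors 1 + k_j^2. A finite
  set of lattice points lies in a cube with finite side \<open>I\<close>, over which the sum of the
  products is a product of one-dimensional sums.\<close>

lemma freq_weight_summable: "(\<lambda>k :: int^'n::finite. 1 / freq_weight k ^ CARD('n)) summable_on UNIV"
proof (rule nonneg_bdd_above_summable_on)
  fix k :: "int^'n" show "0 \<le> 1 / freq_weight k ^ CARD('n)" using freq_weight_ge_1[of k] by simp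
next
  define h where "h = (\<lambda>m::int. 1 / (1 + (real_of_int m)\<^sup>2))"
  define A where "A = infsum h UNIV"
  have h0: "h m \<ge> 0" for m by (simp add: h_def)
  show "bdd_above (sum (\<lambda>k :: int^'n. 1 / freq_weight k ^ CARD('n)) ` {F. F \<subseteq> UNIV \<and> finite F})"
  proof (rule bdd_aboveI2)
    fix F :: "(int^'n) set" assume "F \<in> {F. F \<subseteq> UNIV \<and> finite F}"
    then have F: "finite F" by simp
    define I where "I = (\<Union>j. (\<lambda>k. k $ j) ` F)"
    have I: "finite I" using F by (auto simp: I_def)
    have "(\<Sum>k\<in>F. 1 / freq_weight k ^ CARD('n)) \<le> (\<Sum>k\<in>F. \<Prod>j\<in>UNIV. h (k $ j))"
    proof (intro sum_mono)
      fix k :: "int^'n"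
      have "(\<Prod>j\<in>UNIV. 1 + (real_of_int (k $ j))\<^sup>2) > 0" by (intro prod_pos) (auto intro: add_pos_nonneg)
      then show "1 / freq_weight k ^ CARD('n) \<le> (\<Prod>j\<in>UNIV. h (k $ j))"
        using freq_weight_power_ge[of k] unfolding h_def by (simp add: prod_dividef frac_le)
    qed
    also have "\<dots> = (\<Sum>g\<in>vec_nth ` F. \<Prod>j\<in>UNIV. h (g j))"
      by (subst sum.reindex) (auto simp: inj_on_def vec_eq_iff)
    also have "\<dots> \<le> (\<Sum>g\<in>PiE (UNIV :: 'n set) (\<lambda>_. I). \<Prod>j\<in>UNIV. h (g j))"
      using I h0 by (intro sum_mono2 finite_PiE prod_nonneg) (auto simp: I_def)
    also have "\<dots> = (\<Prod>j\<in>(UNIV :: 'n set). \<Sum>m\<in>I. h m)"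
      using I by (intro prod_sum_PiE[symmetric]) auto
    also have "\<dots> \<le> (\<Prod>j\<in>(UNIV :: 'n set). A)"
      unfolding A_def using I h0 summable_on_int_inverse_square
      by (intro prod_mono conjI sum_nonneg finite_sum_le_infsum) (auto simp: h_def)
    finally show "(\<Sum>k\<in>F. 1 / freq_weight k ^ CARD('n)) \<le> A ^ CARD('n)" by simp
  qed
qed

section \<open>Distributions as Fourier series with coefficients of polynomial growth\<close>

definition poly_bounded :: "(int^'n::finite \<Rightarrow> complex) \<Rightarrow> bool" where
  "poly_bounded c \<longleftrightarrow> (\<exists>C M. \<forall>k. norm (c k) \<le> C * freq_weight k ^ M)"

lemma poly_boundedE:
  assumes "poly_bounded c"
  obtains C M where "C \<ge> 0" "\<And>k. norm (c k) \<le> C * freq_weight k ^ M"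
proof -
  obtain C M where CM: "\<And>k. norm (c k) \<le> C * freq_weight k ^ M"
    using assms unfolding poly_bounded_def by blast
  have "C \<ge> 0" using order_trans[OF norm_ge_zero CM[of 0]] by simp
  then show ?thesis using CM that by blast
qed

lemma fourier_series_apply:
  "\<phi> \<in> test_functions \<Longrightarrow> fourier_series c \<phi> = (\<Sum>\<^sub>\<infinity>k. c k * mode_integral \<phi> k)"
  by (simp add: fourier_series_def mode_integral_def)

text \<open>Of the \<open>M + CARD('n)\<close> powers of the weight that \<open>\<phi>\<close>
  offers as decay, \<open>M\<close> absorb the growth of \<open>c\<close> and the others leave a
  summable series. A bound linear in one test norm is what continuity of the distribution asks
  for.\<close>

lemma
  fixes \<phi> :: "real^'n::finite \<Rightarrow> complex"
  assumes c: "C \<ge> 0" "\<And>k. norm (c k) \<le> C * freq_weight k ^ M" and \<phi>: "\<phi> \<in> test_functions"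
  shows fourier_series_abs_summable_bound: "(\<lambda>k. norm (c k * mode_integral \<phi> k)) summable_on UNIV"
    and fourier_series_bound: "norm (fourier_series c \<phi>) \<le>
        C * ((real CARD('n) + 1) ^ (M + CARD('n)) * (2 * pi) ^ CARD('n)
          * (\<Sum>\<^sub>\<infinity>k :: int^'n. 1 / freq_weight k ^ CARD('n))) * test_norm (2 * (M + CARD('n))) \<phi>"
proof -
  let ?n = "CARD('n)"
  define K where "K = C * ((real ?n + 1) ^ (M + ?n) * (2 * pi) ^ ?n * test_norm (2 * (M + ?n)) \<phi>)"
  have le: "norm (c k * mode_integral \<phi> k) \<le> K * (1 / freq_weight k ^ ?n)" for k
  proof -
    have w: "freq_weight k > 0" using freq_weight_ge_1[of k] by simp
    have "norm (c k * mode_integral \<phi> k) \<le> (C * freq_weight k ^ M) * norm (mode_integral \<phi> k)"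
      unfolding norm_mult by (intro mult_right_mono c) auto
    also have "\<dots> = C * (freq_weight k ^ (M + ?n) * norm (mode_integral \<phi> k)) * (1 / freq_weight k ^ ?n)"
      using w by (simp add: power_add)
    also have "\<dots> \<le> K * (1 / freq_weight k ^ ?n)"
      unfolding K_def using w c(1) by (intro mult_right_mono mult_left_mono mode_integral_decay \<phi>) auto
    finally show ?thesis .
  qed
  have sm: "(\<lambda>k :: int^'n. K * (1 / freq_weight k ^ ?n)) summable_on UNIV"
    by (intro summable_on_cmult_right freq_weight_summable)
  show abs: "(\<lambda>k. norm (c k * mode_integral \<phi> k)) summable_on UNIV"
    by (rule summable_on_comparison_test[OF sm le]) auto
  have "norm (fourier_series c \<phi>) \<le> (\<Sum>\<^sub>\<infinity>k. norm (c k * mode_integral \<phi> k))"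
    unfolding fourier_series_apply[OF \<phi>] by (rule norm_infsum_bound[OF abs])
  also have "\<dots> \<le> (\<Sum>\<^sub>\<infinity>k :: int^'n. K * (1 / freq_weight k ^ ?n))"
    by (intro infsum_mono abs sm le)
  also have "\<dots> = K * (\<Sum>\<^sub>\<infinity>k :: int^'n. 1 / freq_weight k ^ ?n)"
    by (rule infsum_cmult_right[OF freq_weight_summable])
  finally show "norm (fourier_series c \<phi>) \<le>
        C * ((real ?n + 1) ^ (M + ?n) * (2 * pi) ^ ?n
          * (\<Sum>\<^sub>\<infinity>k :: int^'n. 1 / freq_weight k ^ ?n)) * test_norm (2 * (M + ?n)) \<phi>"
    unfolding K_def by (simp add: mult_ac)
qed

lemma fourier_series_abs_summable:
  assumes "poly_bounded c" "\<phi> \<in> test_functions"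
  shows "(\<lambda>k. norm (c k * mode_integral \<phi> k)) summable_on UNIV"
  using assms by (elim poly_boundedE) (rule fourier_series_abs_summable_bound)

lemma fourier_series_summable:
  assumes "poly_bounded c" "\<phi> \<in> test_functions"
  shows "(\<lambda>k. c k * mode_integral \<phi> k) summable_on UNIV"
  by (rule abs_summable_summable[OF fourier_series_abs_summable[OF assms]])

lemma fourier_series_periodic_distribution:
  assumes c: "poly_bounded c"
  shows "fourier_series c \<in> periodic_distributions"
  unfolding periodic_distributions_def mem_Collect_eq
proof (intro conjI allI impI ballI)
  show "fourier_series c \<phi> = 0" if "\<phi> \<notin> test_functions" for \<phi>
    using that by (simp add: fourier_series_def)
next
  fix \<phi> \<psi> :: "real^'a \<Rightarrow> complex" and a b assume *: "\<phi> \<in> test_functions" "\<psi> \<in> test_functions"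
  have "fourier_series c (\<lambda>x. a * \<phi> x + b * \<psi> x) =
      (\<Sum>\<^sub>\<infinity>k. a * (c k * mode_integral \<phi> k) + b * (c k * mode_integral \<psi> k))"
    using * by (simp add: fourier_series_apply test_lincomb mode_integral_lincomb test_continuous algebra_simps)
  also have "\<dots> = (\<Sum>\<^sub>\<infinity>k. a * (c k * mode_integral \<phi> k)) + (\<Sum>\<^sub>\<infinity>k. b * (c k * mode_integral \<psi> k))"
    using * by (intro infsum_add summable_on_cmult_right fourier_series_summable c)
  also have "\<dots> = a * fourier_series c \<phi> + b * fourier_series c \<psi>"
    using * by (simp add: fourier_series_apply infsum_cmult_right fourier_series_summable c)
  finally show "fourier_series c (\<lambda>x. a * \<phi> x + b * \<psi> x) = a * fourier_series c \<phi> + b * fourier_series c \<psi>" .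
next
  show "\<exists>N C. \<forall>\<phi>\<in>test_functions. norm (fourier_series c \<phi>) \<le> C * test_norm N \<phi>"
    using c by (elim poly_boundedE) (blast intro: fourier_series_bound)
qed

lemma fourier_coeff_fourier_series: "fourier_coeff (fourier_series c) k = c k"
  for k :: "int^'n::finite"
proof -
  have "fourier_series c (fourier_mode (- k)) = (\<Sum>\<^sub>\<infinity>l. c l * mode_integral (fourier_mode (- k)) l)"
    by (simp add: fourier_series_apply)
  also have "\<dots> = (\<Sum>\<^sub>\<infinity>l\<in>{k}. c l * mode_integral (fourier_mode (- k)) l)"
    by (rule infsum_cong_neutral) (auto simp: mode_integral_fourier_mode)
  also have "\<dots> = c k * of_real ((2 * pi) ^ CARD('n))"
    by (simp add: mode_integral_fourier_mode)
  finally show ?thesis unfolding fourier_coeff_def by simp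
qed

lemma test_norm_fourier_mode_le:
  "test_norm N (fourier_mode (- k :: int^'n::finite)) \<le> real (card {js :: 'n list. length js \<le> N}) * freq_weight k ^ N"
  unfolding test_norm_def
proof (rule sum_bounded_above)
  fix js :: "'n list" assume js: "js \<in> {js. length js \<le> N}"
  have "(\<Prod>j\<leftarrow>js. \<bar>real_of_int (k $ j)\<bar>) \<le> freq_weight k ^ length js"
  proof (induction js)
    case (Cons j js)
    then show ?case using freq_weight_ge_1[of k]
      by (auto intro!: mult_mono abs_component_le_freq_weight prod_list_nonneg)
  qed simp
  also have "\<dots> \<le> freq_weight k ^ N"
    using js freq_weight_ge_1[of k] by (intro power_increasing) auto
  finally have "(\<Prod>j\<leftarrow>js. \<bar>real_of_int (k $ j)\<bar>) \<le> freq_weight k ^ N" .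
  then show "(SUP x. norm (iter_partial js (fourier_mode (- k)) x)) \<le> freq_weight k ^ N"
    by (intro cSUP_least) (auto simp: iter_partial_fourier_mode norm_mult norm_prod_list)
qed

text \<open>Continuity of \<open>T\<close>, applied to the modes, whose test norms grow like a power
  of the weight. With \<open>fourier_series_periodic_distribution\<close>, polynomial growth
  characterises the coefficient sequences of periodic distributions.\<close>

lemma fourier_coeff_poly_bounded:
  fixes T :: "'n::finite distr"
  assumes "T \<in> periodic_distributions"
  shows "poly_bounded (fourier_coeff T)"
proof -
  obtain N C where NC: "\<And>\<phi>. \<phi> \<in> test_functions \<Longrightarrow> norm (T \<phi>) \<le> C * test_norm N \<phi>"
    using assms unfolding periodic_distributions_def by blast
  define L where "L = real (card {js :: 'n list. length js \<le> N})"
  have "norm (fourier_coeff T k) \<le> \<bar>C\<bar> * L / (2 * pi) ^ CARD('n) * freq_weight k ^ N" for k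
  proof -
    have "norm (T (fourier_mode (- k))) \<le> C * test_norm N (fourier_mode (- k))"
      by (rule NC) simp
    also have "\<dots> \<le> \<bar>C\<bar> * (L * freq_weight k ^ N)"
      using test_norm_fourier_mode_le[of N k] unfolding L_def
      by (intro mult_mono) (auto simp: test_norm_nonneg)
    finally have "norm (T (fourier_mode (- k))) / (2 * pi) ^ CARD('n) \<le> \<bar>C\<bar> * (L * freq_weight k ^ N) / (2 * pi) ^ CARD('n)"
      by (intro divide_right_mono) auto
    then show ?thesis unfolding fourier_coeff_def by (simp add: norm_divide norm_power norm_mult mult.assoc)
  qed
  then show ?thesis unfolding poly_bounded_def by blast
qed

lemma distribution_sum:
  assumes T: "T \<in> periodic_distributions" and "finite F" "\<And>k. \<phi> k \<in> test_functions"
  shows "T (\<lambda>x. \<Sum>k\<in>F. c k * \<phi> k x) = (\<Sum>k\<in>F. c k * T (\<phi> k))"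
proof -
  have lin: "T (\<lambda>x. a * \<phi> x + b * \<psi> x) = a * T \<phi> + b * T \<psi>"
    if "\<phi> \<in> test_functions" "\<psi> \<in> test_functions" for a b \<phi> \<psi>
    using T that unfolding periodic_distributions_def by blast
  show ?thesis
    using assms(2)
  proof induction
    case empty
    show ?case using lin[OF test_zero test_zero, of 0 0] by simp
  next
    case (insert k F)
    then show ?case
      using lin[OF assms(3)[of k] test_sum[OF insert.hyps(1) assms(3), of c], of "c k" 1] by simp
  qed
qed

section \<open>Fourier inversion for test functions and distributions\<close>

definition fourier_partial_sum :: "(real^'n::finite \<Rightarrow> complex) \<Rightarrow> (int^'n) set \<Rightarrow> real^'n \<Rightarrow> complex" where
  "fourier_partial_sum \<phi> F x =
     (\<Sum>k\<in>F. mode_integral \<phi> k / of_real ((2 * pi) ^ CARD('n)) * fourier_mode (- k) x)"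

text \<open>Summable coefficients give a continuous uniform limit with the same Fourier integrals as
  \<phi>, hence \<phi> itself. The modes carry -k because \<open>mode_integral \<phi> k\<close>
  belongs to the frequency -k.\<close>

lemma fourier_partial_sum_uniform_limit:
  fixes \<phi> :: "real^'n::finite \<Rightarrow> complex"
  assumes \<phi>: "\<phi> \<in> test_functions"
  shows "uniform_limit UNIV (fourier_partial_sum \<phi>) \<phi> (finite_subsets_at_top UNIV)"
proof -
  let ?P = "(2 * pi) ^ CARD('n)"
  define a where "a = (\<lambda>k. mode_integral \<phi> k / of_real ?P)"
  define S where "S = (\<lambda>x. \<Sum>\<^sub>\<infinity>k. a k * fourier_mode (- k) x)"
  \<comment> \<open>For the constant coefficient sequence 1, the general summability result speaks
    of the Fourier integrals themselves.\<close>
  have pb: "poly_bounded (\<lambda>k :: int^'n. 1)"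
    unfolding poly_bounded_def by (intro exI[of _ 1] exI[of _ 0]) simp
  have sm: "(\<lambda>k. norm (a k)) summable_on UNIV"
    using summable_on_cmult_right[OF fourier_series_abs_summable[OF pb \<phi>], of "1 / ?P"]
    by (simp add: a_def norm_divide norm_power norm_mult)
  have ul: "uniform_limit UNIV (\<lambda>F x. \<Sum>k\<in>F. a k * fourier_mode (- k) x) S (finite_subsets_at_top UNIV)"
    unfolding S_def by (rule Weierstrass_m_test_general[OF _ sm]) (simp add: norm_mult)
  have contS: "continuous_on UNIV S"
    by (rule uniform_limit_theorem[OF _ ul]) (auto intro!: always_eventually continuous_intros)
  have perS: "S (x + (2 * pi) *\<^sub>R axis j 1) = S x" for j x
    by (simp add: S_def fourier_mode_periodic)
  have coeffS: "mode_integral S l = mode_integral \<phi> l" for l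
  proof -
    \<comment> \<open>Multiplication by the mode \<open>l\<close> shifts all frequencies. Uniform
      convergence permits integration of the series, and orthogonality leaves the term k =
      l.\<close>
    have ul': "uniform_limit torus (\<lambda>F x. \<Sum>k\<in>F. a k * fourier_mode (l - k) x)
        (\<lambda>x. \<Sum>\<^sub>\<infinity>k. a k * fourier_mode (l - k) x) (finite_subsets_at_top UNIV)"
      by (rule Weierstrass_m_test_general[OF _ sm]) (simp add: norm_mult)
    obtain I J where IJ: "\<And>F. ((\<lambda>x. \<Sum>k\<in>F. a k * fourier_mode (l - k) x) has_integral I F) torus"
      "((\<lambda>x. \<Sum>\<^sub>\<infinity>k. a k * fourier_mode (l - k) x) has_integral J) torus"
      "(I \<longlongrightarrow> J) (finite_subsets_at_top UNIV)"
      unfolding torus_def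
      by (rule uniform_limit_integral_cbox[OF ul'[unfolded torus_def]]) (auto intro!: continuous_intros)
    have "I F = mode_integral \<phi> l" if "finite F" "l \<in> F" for F
    proof -
      have "I F = integral torus (\<lambda>x. \<Sum>k\<in>F. a k * fourier_mode (l - k) x)"
        by (rule integral_unique[OF IJ(1), symmetric])
      also have "\<dots> = (\<Sum>k\<in>F. integral torus (\<lambda>x. a k * fourier_mode (l - k) x))"
        using that by (intro integral_sum) (auto intro!: integrable_on_torus continuous_intros)
      also have "\<dots> = (\<Sum>k\<in>F. if k = l then mode_integral \<phi> l else 0)"
        by (intro sum.cong) (auto simp: integral_fourier_mode a_def)
      also have "\<dots> = mode_integral \<phi> l" using that by simp
      finally show ?thesis .
    qed
    then have "\<forall>\<^sub>F F in finite_subsets_at_top UNIV. I F = mode_integral \<phi> l"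
      unfolding eventually_finite_subsets_at_top by (intro exI[of _ "{l}"]) auto
    then have "J = mode_integral \<phi> l"
      using IJ(3) tendsto_unique[OF finite_subsets_at_top_neq_bot] tendsto_eventually by blast
    moreover have "(\<lambda>x. \<Sum>\<^sub>\<infinity>k. a k * fourier_mode (l - k) x) = (\<lambda>x. fourier_mode l x * S x)"
    proof
      fix x
      have "(\<Sum>\<^sub>\<infinity>k. a k * fourier_mode (l - k) x) = (\<Sum>\<^sub>\<infinity>k. fourier_mode l x * (a k * fourier_mode (- k) x))"
        using fourier_mode_add[of l "- k" x for k] by (simp add: mult_ac)
      also have "\<dots> = fourier_mode l x * S x"
        unfolding S_def by (rule infsum_cmult_right')
      finally show "(\<Sum>\<^sub>\<infinity>k. a k * fourier_mode (l - k) x) = fourier_mode l x * S x" .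
    qed
    ultimately show ?thesis using IJ(2) unfolding mode_integral_def by (simp add: integral_unique)
  qed
  have "\<phi> x - S x = 0" for x
  proof (rule mode_integral_zero_imp_zero)
    show "continuous_on UNIV (\<lambda>x. \<phi> x - S x)"
      by (intro continuous_intros contS test_continuous \<phi>)
    show "\<phi> (x + (2 * pi) *\<^sub>R axis j 1) - S (x + (2 * pi) *\<^sub>R axis j 1) = \<phi> x - S x" for j x
      by (simp add: perS test_periodic \<phi>)
    show "mode_integral (\<lambda>x. \<phi> x - S x) k = 0" for k
      using mode_integral_lincomb[OF test_continuous[OF \<phi>] contS, of 1 "- 1" k] coeffS by simp
  qed
  then have "S = \<phi>" by (simp add: fun_eq_iff)
  moreover have "fourier_partial_sum \<phi> = (\<lambda>F x. \<Sum>k\<in>F. a k * fourier_mode (- k) x)"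
    by (simp add: fun_eq_iff fourier_partial_sum_def a_def)
  ultimately show ?thesis using ul by simp
qed

text \<open>Differentiating the mode -k and integrating by parts against the mode k produce the same
  factor, so partial sums commute with derivatives. Uniform convergence thereby extends to
  convergence in every test norm.\<close>

lemma
  assumes \<phi>: "\<phi> \<in> test_functions" and F: "finite F"
  shows test_fourier_partial_sum: "fourier_partial_sum \<phi> F \<in> test_functions"
    and iter_partial_fourier_partial_sum:
      "iter_partial js (fourier_partial_sum \<phi> F) = fourier_partial_sum (iter_partial js \<phi>) F"
proof -
  have eq: "fourier_partial_sum \<phi> F =
     (\<lambda>x. \<Sum>k\<in>F. mode_integral \<phi> k / of_real ((2 * pi) ^ CARD('a)) * fourier_mode (- k) x)"
    by (simp add: fun_eq_iff fourier_partial_sum_def)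
  show "fourier_partial_sum \<phi> F \<in> test_functions"
    unfolding eq by (rule test_sum[OF F]) simp
  show "iter_partial js (fourier_partial_sum \<phi> F) = fourier_partial_sum (iter_partial js \<phi>) F"
    unfolding eq iter_partial_sum[OF F test_fourier_mode] iter_partial_fourier_mode
      fourier_partial_sum_def[abs_def] mode_integral_iter_partial[OF \<phi>]
    by (simp add: mult_ac)
qed

lemma fourier_partial_sum_test_norm:
  fixes \<phi> :: "real^'n::finite \<Rightarrow> complex"
  assumes \<phi>: "\<phi> \<in> test_functions" and e: "e > 0"
  shows "\<forall>\<^sub>F F in finite_subsets_at_top UNIV. test_norm N (\<lambda>x. \<phi> x - fourier_partial_sum \<phi> F x) \<le> e"
proof -
  let ?L = "{js :: 'n list. length js \<le> N}"
  define L where "L = real (card ?L)"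
  have "?L \<noteq> {}" by (auto intro: exI[of _ "[]"])
  then have L: "L > 0" unfolding L_def by (simp add: card_gt_0_iff)
  have "\<forall>\<^sub>F F in finite_subsets_at_top UNIV. \<forall>js\<in>?L. \<forall>x\<in>UNIV.
      dist (fourier_partial_sum (iter_partial js \<phi>) F x) (iter_partial js \<phi> x) < e / L"
    using fourier_partial_sum_uniform_limit[OF test_iter_partial[OF \<phi>]] e L
    by (intro eventually_ball_finite ballI uniform_limitD) auto
  moreover have "\<forall>\<^sub>F F :: (int^'n) set in finite_subsets_at_top UNIV. finite F"
    by (rule eventually_finite_subsets_at_top_weakI)
  ultimately show ?thesis
  proof eventually_elim
    case (elim F)
    have "test_norm N (\<lambda>x. \<phi> x - fourier_partial_sum \<phi> F x) \<le> real (card ?L) * (e / L)"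
      unfolding test_norm_def
    proof (rule sum_bounded_above)
      fix js assume js: "js \<in> ?L"
      have "iter_partial js (\<lambda>x. \<phi> x - fourier_partial_sum \<phi> F x) =
          (\<lambda>x. iter_partial js \<phi> x - fourier_partial_sum (iter_partial js \<phi>) F x)"
        using iter_partial_lincomb[OF \<phi> test_fourier_partial_sum[OF \<phi> elim(2)], of js 1 "- 1"]
        by (simp add: iter_partial_fourier_partial_sum[OF \<phi> elim(2)])
      then show "(SUP x. norm (iter_partial js (\<lambda>x. \<phi> x - fourier_partial_sum \<phi> F x) x)) \<le> e / L"
        using elim(1) js by (intro cSUP_least) (auto simp: dist_norm norm_minus_commute intro: less_imp_le)
    qed
    then show ?case unfolding L_def[symmetric] using L by simp
  qed
qed

text \<open>By linearity, \<open>T\<close> maps the partial sums of \<phi> to the partial sums of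
  its own Fourier series; they converge because \<open>T\<close> is controlled by a test
  norm.\<close>

lemma fourier_inversion:
  fixes T :: "'n::finite distr"
  assumes T: "T \<in> periodic_distributions"
  shows "fourier_series (fourier_coeff T) = T"
proof
  fix \<phi> :: "real^'n \<Rightarrow> complex"
  show "fourier_series (fourier_coeff T) \<phi> = T \<phi>"
  proof (cases "\<phi> \<in> test_functions")
    case False
    then show ?thesis using T by (simp add: fourier_series_def periodic_distributions_def)
  next
    case \<phi>: True
    obtain N C where NC: "\<And>\<phi>. \<phi> \<in> test_functions \<Longrightarrow> norm (T \<phi>) \<le> C * test_norm N \<phi>"
      using T unfolding periodic_distributions_def by blast
    have sum: "(\<Sum>k\<in>F. fourier_coeff T k * mode_integral \<phi> k) = T (fourier_partial_sum \<phi> F)" if "finite F" for F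
    proof -
      have "fourier_partial_sum \<phi> F =
         (\<lambda>x. \<Sum>k\<in>F. mode_integral \<phi> k / of_real ((2 * pi) ^ CARD('n)) * fourier_mode (- k) x)"
        by (simp add: fun_eq_iff fourier_partial_sum_def)
      then have "T (fourier_partial_sum \<phi> F) =
          (\<Sum>k\<in>F. mode_integral \<phi> k / of_real ((2 * pi) ^ CARD('n)) * T (fourier_mode (- k)))"
        using distribution_sum[OF T that test_fourier_mode] by (simp only:)
      then show ?thesis by (simp add: fourier_coeff_def mult.commute)
    qed
    have "((\<lambda>k. fourier_coeff T k * mode_integral \<phi> k) has_sum T \<phi>) UNIV"
      unfolding has_sum_def
    proof (rule tendstoI)
      fix e :: real assume "e > 0"
      \<comment> \<open>The added 1 keeps the denominator positive for \<open>C = 0\<close>; the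
        factor 2 makes the final inequality strict.\<close>
      define d where "d = e / (2 * (\<bar>C\<bar> + 1))"
      have d: "d > 0" "\<bar>C\<bar> * d < e" using \<open>e > 0\<close> by (simp_all add: d_def field_simps add_nonneg_pos)
      have "\<forall>\<^sub>F F :: (int^'n) set in finite_subsets_at_top UNIV. finite F"
        by (rule eventually_finite_subsets_at_top_weakI)
      with fourier_partial_sum_test_norm[OF \<phi> d(1), of N]
      show "\<forall>\<^sub>F F in finite_subsets_at_top UNIV. dist (\<Sum>k\<in>F. fourier_coeff T k * mode_integral \<phi> k) (T \<phi>) < e"
      proof eventually_elim
        case (elim F)
        note S = test_fourier_partial_sum[OF \<phi> elim(2)]
        have D: "(\<lambda>x. \<phi> x - fourier_partial_sum \<phi> F x) \<in> test_functions"
          using test_lincomb[OF \<phi> S, of 1 "- 1"] by simp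
        have "T (\<lambda>x. 1 * \<phi> x + (- 1) * fourier_partial_sum \<phi> F x) = 1 * T \<phi> + (- 1) * T (fourier_partial_sum \<phi> F)"
          using T \<phi> S unfolding periodic_distributions_def by blast
        then have "T \<phi> - T (fourier_partial_sum \<phi> F) = T (\<lambda>x. \<phi> x - fourier_partial_sum \<phi> F x)" by simp
        also have "norm \<dots> \<le> C * test_norm N (\<lambda>x. \<phi> x - fourier_partial_sum \<phi> F x)" by (rule NC[OF D])
        also have "\<dots> \<le> \<bar>C\<bar> * d" using elim(1) test_norm_nonneg[OF D] by (intro mult_mono) auto
        finally show ?case using d sum[OF elim(2)] by (simp add: dist_norm norm_minus_commute)
      qed
    qed
    then show ?thesis by (simp add: fourier_series_apply[OF \<phi>] infsumI)
  qed
qed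

text \<open>Integrating by parts twice in direction j multiplies a mode integral by (-i k_j)^2 =
  -k_j^2.\<close>

lemma laplacian_fourier_series:
  fixes c :: "int^'n::finite \<Rightarrow> complex"
  shows "laplacian (fourier_series c) = fourier_series (\<lambda>k. - of_real ((norm (real_vec k))\<^sup>2) * c k)"
proof
  fix \<phi> :: "real^'n \<Rightarrow> complex"
  show "laplacian (fourier_series c) \<phi> = fourier_series (\<lambda>k. - of_real ((norm (real_vec k))\<^sup>2) * c k) \<phi>"
  proof (cases "\<phi> \<in> test_functions")
    case \<phi>: True
    have pd: "partial_deriv j (partial_deriv j \<phi>) = iter_partial [j, j] \<phi>" for j
      by (simp add: iter_partial_def)
    define \<psi> where "\<psi> = (\<lambda>x. \<Sum>j\<in>UNIV. 1 * iter_partial [j, j] \<phi> x)"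
    have \<psi>: "\<psi> \<in> test_functions" unfolding \<psi>_def by (intro test_sum test_iter_partial \<phi>) auto
    have "mode_integral \<psi> k = - of_real ((norm (real_vec k))\<^sup>2) * mode_integral \<phi> k" for k
    proof -
      have "mode_integral \<psi> k = integral torus (\<lambda>x. \<Sum>j\<in>UNIV. fourier_mode k x * iter_partial [j, j] \<phi> x)"
        by (simp add: mode_integral_def \<psi>_def sum_distrib_left)
      also have "\<dots> = (\<Sum>j\<in>UNIV. mode_integral (iter_partial [j, j] \<phi>) k)"
        unfolding mode_integral_def
        by (intro integral_sum mode_integrable test_continuous test_iter_partial \<phi>) auto
      also have "\<dots> = (\<Sum>j\<in>UNIV. - of_real ((of_int (k $ j))\<^sup>2) * mode_integral \<phi> k)"
      proof (intro sum.cong refl)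
        fix j
        have "(\<Prod>j\<leftarrow>[j, j]. - \<i> * complex_of_int (k $ j)) = - of_real ((of_int (k $ j))\<^sup>2)"
          by (simp add: complex_eq_iff power2_eq_square)
        then show "mode_integral (iter_partial [j, j] \<phi>) k = - of_real ((of_int (k $ j))\<^sup>2) * mode_integral \<phi> k"
          unfolding mode_integral_iter_partial[OF \<phi>] by (simp only:)
      qed
      also have "\<dots> = - of_real ((norm (real_vec k))\<^sup>2) * mode_integral \<phi> k"
        unfolding norm_real_vec_power2 by (simp add: sum_distrib_right sum_negf)
      finally show ?thesis .
    qed
    moreover have "laplacian (fourier_series c) \<phi> = fourier_series c \<psi>"
      using \<phi> by (simp add: laplacian_def pd \<psi>_def)
    ultimately show ?thesis by (simp add: fourier_series_apply \<phi> \<psi> mult_ac)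
  qed (simp add: laplacian_def fourier_series_def)
qed

section \<open>Wave equations\<close>

text \<open>The value \<open>t\<close> at frequency 0 is the limit of sin (w t) / w, which makes the
  affine zero mode an instance of the general formula.\<close>

definition sinc_freq :: "real \<Rightarrow> real \<Rightarrow> real" where
  "sinc_freq w t = (if w = 0 then t else sin (w * t) / w)"

definition wave_coeff :: "complex \<Rightarrow> complex \<Rightarrow> real \<Rightarrow> real \<Rightarrow> complex" where
  "wave_coeff a b w t = a * of_real (cos (w * t)) + b * of_real (sinc_freq w t)"

definition wave_velocity :: "complex \<Rightarrow> complex \<Rightarrow> real \<Rightarrow> real \<Rightarrow> complex" where
  "wave_velocity a b w t = b * of_real (cos (w * t)) - a * of_real (w * sin (w * t))"

lemma abs_sinc_freq_le: "\<bar>sinc_freq w t\<bar> \<le> \<bar>t\<bar>"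
  using abs_sin_x_le_abs_x[of "w * t"] by (simp add: sinc_freq_def abs_mult divide_simps mult.commute)

lemma wave_coeff_0 [simp]: "wave_coeff a b w 0 = a"
  by (simp add: wave_coeff_def sinc_freq_def)

lemma wave_velocity_0 [simp]: "wave_velocity a b w 0 = b"
  by (simp add: wave_velocity_def)

lemma sinc_freq_deriv: "(sinc_freq w has_real_derivative cos (w * t)) (at t)"
proof (cases "w = 0")
  case True
  then show ?thesis by (simp add: sinc_freq_def[abs_def])
next
  case False
  then show ?thesis unfolding sinc_freq_def[abs_def]
    by (auto intro!: derivative_eq_intros)
qed

lemma wave_coeff_deriv:
  "(wave_coeff a b w has_vector_derivative wave_velocity a b w t) (at t)"
proof -
  have "((\<lambda>t. cos (w * t)) has_real_derivative - (w * sin (w * t))) (at t)"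
    by (auto intro!: derivative_eq_intros)
  then have "((\<lambda>t. a * of_real (cos (w * t))) has_vector_derivative a * of_real (- (w * sin (w * t)))) (at t)"
    by (intro has_vector_derivative_mult_right has_vector_derivative_of_real)
  moreover have "((\<lambda>t. b * of_real (sinc_freq w t)) has_vector_derivative b * of_real (cos (w * t))) (at t)"
    by (intro has_vector_derivative_mult_right has_vector_derivative_of_real sinc_freq_deriv)
  ultimately have "((\<lambda>t. a * of_real (cos (w * t)) + b * of_real (sinc_freq w t)) has_vector_derivative
      a * of_real (- (w * sin (w * t))) + b * of_real (cos (w * t))) (at t)"
    by (rule has_vector_derivative_add)
  then show ?thesis unfolding wave_coeff_def[abs_def] wave_velocity_def by (simp add: algebra_simps)
qed

lemma wave_velocity_deriv:
  "(wave_velocity a b w has_vector_derivative - of_real (w\<^sup>2) * wave_coeff a b w t) (at t)"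
proof -
  have "((\<lambda>t. cos (w * t)) has_real_derivative - (w * sin (w * t))) (at t)"
    by (auto intro!: derivative_eq_intros)
  then have "((\<lambda>t. b * of_real (cos (w * t))) has_vector_derivative b * of_real (- (w * sin (w * t)))) (at t)"
    by (intro has_vector_derivative_mult_right has_vector_derivative_of_real)
  moreover have "((\<lambda>t. w * sin (w * t)) has_real_derivative w\<^sup>2 * cos (w * t)) (at t)"
    by (auto intro!: derivative_eq_intros simp: power2_eq_square)
  then have "((\<lambda>t. a * of_real (w * sin (w * t))) has_vector_derivative a * of_real (w\<^sup>2 * cos (w * t))) (at t)"
    by (intro has_vector_derivative_mult_right has_vector_derivative_of_real)
  ultimately have "((\<lambda>t. b * of_real (cos (w * t)) - a * of_real (w * sin (w * t))) has_vector_derivative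
      b * of_real (- (w * sin (w * t))) - a * of_real (w\<^sup>2 * cos (w * t))) (at t)"
    by (rule has_vector_derivative_diff)
  \<comment> \<open>Valid also for w = 0, where both sides vanish, so the oscillator equation needs
    no case distinction.\<close>
  moreover have "of_real (w * sin (w * t)) = complex_of_real (w\<^sup>2 * sinc_freq w t)"
    by (simp add: sinc_freq_def power2_eq_square)
  then have "b * of_real (- (w * sin (w * t))) - a * of_real (w\<^sup>2 * cos (w * t)) = - of_real (w\<^sup>2) * wave_coeff a b w t"
    unfolding wave_coeff_def of_real_minus by (simp add: algebra_simps)
  ultimately show ?thesis unfolding wave_velocity_def[abs_def] by simp
qed

lemma norm_wave_coeff_le: "norm (wave_coeff a b w t) \<le> (1 + \<bar>t\<bar>) * (norm a + norm b)"
proof -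
  have "norm (wave_coeff a b w t) \<le> norm a * \<bar>cos (w * t)\<bar> + norm b * \<bar>sinc_freq w t\<bar>"
    unfolding wave_coeff_def by (rule norm_triangle_le) (simp add: norm_mult)
  also have "\<dots> \<le> norm a * (1 + \<bar>t\<bar>) + norm b * (1 + \<bar>t\<bar>)"
    using order_trans[OF abs_cos_le_one[of "w * t"], of "1 + \<bar>t\<bar>"] order_trans[OF abs_sinc_freq_le[of w t], of "1 + \<bar>t\<bar>"]
    by (intro add_mono mult_left_mono) simp_all
  finally show ?thesis by (simp add: algebra_simps)
qed

lemma norm_wave_velocity_le:
  assumes "w \<ge> 0"
  shows "norm (wave_velocity a b w t) \<le> (1 + w) * (norm a + norm b)"
proof -
  have "norm (wave_velocity a b w t) \<le> norm b * \<bar>cos (w * t)\<bar> + norm a * (w * \<bar>sin (w * t)\<bar>)"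
    unfolding wave_velocity_def using assms
    by (intro order_trans[OF norm_triangle_ineq4]) (simp add: norm_mult abs_mult)
  also have "\<dots> \<le> norm b * (1 + w) + norm a * ((1 + w) * 1)"
    using order_trans[OF abs_cos_le_one[of "w * t"], of "1 + w"] abs_sin_le_one[of "w * t"] assms
    by (intro add_mono mult_left_mono mult_mono) simp_all
  finally show ?thesis by (simp add: algebra_simps)
qed

text \<open>Second derivatives need a bound uniform in \<open>t\<close>, unlike
  \<open>norm_wave_coeff_le\<close>. Two powers of w turn the sinc term into w |sin|, which removes
  the \<open>t\<close>.\<close>

lemma norm_wave_acceleration_le:
  assumes w: "w \<ge> 0"
  shows "norm (- of_real (w\<^sup>2) * wave_coeff a b w t) \<le> (1 + w)\<^sup>2 * (norm a + norm b)"
proof -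
  have s: "w\<^sup>2 * \<bar>sinc_freq w t\<bar> = w * \<bar>sin (w * t)\<bar>"
    using w by (simp add: sinc_freq_def power2_eq_square abs_mult)
  have "norm (- of_real (w\<^sup>2) * wave_coeff a b w t) = w\<^sup>2 * norm (wave_coeff a b w t)"
    by (simp add: norm_mult norm_power)
  also have "\<dots> \<le> w\<^sup>2 * (norm a * \<bar>cos (w * t)\<bar> + norm b * \<bar>sinc_freq w t\<bar>)"
    unfolding wave_coeff_def by (intro mult_left_mono norm_triangle_le) (simp_all add: norm_mult)
  also have "\<dots> = w\<^sup>2 * \<bar>cos (w * t)\<bar> * norm a + w\<^sup>2 * \<bar>sinc_freq w t\<bar> * norm b"
    by (simp add: algebra_simps)
  also have "\<dots> \<le> (1 + w)\<^sup>2 * norm a + (1 + w)\<^sup>2 * norm b"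
  proof (intro add_mono mult_right_mono)
    have "w\<^sup>2 * \<bar>cos (w * t)\<bar> \<le> w\<^sup>2 * 1"
      using abs_cos_le_one[of "w * t"] by (intro mult_left_mono) auto
    also have "\<dots> \<le> (1 + w)\<^sup>2" using w by (simp add: power_mono)
    finally show "w\<^sup>2 * \<bar>cos (w * t)\<bar> \<le> (1 + w)\<^sup>2" .
    have "w * \<bar>sin (w * t)\<bar> \<le> w * 1"
      using abs_sin_le_one[of "w * t"] w by (intro mult_left_mono) auto
    also have "\<dots> \<le> (1 + w)\<^sup>2" using w by (simp add: power2_eq_square algebra_simps)
    finally show "w\<^sup>2 * \<bar>sinc_freq w t\<bar> \<le> (1 + w)\<^sup>2" unfolding s .
  qed auto
  finally show ?thesis by (simp add: algebra_simps)
qed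

section \<open>Time derivatives of Fourier series and the wave equation\<close>

lemma quadratic_remainder:
  fixes f :: "real \<Rightarrow> complex"
  assumes f: "\<And>x. (f has_vector_derivative f' x) (at x)"
    and f': "\<And>x. (f' has_vector_derivative f'' x) (at x)"
    and K: "\<And>x. norm (f'' x) \<le> K"
  shows "norm (f s - f t - (s - t) *\<^sub>R f' t) \<le> K * (s - t)\<^sup>2"
proof -
  \<comment> \<open>Two mean value inequalities in a row lose the factor 1/2 of Taylor's formula;
    only the order (s - t)^2 matters below.\<close>
  let ?S = "closed_segment t s"
  have "norm (f' x - f' t) \<le> K * \<bar>s - t\<bar>" if "x \<in> ?S" for x
  proof -
    have "norm (f' x - f' t) \<le> K * norm (x - t)"
    proof (rule differentiable_bound[where S = UNIV])
      fix y
      show "(f' has_derivative (\<lambda>h. h *\<^sub>R f'' y)) (at y within UNIV)"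
        using f' by (simp add: has_vector_derivative_def)
      show "onorm (\<lambda>h. h *\<^sub>R f'' y) \<le> K"
        using mult_right_mono[OF K[of y] abs_ge_zero] by (intro onorm_le) (simp add: mult.commute)
    qed auto
    also have "\<dots> \<le> K * \<bar>s - t\<bar>"
      using that order_trans[OF norm_ge_zero K[of 0]] segment_bound(1)[of x t s]
      by (intro mult_left_mono) auto
    finally show ?thesis .
  qed
  then have "norm (f s - f t - (s - t) *\<^sub>R f' t) \<le> norm (s - t) * (K * \<bar>s - t\<bar>)"
    by (intro vector_differentiable_bound_linearization[of ?S])
       (auto intro: has_vector_derivative_at_within f)
  then show ?thesis by (simp add: power2_eq_square mult_ac)
qed

lemma poly_bounded_combine:
  assumes "poly_bounded c" "poly_bounded d" "B \<ge> 0"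
    and le: "\<And>k. norm (e k) \<le> B * freq_weight k ^ L * (norm (c k) + norm (d k))"
  shows "poly_bounded e"
proof -
  obtain C M where C: "C \<ge> 0" "\<And>k. norm (c k) \<le> C * freq_weight k ^ M"
    using assms(1) by (rule poly_boundedE) blast
  obtain D N where D: "D \<ge> 0" "\<And>k. norm (d k) \<le> D * freq_weight k ^ N"
    using assms(2) by (rule poly_boundedE) blast
  have "norm (e k) \<le> B * (C + D) * freq_weight k ^ (L + (M + N))" for k
  proof -
    have w: "freq_weight k \<ge> 1" by (rule freq_weight_ge_1)
    have "norm (c k) \<le> C * freq_weight k ^ (M + N)"
      by (rule order_trans[OF C(2)]) (intro mult_left_mono power_increasing C(1) w; simp)
    moreover have "norm (d k) \<le> D * freq_weight k ^ (M + N)"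
      by (rule order_trans[OF D(2)]) (intro mult_left_mono power_increasing D(1) w; simp)
    ultimately have "norm (c k) + norm (d k) \<le> (C + D) * freq_weight k ^ (M + N)"
      by (simp add: distrib_right)
    then have "B * freq_weight k ^ L * (norm (c k) + norm (d k)) \<le> B * freq_weight k ^ L * ((C + D) * freq_weight k ^ (M + N))"
      using w assms(3) by (intro mult_left_mono) auto
    then show ?thesis using le[of k] by (simp add: power_add mult_ac)
  qed
  then show ?thesis unfolding poly_bounded_def by blast
qed

text \<open>The remainder of each mode is at most \<open>M k\<close> times (s - t)^2. Rapid decay of
  the mode integrals makes these sum to a constant times (s - t)^2, which gives the derivative of
  the sum.\<close>

lemma fourier_series_deriv:
  fixes c c' c'' :: "int^'n::finite \<Rightarrow> real \<Rightarrow> complex"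
  assumes c: "\<And>k x. (c k has_vector_derivative c' k x) (at x)"
    and c': "\<And>k x. (c' k has_vector_derivative c'' k x) (at x)"
    and M: "\<And>k x. norm (c'' k x) \<le> M k" "poly_bounded (\<lambda>k. of_real (M k))"
    and pb: "\<And>t. poly_bounded (\<lambda>k. c k t)" "\<And>t. poly_bounded (\<lambda>k. c' k t)"
    and \<phi>: "\<phi> \<in> test_functions"
  shows "((\<lambda>t. fourier_series (\<lambda>k. c k t) \<phi>) has_vector_derivative fourier_series (\<lambda>k. c' k t) \<phi>) (at t within T)"
proof -
  define F where "F = (\<lambda>t. fourier_series (\<lambda>k. c k t) \<phi>)"
  define G where "G = fourier_series (\<lambda>k. c' k t) \<phi>"
  define K where "K = (\<Sum>\<^sub>\<infinity>k. M k * norm (mode_integral \<phi> k))"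
  have M0: "M k \<ge> 0" for k using order_trans[OF norm_ge_zero M(1)] .
  have smM: "(\<lambda>k. M k * norm (mode_integral \<phi> k)) summable_on UNIV"
    using fourier_series_abs_summable[OF M(2) \<phi>] M0 by (simp add: norm_mult)
  have rem: "norm (F s - F t - (s - t) *\<^sub>R G) \<le> K * (s - t)\<^sup>2" for s
  proof -
    let ?r = "\<lambda>k. c k s - c k t - (s - t) *\<^sub>R c' k t"
    have le: "norm (?r k * mode_integral \<phi> k) \<le> (s - t)\<^sup>2 * (M k * norm (mode_integral \<phi> k))" for k
    proof -
      have "norm (?r k) \<le> M k * (s - t)\<^sup>2"
        by (rule quadratic_remainder[OF c c' M(1)])
      then have "norm (?r k) * norm (mode_integral \<phi> k) \<le> (M k * (s - t)\<^sup>2) * norm (mode_integral \<phi> k)"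
        by (intro mult_right_mono) auto
      then show ?thesis by (simp add: norm_mult mult_ac)
    qed
    have smr: "(\<lambda>k. norm (?r k * mode_integral \<phi> k)) summable_on UNIV"
      by (rule summable_on_comparison_test[OF summable_on_cmult_right[OF smM] le]) auto
    note sm = fourier_series_summable[OF pb(1) \<phi>] fourier_series_summable[OF pb(2) \<phi>]
    have "F s - F t - (s - t) *\<^sub>R G = (\<Sum>\<^sub>\<infinity>k. ?r k * mode_integral \<phi> k)"
    proof -
      have "((\<lambda>k. c k s * mode_integral \<phi> k + - (c k t * mode_integral \<phi> k) + - ((s - t) *\<^sub>R (c' k t * mode_integral \<phi> k)))
          has_sum (F s + - F t + - ((s - t) *\<^sub>R G))) UNIV"
        unfolding F_def G_def fourier_series_apply[OF \<phi>]
        by (intro has_sum_add has_sum_uminusI has_sum_scaleR has_sum_infsum sm)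
      from infsumI[OF this] show ?thesis by (simp add: algebra_simps)
    qed
    also have "norm \<dots> \<le> (\<Sum>\<^sub>\<infinity>k. norm (?r k * mode_integral \<phi> k))"
      by (rule norm_infsum_bound[OF smr])
    also have "\<dots> \<le> (\<Sum>\<^sub>\<infinity>k. (s - t)\<^sup>2 * (M k * norm (mode_integral \<phi> k)))"
      by (intro infsum_mono smr le summable_on_cmult_right smM)
    also have "\<dots> = (s - t)\<^sup>2 * K"
      unfolding K_def by (rule infsum_cmult_right[OF smM])
    finally show ?thesis by (simp add: mult.commute)
  qed
  have "(F has_vector_derivative G) (at t within T)"
    unfolding has_vector_derivative_def
  proof (rule has_derivativeI_sandwich[of 1 _ _ _ _ "\<lambda>s. K * \<bar>s - t\<bar>"])
    fix s assume "s \<noteq> t"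
    then have p: "\<bar>s - t\<bar> > 0" by simp
    have "norm (F s - F t - (s - t) *\<^sub>R G) / \<bar>s - t\<bar> \<le> K * (s - t)\<^sup>2 / \<bar>s - t\<bar>"
      using rem p by (intro divide_right_mono) auto
    also have "\<dots> = K * \<bar>s - t\<bar>"
    proof -
      have "(s - t)\<^sup>2 = \<bar>s - t\<bar> * \<bar>s - t\<bar>" by (simp only: power2_eq_square abs_mult_self_eq)
      then have "K * (s - t)\<^sup>2 / \<bar>s - t\<bar> = K * \<bar>s - t\<bar> * \<bar>s - t\<bar> / \<bar>s - t\<bar>" by (simp only: mult.assoc)
      also have "\<dots> = K * \<bar>s - t\<bar>"
        by (rule nonzero_mult_div_cancel_right[OF less_imp_neq[OF p, symmetric]])
      finally show ?thesis .
    qed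
    finally show "norm (F s - F t - (s - t) *\<^sub>R G) / norm (s - t) \<le> K * \<bar>s - t\<bar>" by simp
  next
    have "((\<lambda>s. K * \<bar>s - t\<bar>) \<longlongrightarrow> K * \<bar>t - t\<bar>) (at t within T)"
      by (intro tendsto_intros)
    then show "((\<lambda>s. K * \<bar>s - t\<bar>) \<longlongrightarrow> 0) (at t within T)" by simp
  qed (auto intro: bounded_linear_scaleR_left)
  then show ?thesis by (simp add: F_def G_def)
qed

lemma wave_coeff_poly_bounded:
  assumes "poly_bounded a" "poly_bounded b"
  shows "poly_bounded (\<lambda>k. wave_coeff (a k) (b k) (w k) t)"
  by (rule poly_bounded_combine[OF assms, of "1 + \<bar>t\<bar>" _ 0]) (simp_all add: norm_wave_coeff_le)

lemma
  assumes ab: "poly_bounded a" "poly_bounded b" and w: "\<And>k. w k \<ge> 0" "\<And>k. w k \<le> C * freq_weight k ^ N"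
  shows wave_velocity_poly_bounded: "poly_bounded (\<lambda>k. wave_velocity (a k) (b k) (w k) t)"
    and wave_power_poly_bounded: "poly_bounded (\<lambda>k. of_real ((1 + w k) ^ m * (norm (a k) + norm (b k))))"
proof -
  have C: "C \<ge> 0" using order_trans[OF w(1) w(2)[of 0]] by simp
  have le: "1 + w k \<le> (1 + C) * freq_weight k ^ N" for k
    using w(2)[of k] one_le_power[OF freq_weight_ge_1, of k N] by (simp add: distrib_right)
  have lem: "(1 + w k) ^ m \<le> (1 + C) ^ m * freq_weight k ^ (N * m)" for k m
    using power_mono[OF le, of k m] w(1)[of k] by (simp add: power_mult_distrib power_mult)
  show "poly_bounded (\<lambda>k. of_real ((1 + w k) ^ m * (norm (a k) + norm (b k))))"
    using lem w(1) C
    by (intro poly_bounded_combine[OF ab, of "(1 + C) ^ m" _ "N * m"])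
       (auto simp: norm_mult norm_power simp flip: of_real_add of_real_mult of_real_power intro!: mult_right_mono)
  show "poly_bounded (\<lambda>k. wave_velocity (a k) (b k) (w k) t)"
    using C
    by (intro poly_bounded_combine[OF ab, of "1 + C" _ N] order_trans[OF norm_wave_velocity_le[OF w(1)]] mult_right_mono le) auto
qed

text \<open>Covers both Laplacians: all that is used of \<open>A\<close> is that it multiplies
  coefficients by -w^2 with w of polynomial growth. The initial values are recovered by
  \<open>fourier_inversion\<close>.\<close>

lemma wave_solution_fourier_series:
  fixes f g :: "'n::finite distr" and w :: "int^'n \<Rightarrow> real"
  assumes f: "f \<in> periodic_distributions" and g: "g \<in> periodic_distributions"
    and w: "\<And>k. w k \<ge> 0" "\<And>k. w k \<le> C * freq_weight k ^ N"
    and A: "\<And>c. A (fourier_series c) = fourier_series (\<lambda>k. - of_real ((w k)\<^sup>2) * c k)"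
  shows "wave_solution A f g
     (\<lambda>t. fourier_series (\<lambda>k. wave_coeff (fourier_coeff f k) (fourier_coeff g k) (w k) t))"
proof -
  let ?a = "fourier_coeff f" and ?b = "fourier_coeff g"
  let ?U = "\<lambda>t. fourier_series (\<lambda>k. wave_coeff (?a k) (?b k) (w k) t)"
  let ?V = "\<lambda>t. fourier_series (\<lambda>k. wave_velocity (?a k) (?b k) (w k) t)"
  note ab = fourier_coeff_poly_bounded[OF f] fourier_coeff_poly_bounded[OF g]
  note pb = wave_coeff_poly_bounded[OF ab, of w] wave_velocity_poly_bounded[OF ab w]
  have pb_acc: "poly_bounded (\<lambda>k. - of_real ((w k)\<^sup>2) * wave_coeff (?a k) (?b k) (w k) t)" for t
  \<comment> \<open>The combination lemma expects two sequences; the single majorant is passed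
    twice.\<close>
  proof (rule poly_bounded_combine[OF wave_power_poly_bounded[OF ab w, of 2] wave_power_poly_bounded[OF ab w, of 2], of 1 _ 0])
    fix k
    show "norm (- of_real ((w k)\<^sup>2) * wave_coeff (?a k) (?b k) (w k) t) \<le> 1 * freq_weight k ^ 0 *
      (norm (complex_of_real ((1 + w k)\<^sup>2 * (norm (?a k) + norm (?b k))))
       + norm (complex_of_real ((1 + w k)\<^sup>2 * (norm (?a k) + norm (?b k)))))"
      using norm_wave_acceleration_le[OF w(1)[of k], of "?a k" "?b k" t]
        norm_ge_zero[of "- of_real ((w k)\<^sup>2) * wave_coeff (?a k) (?b k) (w k) t"]
      unfolding norm_of_real power_0 mult_1 by linarith
  qed simp
  have "has_time_derivative ?U ?V"
    unfolding has_time_derivative_def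
    by (intro allI impI ballI fourier_series_deriv[OF wave_coeff_deriv wave_velocity_deriv
          norm_wave_acceleration_le[OF w(1)] wave_power_poly_bounded[OF ab w] pb])
  moreover have "has_time_derivative ?V (\<lambda>t. A (?U t))"
    unfolding has_time_derivative_def A
  \<comment> \<open>The second derivative of the velocity is -w^2 times the velocity, whose bound
    carries another power of w: hence the cube.\<close>
  proof (intro allI impI ballI fourier_series_deriv[where M = "\<lambda>k. (1 + w k) ^ 3 * (norm (?a k) + norm (?b k))"])
    fix k x
    show "((\<lambda>t. - of_real ((w k)\<^sup>2) * wave_coeff (?a k) (?b k) (w k) t) has_vector_derivative
        - of_real ((w k)\<^sup>2) * wave_velocity (?a k) (?b k) (w k) x) (at x)"
      by (intro has_vector_derivative_mult_right wave_coeff_deriv)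
    have "norm (- of_real ((w k)\<^sup>2) * wave_velocity (?a k) (?b k) (w k) x)
        = (w k)\<^sup>2 * norm (wave_velocity (?a k) (?b k) (w k) x)"
      by (simp add: norm_mult norm_power)
    also have "\<dots> \<le> (1 + w k)\<^sup>2 * ((1 + w k) * (norm (?a k) + norm (?b k)))"
      using w(1)[of k] by (intro mult_mono norm_wave_velocity_le power_mono) auto
    finally show "norm (- of_real ((w k)\<^sup>2) * wave_velocity (?a k) (?b k) (w k) x)
        \<le> (1 + w k) ^ 3 * (norm (?a k) + norm (?b k))"
      by (simp add: power3_eq_cube power2_eq_square mult_ac)
  qed (use pb pb_acc wave_velocity_deriv wave_power_poly_bounded[OF ab w, of 3] in auto)
  moreover have "?U 0 = f" "?V 0 = g"
    by (simp_all add: fourier_inversion f g)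
  ultimately show ?thesis
    unfolding wave_solution_def using pb
    by (intro conjI exI[of _ ?V] allI impI fourier_series_periodic_distribution) auto
qed

section \<open>Dominated convergence in Sobolev spaces\<close>

lemma infsum_tendsto_0_dominated:
  fixes u :: "'d \<Rightarrow> 'k \<Rightarrow> real"
  assumes h: "h summable_on UNIV" and le: "\<forall>\<^sub>F d in F. \<forall>k. 0 \<le> u d k \<and> u d k \<le> h k"
    and lim: "\<And>k. ((\<lambda>d. u d k) \<longlongrightarrow> 0) F"
  shows "((\<lambda>d. \<Sum>\<^sub>\<infinity>k. u d k) \<longlongrightarrow> 0) F"
proof (rule tendstoI)
  fix e :: real assume e: "e > 0"
  \<comment> \<open>\<open>G\<close> carries the sum of \<open>h\<close> up to e/2. Domination
    passes this tail bound on to \<open>u d\<close>, and on \<open>G\<close> the pointwise limits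
    suffice.\<close>
  obtain G where G: "finite G" "dist (sum h G) (infsum h UNIV) \<le> e / 2"
    using infsum_finite_approximation[OF h, of "e / 2"] e by auto
  have smh: "h summable_on - G" using h by (rule summable_on_subset_banach) simp
  have "infsum h (G \<union> - G) = infsum h G + infsum h (- G)"
    using smh G by (intro infsum_Un_disjoint) auto
  then have tail: "infsum h (- G) \<le> e / 2" using G by (simp add: dist_real_def)
  have "((\<lambda>d. sum (u d) G) \<longlongrightarrow> (\<Sum>k\<in>G. 0)) F" by (intro tendsto_sum lim)
  then have "((\<lambda>d. sum (u d) G) \<longlongrightarrow> 0) F" by simp
  then have "\<forall>\<^sub>F d in F. dist (sum (u d) G) 0 < e / 2" using e by (intro tendstoD) auto
  with le show "\<forall>\<^sub>F d in F. dist (\<Sum>\<^sub>\<infinity>k. u d k) 0 < e"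
  proof eventually_elim
    case (elim d)
    have sm: "u d summable_on UNIV" by (rule summable_on_comparison_test[OF h]) (use elim in auto)
    have smG: "u d summable_on - G" using sm by (rule summable_on_subset_banach) simp
    have "infsum (u d) (G \<union> - G) = infsum (u d) G + infsum (u d) (- G)"
      using smG G by (intro infsum_Un_disjoint) auto
    also have "infsum (u d) (- G) \<le> infsum h (- G)"
      using elim by (intro infsum_mono smG smh) auto
    finally have "infsum (u d) UNIV \<le> sum (u d) G + e / 2" using G tail by simp
    moreover have "infsum (u d) UNIV \<ge> 0" using elim by (intro infsum_nonneg) auto
    ultimately show ?case using elim(2) by (simp add: dist_real_def)
  qed
qed

lemma weighted_summable:
  "f \<in> sobolev q \<Longrightarrow> (\<lambda>k. freq_weight k powr q * (norm (fourier_coeff f k))\<^sup>2) summable_on UNIV"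
  by (simp add: sobolev_def freq_weight_def)

lemma sobolev_fourier_seriesI:
  assumes "poly_bounded c" "(\<lambda>k. freq_weight k powr q * (norm (c k))\<^sup>2) summable_on UNIV"
  shows "fourier_series c \<in> sobolev q"
  using assms fourier_series_periodic_distribution
  by (simp add: sobolev_def fourier_coeff_fourier_series freq_weight_def)

text \<open>The bound 2 on \<open>x\<close> admits a single cosine as well as a difference of two,
  and 8 is twice its square. The decay of \<open>y\<close> lowers the weight at \<open>b\<close>
  from q to q - \<theta> \<le> s2.\<close>

lemma weighted_combination_le:
  assumes W: "W \<ge> (1::real)" and q: "q \<le> s1" "q \<le> s2 + \<theta>"
    and x: "\<bar>x\<bar> \<le> 2" and y: "y\<^sup>2 \<le> B * W powr (- \<theta>)"
  shows "W powr q * (norm (a * of_real x + b * of_real y :: complex))\<^sup>2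
     \<le> 8 * (W powr s1 * (norm a)\<^sup>2) + 2 * B * (W powr s2 * (norm b)\<^sup>2)"
proof -
  have "x\<^sup>2 \<le> 2\<^sup>2" using x power2_le_iff_abs_le[of 2 x] by simp
  then have x2: "x\<^sup>2 \<le> 4" by simp
  have B: "B \<ge> 0" using order_trans[OF zero_le_power2 y] W by (simp add: zero_le_mult_iff)
  have "norm (a * of_real x + b * of_real y) \<le> norm a * \<bar>x\<bar> + norm b * \<bar>y\<bar>"
    by (rule norm_triangle_le) (simp add: norm_mult)
  then have "(norm (a * of_real x + b * of_real y))\<^sup>2 \<le> (norm a * \<bar>x\<bar> + norm b * \<bar>y\<bar>)\<^sup>2"
    by (intro power_mono) auto
  also have "\<dots> \<le> 2 * (norm a)\<^sup>2 * x\<^sup>2 + 2 * (norm b)\<^sup>2 * y\<^sup>2"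
  proof -
    have "0 \<le> (norm a * \<bar>x\<bar> - norm b * \<bar>y\<bar>)\<^sup>2" by simp
    then show ?thesis unfolding power2_diff power2_sum by (simp add: power_mult_distrib mult.commute)
  qed
  also have "\<dots> \<le> 2 * (norm a)\<^sup>2 * 4 + 2 * (norm b)\<^sup>2 * (B * W powr (- \<theta>))"
    using x2 y by (intro add_mono mult_left_mono) auto
  finally have "W powr q * (norm (a * of_real x + b * of_real y))\<^sup>2 \<le>
      W powr q * (2 * (norm a)\<^sup>2 * 4 + 2 * (norm b)\<^sup>2 * (B * W powr (- \<theta>)))"
    by (intro mult_left_mono) auto
  also have "\<dots> = 8 * (W powr q * (norm a)\<^sup>2) + 2 * B * (W powr (q - \<theta>) * (norm b)\<^sup>2)"
    by (simp add: algebra_simps powr_diff powr_minus divide_simps)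
  also have "\<dots> \<le> 8 * (W powr s1 * (norm a)\<^sup>2) + 2 * B * (W powr s2 * (norm b)\<^sup>2)"
    using W q B by (intro add_mono mult_left_mono mult_right_mono powr_mono) auto
  finally show ?thesis .
qed

lemma wave_sobolev:
  fixes f g :: "'n::finite distr" and w :: "int^'n \<Rightarrow> real"
  assumes f: "f \<in> sobolev s1" and g: "g \<in> sobolev s2" and q: "q \<le> s1" "q \<le> s2 + \<theta>"
    and w: "\<And>k. (sinc_freq (w k) t)\<^sup>2 \<le> B * freq_weight k powr (- \<theta>)"
  shows "fourier_series (\<lambda>k. wave_coeff (fourier_coeff f k) (fourier_coeff g k) (w k) t) \<in> sobolev q"
proof (rule sobolev_fourier_seriesI)
  show "poly_bounded (\<lambda>k. wave_coeff (fourier_coeff f k) (fourier_coeff g k) (w k) t)"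
    using f g by (intro wave_coeff_poly_bounded fourier_coeff_poly_bounded) (auto simp: sobolev_def)
  have sm: "(\<lambda>k. 8 * (freq_weight k powr s1 * (norm (fourier_coeff f k))\<^sup>2)
      + 2 * B * (freq_weight k powr s2 * (norm (fourier_coeff g k))\<^sup>2)) summable_on UNIV"
    by (intro summable_on_add summable_on_cmult_right weighted_summable f g)
  show "(\<lambda>k. freq_weight k powr q * (norm (wave_coeff (fourier_coeff f k) (fourier_coeff g k) (w k) t))\<^sup>2) summable_on UNIV"
  proof (rule summable_on_comparison_test[OF sm])
    fix k
    show "freq_weight k powr q * (norm (wave_coeff (fourier_coeff f k) (fourier_coeff g k) (w k) t))\<^sup>2
      \<le> 8 * (freq_weight k powr s1 * (norm (fourier_coeff f k))\<^sup>2)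
      + 2 * B * (freq_weight k powr s2 * (norm (fourier_coeff g k))\<^sup>2)"
      unfolding wave_coeff_def using abs_cos_le_one[of "w k * t"]
      by (intro weighted_combination_le[OF freq_weight_ge_1 q _ w]) linarith
  qed simp
qed

lemma wave_sobolev_tendsto:
  fixes f g :: "'n::finite distr" and w :: "real \<Rightarrow> int^'n \<Rightarrow> real"
  assumes f: "f \<in> sobolev s1" and g: "g \<in> sobolev s2" and q: "q \<le> s1" "q \<le> s2 + \<theta>"
    and w: "\<forall>\<^sub>F \<delta> in F. \<forall>k. (sinc_freq (w \<delta> k) t)\<^sup>2 \<le> B * freq_weight k powr (- \<theta>)"
    and w0: "\<And>k. (sinc_freq (w0 k) t)\<^sup>2 \<le> B * freq_weight k powr (- \<theta>)"
    and cos_lim: "\<And>k. ((\<lambda>\<delta>. cos (w \<delta> k * t)) \<longlongrightarrow> cos (w0 k * t)) F"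
    and sinc_lim: "\<And>k. ((\<lambda>\<delta>. sinc_freq (w \<delta> k) t) \<longlongrightarrow> sinc_freq (w0 k) t) F"
  shows "sobolev_tendsto q
     (\<lambda>\<delta>. fourier_series (\<lambda>k. wave_coeff (fourier_coeff f k) (fourier_coeff g k) (w \<delta> k) t))
     (fourier_series (\<lambda>k. wave_coeff (fourier_coeff f k) (fourier_coeff g k) (w0 k) t)) F"
  unfolding sobolev_tendsto_def
proof (intro conjI)
  let ?a = "fourier_coeff f" and ?b = "fourier_coeff g"
  show "fourier_series (\<lambda>k. wave_coeff (?a k) (?b k) (w0 k) t) \<in> sobolev q"
    by (rule wave_sobolev[OF f g q w0])
  show "\<forall>\<^sub>F \<delta> in F. fourier_series (\<lambda>k. wave_coeff (?a k) (?b k) (w \<delta> k) t) \<in> sobolev q"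
    using w by eventually_elim (rule wave_sobolev[OF f g q], blast)
  \<comment> \<open>A difference of two solutions has coefficients of the same shape, with
    differences in place of the cosine and sinc factors, so \<open>weighted_combination_le\<close>
    yields a common majorant \<open>h\<close>.\<close>
  define x where "x = (\<lambda>\<delta> k. cos (w \<delta> k * t) - cos (w0 k * t))"
  define y where "y = (\<lambda>\<delta> k. sinc_freq (w \<delta> k) t - sinc_freq (w0 k) t)"
  define h where "h = (\<lambda>k. 8 * (freq_weight k powr s1 * (norm (?a k))\<^sup>2)
      + 2 * (4 * B) * (freq_weight k powr s2 * (norm (?b k))\<^sup>2))"
  define u where "u = (\<lambda>\<delta> k. freq_weight k powr q * (norm (?a k * of_real (x \<delta> k) + ?b k * of_real (y \<delta> k)))\<^sup>2)"
  have h: "h summable_on UNIV"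
    unfolding h_def by (intro summable_on_add summable_on_cmult_right weighted_summable f g)
  have "((\<lambda>\<delta>. \<Sum>\<^sub>\<infinity>k. u \<delta> k) \<longlongrightarrow> 0) F"
  proof (rule infsum_tendsto_0_dominated[OF h])
    show "\<forall>\<^sub>F \<delta> in F. \<forall>k. 0 \<le> u \<delta> k \<and> u \<delta> k \<le> h k"
      using w
    proof eventually_elim
      case (elim \<delta>)
      show ?case
      proof (intro allI conjI)
        fix k
        show "0 \<le> u \<delta> k" by (simp add: u_def)
        \<comment> \<open>Gives (p - r)^2 \<le> 2 p^2 + 2 r^2, the origin of the constant
          4B.\<close>
        have "0 \<le> (sinc_freq (w \<delta> k) t + sinc_freq (w0 k) t)\<^sup>2" by simp
        then have "(y \<delta> k)\<^sup>2 \<le> 2 * (sinc_freq (w \<delta> k) t)\<^sup>2 + 2 * (sinc_freq (w0 k) t)\<^sup>2"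
          unfolding y_def power2_diff power2_sum by simp
        then have "(y \<delta> k)\<^sup>2 \<le> 4 * B * freq_weight k powr (- \<theta>)"
          using elim[rule_format, of k] w0[of k] by simp
        moreover have "\<bar>x \<delta> k\<bar> \<le> 2"
          unfolding x_def using abs_cos_le_one[of "w \<delta> k * t"] abs_cos_le_one[of "w0 k * t"] by linarith
        ultimately show "u \<delta> k \<le> h k"
          unfolding u_def h_def by (intro weighted_combination_le[OF freq_weight_ge_1 q])
      qed
    qed
    fix k
    have "((\<lambda>\<delta>. u \<delta> k) \<longlongrightarrow> freq_weight k powr q * (norm (?a k * of_real (cos (w0 k * t) - cos (w0 k * t))
        + ?b k * of_real (sinc_freq (w0 k) t - sinc_freq (w0 k) t)))\<^sup>2) F"
      unfolding u_def x_def y_def by (intro tendsto_intros cos_lim sinc_lim)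
    then show "((\<lambda>\<delta>. u \<delta> k) \<longlongrightarrow> 0) F" by simp
  qed
  then have "((\<lambda>\<delta>. sqrt (\<Sum>\<^sub>\<infinity>k. u \<delta> k)) \<longlongrightarrow> sqrt 0) F" by (rule tendsto_real_sqrt)
  moreover have "sobolev_norm q (\<lambda>\<phi>. fourier_series (\<lambda>k. wave_coeff (?a k) (?b k) (w \<delta> k) t) \<phi>
      - fourier_series (\<lambda>k. wave_coeff (?a k) (?b k) (w0 k) t) \<phi>) = sqrt (\<Sum>\<^sub>\<infinity>k. u \<delta> k)" for \<delta>
  proof -
    have "fourier_coeff (\<lambda>\<phi>. fourier_series (\<lambda>k. wave_coeff (?a k) (?b k) (w \<delta> k) t) \<phi>
      - fourier_series (\<lambda>k. wave_coeff (?a k) (?b k) (w0 k) t) \<phi>) k = ?a k * of_real (x \<delta> k) + ?b k * of_real (y \<delta> k)" for k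
    proof -
      have "fourier_coeff (\<lambda>\<phi>. S \<phi> - T \<phi>) k = fourier_coeff S k - fourier_coeff T k" for S T :: "'n distr"
        by (simp add: fourier_coeff_def diff_divide_distrib)
      then show ?thesis
        unfolding x_def y_def of_real_diff right_diff_distrib
        by (simp add: fourier_coeff_fourier_series wave_coeff_def)
    qed
    then show ?thesis by (simp add: sobolev_norm_def u_def freq_weight_def)
  qed
  ultimately show "((\<lambda>\<delta>. sobolev_norm q (\<lambda>\<phi>. fourier_series (\<lambda>k. wave_coeff (?a k) (?b k) (w \<delta> k) t) \<phi>
      - fourier_series (\<lambda>k. wave_coeff (?a k) (?b k) (w0 k) t) \<phi>)) \<longlongrightarrow> 0) F"
    by simp
qed

text \<open>The summand t^2 is for k = 0, where the weight is 1 and the sinc factor is t; for other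
  k the bound sin^2 \<le> 1 gives 1/c.\<close>

lemma sinc_freq_weight_bound:
  assumes "c > 0" "w 0 = 0" and w: "\<And>k. k \<noteq> 0 \<Longrightarrow> (w k)\<^sup>2 \<ge> c * freq_weight k powr \<theta>"
  shows "(sinc_freq (w k) t)\<^sup>2 \<le> (t\<^sup>2 + 1 / c) * freq_weight k powr (- \<theta>)"
proof (cases "k = 0")
  case True
  then show ?thesis using assms by (simp add: sinc_freq_def)
next
  case False
  have W: "freq_weight k powr \<theta> > 0" using freq_weight_ge_1[of k] by simp
  then have w2: "(w k)\<^sup>2 > 0" using w[OF False] assms(1) by (meson mult_pos_pos less_le_trans)
  then have "(sinc_freq (w k) t)\<^sup>2 = (sin (w k * t))\<^sup>2 / (w k)\<^sup>2"
    by (simp add: sinc_freq_def power_divide)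
  also have "\<dots> \<le> 1 / (c * freq_weight k powr \<theta>)"
    using w[OF False] w2 W assms(1) sin_squared_eq[of "w k * t"] by (intro frac_le) auto
  also have "\<dots> = 1 / c * freq_weight k powr (- \<theta>)"
    by (simp add: powr_minus divide_simps)
  also have "\<dots> \<le> (t\<^sup>2 + 1 / c) * freq_weight k powr (- \<theta>)"
    by (intro mult_right_mono) auto
  finally show ?thesis .
qed

lemma sinc_freq_weight_bound_0: "(sinc_freq w t)\<^sup>2 \<le> t\<^sup>2 * freq_weight k powr (- 0)"
  using abs_sinc_freq_le[of w t] freq_weight_ge_1[of k] by (simp add: abs_le_square_iff)

lemma freq_weight_le_norm: "k \<noteq> 0 \<Longrightarrow> freq_weight k / 2 \<le> (norm (real_vec k))\<^sup>2"
  using power_mono[OF norm_real_vec_ge_1[of k], of 2] by (simp add: freq_weight_def)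

text \<open>\<open>\<bar>a\<bar>\<close> unites both signs: p \<le> D q is used for a \<ge> 0, and q
  \<le> D p for a < 0.\<close>

lemma powr_neg_comparable:
  assumes "p > 0" "q > 0" "D \<ge> (1::real)" "p \<le> D * q" "q \<le> D * p"
  shows "D powr (- \<bar>a\<bar>) * q powr (- a) \<le> p powr (- a)"
proof (cases "a \<ge> 0")
  case True
  then have "(D * q) powr (- a) \<le> p powr (- a)"
    using assms by (intro powr_mono2') auto
  then show ?thesis using True assms by (simp add: powr_mult)
next
  case False
  then have "(q / D) powr (- a) \<le> p powr (- a)"
    using assms by (intro powr_mono2) (auto simp: divide_le_eq mult.commute)
  moreover have "D powr a * q powr (- a) = (q / D) powr (- a)"
    using assms by (simp add: powr_divide powr_minus divide_simps)
  ultimately show ?thesis using False by simp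
qed

section \<open>The multiplier in terms of the Sobolev weight\<close>

context
  fixes \<beta> a :: real
  assumes \<beta>: "\<beta> < real CARD('n::finite) + 4" and a: "a = (real CARD('n) + 2 - \<beta>) / 2"
begin

lemma hyp_params: "a > - 1" "(real CARD('n) + 2) / 2 \<ge> 3 / 2"
proof -
  have "CARD('n) \<ge> 1" by (simp add: Suc_leI)
  then show "(real CARD('n) + 2) / 2 \<ge> 3 / 2" by simp
  show "a > - 1" using \<beta> by (simp add: a)
qed

lemma neg_multiplier:
  "- multiplier \<delta> \<beta> (\<nu> :: real^'n) =
     (norm \<nu>)\<^sup>2 * hyp_mult a ((real CARD('n) + 2) / 2) ((norm \<nu>)\<^sup>2 * \<delta>\<^sup>2 / 4)"
  unfolding multiplier_eq a by simp

lemma neg_multiplier_lower: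
  obtains c where "c > 0"
    "\<And>\<delta> \<nu> :: real^'n. c * (norm \<nu>)\<^sup>2 * (1 + (norm \<nu>)\<^sup>2 * \<delta>\<^sup>2 / 4) powr (- a) \<le> - multiplier \<delta> \<beta> \<nu>"
proof -
  obtain c where c: "c > 0" "\<And>v. v \<ge> 0 \<Longrightarrow> c * (1 + v) powr (- a) \<le> hyp_mult a ((real CARD('n) + 2) / 2) v"
    using hyp_mult_lower[OF hyp_params] by blast
  have "c * (norm \<nu>)\<^sup>2 * (1 + (norm \<nu>)\<^sup>2 * \<delta>\<^sup>2 / 4) powr (- a) \<le> - multiplier \<delta> \<beta> \<nu>" for \<delta> and \<nu> :: "real^'n"
    using mult_left_mono[OF c(2)[of "(norm \<nu>)\<^sup>2 * \<delta>\<^sup>2 / 4"], of "(norm \<nu>)\<^sup>2"]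
    unfolding neg_multiplier by (simp add: mult_ac)
  then show ?thesis using c(1) that by blast
qed

lemma neg_multiplier_upper:
  obtains C where "\<And>\<delta> \<nu> :: real^'n. - multiplier \<delta> \<beta> \<nu> \<le> C * (norm \<nu>)\<^sup>2 * (1 + (norm \<nu>)\<^sup>2 * \<delta>\<^sup>2 / 4)"
proof -
  obtain C where C: "\<And>v. v \<ge> 0 \<Longrightarrow> hyp_mult a ((real CARD('n) + 2) / 2) v \<le> C * (1 + v)"
    using hyp_mult_upper[OF hyp_params] by blast
  have "- multiplier \<delta> \<beta> \<nu> \<le> C * (norm \<nu>)\<^sup>2 * (1 + (norm \<nu>)\<^sup>2 * \<delta>\<^sup>2 / 4)" for \<delta> and \<nu> :: "real^'n"
    using mult_left_mono[OF C[of "(norm \<nu>)\<^sup>2 * \<delta>\<^sup>2 / 4"], of "(norm \<nu>)\<^sup>2"]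
    unfolding neg_multiplier by (simp add: mult_ac)
  then show ?thesis using that by blast
qed

lemma neg_multiplier_ge_local:
  assumes "\<beta> \<ge> real CARD('n) + 2"
  shows "(norm \<nu>)\<^sup>2 \<le> - multiplier \<delta> \<beta> (\<nu> :: real^'n)"
proof -
  have "hyp_mult a ((real CARD('n) + 2) / 2) ((norm \<nu>)\<^sup>2 * \<delta>\<^sup>2 / 4) \<ge> 1"
    using assms by (intro hyp_mult_ge_1 hyp_params) (auto simp: a)
  then have "(norm \<nu>)\<^sup>2 * 1 \<le> (norm \<nu>)\<^sup>2 * hyp_mult a ((real CARD('n) + 2) / 2) ((norm \<nu>)\<^sup>2 * \<delta>\<^sup>2 / 4)"
    by (intro mult_left_mono) auto
  then show ?thesis unfolding neg_multiplier by simp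
qed

lemma neg_multiplier_pos:
  assumes "\<nu> \<noteq> 0"
  shows "- multiplier \<delta> \<beta> (\<nu> :: real^'n) > 0"
proof -
  obtain c where c: "c > 0"
    "\<And>\<delta> \<nu> :: real^'n. c * (norm \<nu>)\<^sup>2 * (1 + (norm \<nu>)\<^sup>2 * \<delta>\<^sup>2 / 4) powr (- a) \<le> - multiplier \<delta> \<beta> \<nu>"
    by (rule neg_multiplier_lower) blast
  have "1 + (norm \<nu>)\<^sup>2 * \<delta>\<^sup>2 / 4 > 0" by (intro add_pos_nonneg) auto
  then have "c * (norm \<nu>)\<^sup>2 * (1 + (norm \<nu>)\<^sup>2 * \<delta>\<^sup>2 / 4) powr (- a) > 0"
    using c(1) assms by simp
  then show ?thesis using c(2)[where \<nu> = \<nu> and \<delta> = \<delta>] by linarith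
qed

lemma neg_multiplier_tendsto:
  "((\<lambda>\<delta>. - multiplier \<delta> \<beta> (\<nu> :: real^'n)) \<longlongrightarrow> (norm \<nu>)\<^sup>2) (at_right 0)"
proof -
  have "isCont (hyp_mult a ((real CARD('n) + 2) / 2)) ((norm \<nu>)\<^sup>2 * 0\<^sup>2 / 4)"
    using hyp_params by (intro hyp_mult_continuous) simp_all
  then have "((\<lambda>\<delta>. (norm \<nu>)\<^sup>2 * hyp_mult a ((real CARD('n) + 2) / 2) ((norm \<nu>)\<^sup>2 * \<delta>\<^sup>2 / 4)) \<longlongrightarrow>
      (norm \<nu>)\<^sup>2 * hyp_mult a ((real CARD('n) + 2) / 2) ((norm \<nu>)\<^sup>2 * 0\<^sup>2 / 4)) (at_right 0)"
    by (intro tendsto_mult tendsto_const isCont_tendsto_compose[of _ "hyp_mult a ((real CARD('n) + 2) / 2)"] tendsto_intros) auto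
  then show ?thesis unfolding neg_multiplier by simp
qed

text \<open>At fixed \<delta> the quantities 1 + |k|^2 \<delta>^2 / 4 and 1 + |k|^2 are comparable,
  so the lower bound becomes the weight to the power 1 - a = (\<beta> - n)/2. The constant depends
  on \<delta>: this serves membership in the Sobolev space, not the limit.\<close>

lemma neg_multiplier_weight_lower:
  assumes "\<delta> > 0"
  obtains c where "c > 0" "\<And>k :: int^'n. k \<noteq> 0 \<Longrightarrow>
     c * freq_weight k powr ((\<beta> - real CARD('n)) / 2) \<le> - multiplier \<delta> \<beta> (real_vec k)"
proof -
  obtain c where c: "c > 0"
    "\<And>\<delta> \<nu> :: real^'n. c * (norm \<nu>)\<^sup>2 * (1 + (norm \<nu>)\<^sup>2 * \<delta>\<^sup>2 / 4) powr (- a) \<le> - multiplier \<delta> \<beta> \<nu>"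
    by (rule neg_multiplier_lower) blast
  \<comment> \<open>The summand 4/\<delta>^2 serves the upper bound for 1 + x, and \<delta>^2 is the
    slack that makes \<open>D\<close> work in both directions.\<close>
  define D where "D = 1 + 4 / \<delta>\<^sup>2 + \<delta>\<^sup>2"
  have D: "D \<ge> 1" using assms by (simp add: D_def)
  have "c / 2 * D powr (- \<bar>a\<bar>) * freq_weight k powr ((\<beta> - real CARD('n)) / 2) \<le> - multiplier \<delta> \<beta> (real_vec k)"
    if k: "k \<noteq> 0" for k :: "int^'n"
  proof -
    define x where "x = (norm (real_vec k))\<^sup>2"
    have x: "x \<ge> 0" "freq_weight k = 1 + x" by (simp_all add: x_def freq_weight_def)
    have 1: "1 + x * \<delta>\<^sup>2 / 4 \<le> D * (1 + x)" and 2: "1 + x \<le> D * (1 + x * \<delta>\<^sup>2 / 4)"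
    proof -
      have "D * (1 + x) = 1 + x * \<delta>\<^sup>2 / 4 + (x + (4 / \<delta>\<^sup>2) * (1 + x) + \<delta>\<^sup>2 + (3 / 4) * (x * \<delta>\<^sup>2))"
        by (simp add: D_def algebra_simps)
      moreover have "x + (4 / \<delta>\<^sup>2) * (1 + x) + \<delta>\<^sup>2 + (3 / 4) * (x * \<delta>\<^sup>2) \<ge> 0"
        using x by (intro add_nonneg_nonneg mult_nonneg_nonneg) auto
      ultimately show "1 + x * \<delta>\<^sup>2 / 4 \<le> D * (1 + x)" by linarith
      have "D * (1 + x * \<delta>\<^sup>2 / 4) = 1 + x + (x * \<delta>\<^sup>2 / 4 + 4 / \<delta>\<^sup>2 + \<delta>\<^sup>2 * (1 + x * \<delta>\<^sup>2 / 4))"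
        using assms by (simp add: D_def algebra_simps)
      moreover have "x * \<delta>\<^sup>2 / 4 + 4 / \<delta>\<^sup>2 + \<delta>\<^sup>2 * (1 + x * \<delta>\<^sup>2 / 4) \<ge> 0"
        using x by (intro add_nonneg_nonneg mult_nonneg_nonneg) auto
      ultimately show "1 + x \<le> D * (1 + x * \<delta>\<^sup>2 / 4)" by linarith
    qed
    have e: "(\<beta> - real CARD('n)) / 2 = 1 + (- a)" by (simp add: a field_simps)
    have "c / 2 * D powr (- \<bar>a\<bar>) * freq_weight k powr ((\<beta> - real CARD('n)) / 2)
        = c * (freq_weight k / 2) * (D powr (- \<bar>a\<bar>) * (1 + x) powr (- a))"
      unfolding e powr_add using x by simp
    also have "\<dots> \<le> c * x * (1 + x * \<delta>\<^sup>2 / 4) powr (- a)"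
      using c(1) freq_weight_le_norm[OF k] x 1 2 D
      by (intro mult_mono powr_neg_comparable) (auto simp: x_def add_pos_nonneg)
    also have "\<dots> \<le> - multiplier \<delta> \<beta> (real_vec k)"
      unfolding x_def by (rule c(2))
    finally show ?thesis .
  qed
  moreover have "c / 2 * D powr (- \<bar>a\<bar>) > 0" using c(1) D by simp
  ultimately show ?thesis using that by blast
qed

text \<open>Here a \<ge> 0, so replacing 1 + |k|^2 \<delta>^2 / 4 by the larger 1 + |k|^2 only
  decreases the power, and the constant is free of \<delta>.\<close>

lemma neg_multiplier_weight_lower_uniform:
  assumes "\<beta> \<le> real CARD('n) + 2"
  obtains c where "c > 0" "\<And>\<delta> k :: int^'n. 0 < \<delta> \<Longrightarrow> \<delta> \<le> 1 \<Longrightarrow> k \<noteq> 0 \<Longrightarrow>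
     c * freq_weight k powr ((\<beta> - real CARD('n)) / 2) \<le> - multiplier \<delta> \<beta> (real_vec k)"
proof -
  obtain c where c: "c > 0"
    "\<And>\<delta> \<nu> :: real^'n. c * (norm \<nu>)\<^sup>2 * (1 + (norm \<nu>)\<^sup>2 * \<delta>\<^sup>2 / 4) powr (- a) \<le> - multiplier \<delta> \<beta> \<nu>"
    by (rule neg_multiplier_lower) blast
  have "c / 2 * freq_weight k powr ((\<beta> - real CARD('n)) / 2) \<le> - multiplier \<delta> \<beta> (real_vec k)"
    if \<delta>: "0 < \<delta>" "\<delta> \<le> 1" and k: "k \<noteq> 0" for \<delta> and k :: "int^'n"
  proof -
    define x where "x = (norm (real_vec k))\<^sup>2"
    have x: "x \<ge> 0" "freq_weight k = 1 + x" by (simp_all add: x_def freq_weight_def)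
    have "\<delta>\<^sup>2 \<le> 1" using \<delta> by (simp add: power_le_one)
    then have "x * \<delta>\<^sup>2 \<le> x * 1" using x by (intro mult_left_mono) auto
    then have le: "1 + x * \<delta>\<^sup>2 / 4 \<le> 1 + x" using x by simp
    have e: "(\<beta> - real CARD('n)) / 2 = 1 + (- a)" by (simp add: a field_simps)
    have "c / 2 * freq_weight k powr ((\<beta> - real CARD('n)) / 2)
        = c * (freq_weight k / 2) * (1 + x) powr (- a)"
      unfolding e powr_add using x by simp
    also have "\<dots> \<le> c * x * (1 + x * \<delta>\<^sup>2 / 4) powr (- a)"
      using c(1) freq_weight_le_norm[OF k] x le assms
      by (intro mult_mono powr_mono2') (auto simp: x_def a add_pos_nonneg)
    also have "\<dots> \<le> - multiplier \<delta> \<beta> (real_vec k)"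
      unfolding x_def by (rule c(2))
    finally show ?thesis .
  qed
  moreover have "c / 2 > 0" using c(1) by simp
  ultimately show ?thesis using that by blast
qed

lemma neg_multiplier_poly_bounded:
  obtains C N where "\<And>k :: int^'n. sqrt (- multiplier \<delta> \<beta> (real_vec k)) \<le> C * freq_weight k ^ N"
proof -
  obtain C where C: "\<And>\<delta> \<nu> :: real^'n. - multiplier \<delta> \<beta> \<nu> \<le> C * (norm \<nu>)\<^sup>2 * (1 + (norm \<nu>)\<^sup>2 * \<delta>\<^sup>2 / 4)"
    by (rule neg_multiplier_upper) blast
  have "sqrt (- multiplier \<delta> \<beta> (real_vec k)) \<le> (1 + \<bar>C\<bar> * (1 + \<delta>\<^sup>2)) * freq_weight k ^ 2" for k :: "int^'n"
  proof -
    define x where "x = (norm (real_vec k))\<^sup>2"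
    have x: "x \<ge> 0" "freq_weight k = 1 + x" by (simp_all add: x_def freq_weight_def)
    have "- multiplier \<delta> \<beta> (real_vec k) \<le> C * x * (1 + x * \<delta>\<^sup>2 / 4)"
      unfolding x_def by (rule C)
    also have "\<dots> \<le> \<bar>C\<bar> * (1 + x) * ((1 + \<delta>\<^sup>2) * (1 + x))"
    proof (intro mult_mono)
      have "x * \<delta>\<^sup>2 \<ge> 0" using x by simp
      then have "1 + x * \<delta>\<^sup>2 / 4 \<le> 1 + (x + \<delta>\<^sup>2 + x * \<delta>\<^sup>2)" using x zero_le_power2[of \<delta>] by linarith
      then show "1 + x * \<delta>\<^sup>2 / 4 \<le> (1 + \<delta>\<^sup>2) * (1 + x)" by (simp add: algebra_simps)
    qed (use x in auto)
    finally have m: "- multiplier \<delta> \<beta> (real_vec k) \<le> \<bar>C\<bar> * (1 + \<delta>\<^sup>2) * (1 + x)\<^sup>2"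
      by (simp add: power2_eq_square mult_ac)
    have "1 \<le> (1 + x)\<^sup>2" using x by simp
    then have le: "1 - multiplier \<delta> \<beta> (real_vec k) \<le> (1 + \<bar>C\<bar> * (1 + \<delta>\<^sup>2)) * freq_weight k ^ 2"
      using m x(2) by (simp add: distrib_right)
    have "multiplier \<delta> \<beta> (real_vec k) \<le> 0"
      using neg_multiplier_pos[of "real_vec k" \<delta>] by (cases "k = 0") (auto simp: multiplier_def)
    moreover have "sqrt y \<le> 1 + y" if "y \<ge> 0" for y :: real
      using that by (intro real_le_lsqrt) (simp_all add: power2_eq_square algebra_simps)
    ultimately have "sqrt (- multiplier \<delta> \<beta> (real_vec k)) \<le> 1 - multiplier \<delta> \<beta> (real_vec k)"
      by (metis diff_conv_add_uminus neg_0_le_iff_le)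
    with le show ?thesis by linarith
  qed
  then show ?thesis using that by blast
qed

end

theorem theorem8:
  fixes f g :: "('n::finite) distr"
    and \<beta> s1 s2 s s' \<theta> t :: real
  assumes "\<beta> < real CARD('n) + 4"
    and "f \<in> sobolev s1"
    and "g \<in> sobolev s2"
    and "s = min s1 (s2 + 1)"
    and "\<theta> = max 0 ((\<beta> - real CARD('n)) / 2)"
    and "s' = min s1 (s2 + \<theta>)"
    and "t \<ge> 0"
  shows "(\<forall>\<delta>>0. wave_solution (nonlocal_laplacian \<delta> \<beta>) f g (nonlocal_wave \<delta> \<beta> f g) \<and>
                nonlocal_wave \<delta> \<beta> f g t \<in> sobolev s') \<and>
         wave_solution laplacian f g (local_wave f g) \<and>
         local_wave f g t \<in> sobolev s \<and>
         (\<beta> \<le> real CARD('n) + 2 \<longrightarrow>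
            sobolev_tendsto s' (\<lambda>\<delta>. nonlocal_wave \<delta> \<beta> f g t) (local_wave f g t) (at_right 0)) \<and>
         (real CARD('n) + 2 < \<beta> \<longrightarrow>
            sobolev_tendsto s (\<lambda>\<delta>. nonlocal_wave \<delta> \<beta> f g t) (local_wave f g t) (at_right 0))"
proof -
  note \<beta> = assms(1) and f = assms(2) and g = assms(3)
  have fg: "f \<in> periodic_distributions" "g \<in> periodic_distributions"
    using f g by (simp_all add: sobolev_def)
  have s: "s \<le> s1" "s \<le> s2 + 1" and s': "s' \<le> s1" "s' \<le> s2 + \<theta>" using assms by simp_all
  define w where "w = (\<lambda>\<delta> k. sqrt (- multiplier \<delta> \<beta> (real_vec (k :: int^'n))))"
  define w0 where "w0 = (\<lambda>k :: int^'n. norm (real_vec k))"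
  have w_0 [simp]: "w \<delta> 0 = 0" "w0 0 = 0" for \<delta>
    by (simp_all add: w_def w0_def multiplier_def)
  have neg: "- multiplier \<delta> \<beta> (real_vec k) > 0" if "k \<noteq> 0" for \<delta> and k :: "int^'n"
    using that by (intro neg_multiplier_pos[OF \<beta> refl]) simp
  have w_pos: "w \<delta> k > 0" "w0 k > 0" if "k \<noteq> 0" for \<delta> k
    using neg[OF that, of \<delta>] that by (simp_all add: w_def w0_def)
  have w_nonneg: "w \<delta> k \<ge> 0" for \<delta> k
    using w_pos(1)[of k \<delta>] by (cases "k = 0") auto
  have w_sq: "(w \<delta> k)\<^sup>2 = - multiplier \<delta> \<beta> (real_vec k)" for \<delta> k
    using neg[of k \<delta>] by (cases "k = 0") (auto simp: w_def multiplier_def)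
  let ?W = "\<lambda>w t. fourier_series (\<lambda>k. wave_coeff (fourier_coeff f k) (fourier_coeff g k) (w k) t)"
  have U: "nonlocal_wave \<delta> \<beta> f g = ?W (w \<delta>)" for \<delta>
  proof
    fix t
    show "nonlocal_wave \<delta> \<beta> f g t = ?W (w \<delta>) t"
      unfolding nonlocal_wave_def
    proof (intro arg_cong[of _ _ fourier_series] ext)
      fix k :: "int^'n"
      show "(if k = 0 then fourier_coeff f 0 + fourier_coeff g 0 * complex_of_real t
       else let \<omega> = sqrt (- multiplier \<delta> \<beta> (real_vec k)) in
            fourier_coeff f k * complex_of_real (cos (\<omega> * t)) +
            fourier_coeff g k / complex_of_real \<omega> * complex_of_real (sin (\<omega> * t))) =
         wave_coeff (fourier_coeff f k) (fourier_coeff g k) (w \<delta> k) t"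
      proof (cases "k = 0")
        case False
        then show ?thesis
          using w_pos(1)[of k \<delta>] by (simp add: wave_coeff_def sinc_freq_def Let_def w_def)
      qed (simp add: wave_coeff_def sinc_freq_def)
    qed
  qed
  have U0: "local_wave f g = ?W w0"
  proof
    fix t
    show "local_wave f g t = ?W w0 t"
      unfolding local_wave_def
    proof (intro arg_cong[of _ _ fourier_series] ext)
      fix k :: "int^'n"
      show "(if k = 0 then fourier_coeff f 0 + fourier_coeff g 0 * complex_of_real t
       else let \<omega> = norm (real_vec k) in
            fourier_coeff f k * complex_of_real (cos (\<omega> * t)) +
            fourier_coeff g k / complex_of_real \<omega> * complex_of_real (sin (\<omega> * t))) =
         wave_coeff (fourier_coeff f k) (fourier_coeff g k) (w0 k) t"
        by (cases "k = 0") (auto simp: wave_coeff_def sinc_freq_def w0_def Let_def)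
    qed
  qed
  have solution: "wave_solution (nonlocal_laplacian \<delta> \<beta>) f g (nonlocal_wave \<delta> \<beta> f g)" for \<delta>
  proof -
    obtain C N where "\<And>k :: int^'n. sqrt (- multiplier \<delta> \<beta> (real_vec k)) \<le> C * freq_weight k ^ N"
      by (rule neg_multiplier_poly_bounded[OF \<beta> refl]) blast
    moreover have "nonlocal_laplacian \<delta> \<beta> (fourier_series c) = fourier_series (\<lambda>k. - of_real ((w \<delta> k)\<^sup>2) * c k)" for c
      unfolding nonlocal_laplacian_def w_sq by (simp add: fourier_coeff_fourier_series)
    ultimately show ?thesis
      unfolding U using w_nonneg
      by (intro wave_solution_fourier_series[OF fg, of "w \<delta>" C N]) (simp_all only:, simp add: w_def)
  qed
  have solution0: "wave_solution laplacian f g (local_wave f g)"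
    unfolding U0
  proof (rule wave_solution_fourier_series[OF fg, of _ 1 1])
    fix k :: "int^'n"
    show "w0 k \<le> 1 * freq_weight k ^ 1"
      using norm_le_freq_weight by (simp add: w0_def)
  qed (simp_all add: w0_def laplacian_fourier_series)
  \<comment> \<open>Nonzero lattice vectors have norm at least 1, so the weight is at most twice the
    squared norm; the local sinc factor gains one derivative.\<close>
  have w0_ge: "(w0 k)\<^sup>2 \<ge> 1 / 2 * freq_weight k powr 1" if "k \<noteq> 0" for k
    using freq_weight_le_norm[OF that] freq_weight_ge_1[of k] by (simp add: w0_def)
  have bound0: "(sinc_freq (w0 k) t)\<^sup>2 \<le> (t\<^sup>2 + 1 / (1 / 2)) * freq_weight k powr (- 1)" for k
    using w0_ge by (intro sinc_freq_weight_bound) auto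
  have member0: "local_wave f g t \<in> sobolev s"
    unfolding U0 by (rule wave_sobolev[OF f g s bound0])
  have member: "nonlocal_wave \<delta> \<beta> f g t \<in> sobolev s'" if \<delta>: "\<delta> > 0" for \<delta>
  proof (cases "\<beta> \<le> real CARD('n)")
    case True
    \<comment> \<open>For \<beta> \<le> n no decay in k is extracted; the bound |t| on the sinc
      factor is enough.\<close>
    then have \<theta>: "\<theta> = 0" using assms by simp
    have "(sinc_freq (w \<delta> k) t)\<^sup>2 \<le> t\<^sup>2 * freq_weight k powr (- \<theta>)" for k
      unfolding \<theta> by (rule sinc_freq_weight_bound_0)
    then show ?thesis unfolding U by (rule wave_sobolev[OF f g s'])
  next
    case False
    then have \<theta>: "\<theta> = (\<beta> - real CARD('n)) / 2" using assms by simp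
    obtain c where c: "c > 0" "\<And>k :: int^'n. k \<noteq> 0 \<Longrightarrow>
       c * freq_weight k powr \<theta> \<le> - multiplier \<delta> \<beta> (real_vec k)"
      using neg_multiplier_weight_lower[OF \<beta> refl \<delta>] unfolding \<theta> by blast
    show ?thesis
      unfolding U
      by (rule wave_sobolev[OF f g s' sinc_freq_weight_bound[OF c(1)]]) (simp_all add: c w_sq)
  qed
  have w_lim: "((\<lambda>\<delta>. w \<delta> k) \<longlongrightarrow> w0 k) (at_right 0)" for k
    using tendsto_real_sqrt[OF neg_multiplier_tendsto[OF \<beta> refl, of "real_vec k"]]
    by (simp add: w_def w0_def)
  have cos_lim: "((\<lambda>\<delta>. cos (w \<delta> k * t)) \<longlongrightarrow> cos (w0 k * t)) (at_right 0)" for k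
    by (intro tendsto_intros w_lim)
  have sinc_lim: "((\<lambda>\<delta>. sinc_freq (w \<delta> k) t) \<longlongrightarrow> sinc_freq (w0 k) t) (at_right 0)" for k
  proof (cases "k = 0")
    case False
    then have nz: "w \<delta> k \<noteq> 0" "w0 k \<noteq> 0" for \<delta> using w_pos(1)[of k \<delta>] w_pos(2)[of k] by simp_all
    show ?thesis
      unfolding sinc_freq_def using nz by (auto intro!: tendsto_intros w_lim)
  qed simp
  have limit_small: "sobolev_tendsto s' (\<lambda>\<delta>. nonlocal_wave \<delta> \<beta> f g t) (local_wave f g t) (at_right 0)"
    if small: "\<beta> \<le> real CARD('n) + 2"
  proof -
    have \<theta>: "0 \<le> \<theta>" "\<theta> \<le> 1" using assms small by auto
    have "\<exists>B. (\<forall>\<delta> k. 0 < \<delta> \<longrightarrow> \<delta> \<le> 1 \<longrightarrow> (sinc_freq (w \<delta> k) t)\<^sup>2 \<le> B * freq_weight k powr (- \<theta>))"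
    proof (cases "\<beta> \<le> real CARD('n)")
      case True
      then have "\<theta> = 0" using assms by simp
      then show ?thesis using sinc_freq_weight_bound_0 by blast
    next
      case False
      then have \<theta>': "\<theta> = (\<beta> - real CARD('n)) / 2" using assms by simp
      obtain c where c: "c > 0" "\<And>\<delta> k :: int^'n. 0 < \<delta> \<Longrightarrow> \<delta> \<le> 1 \<Longrightarrow> k \<noteq> 0 \<Longrightarrow>
         c * freq_weight k powr \<theta> \<le> - multiplier \<delta> \<beta> (real_vec k)"
        using neg_multiplier_weight_lower_uniform[OF \<beta> refl small] unfolding \<theta>' by blast
      then show ?thesis
        by (intro exI[of _ "t\<^sup>2 + 1 / c"] allI impI sinc_freq_weight_bound) (simp_all add: w_sq)
    qed
    then obtain B where B: "\<And>\<delta> k. 0 < \<delta> \<Longrightarrow> \<delta> \<le> 1 \<Longrightarrow> (sinc_freq (w \<delta> k) t)\<^sup>2 \<le> B * freq_weight k powr (- \<theta>)"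
      by blast
    \<comment> \<open>One constant for both frequencies: \<open>B\<close> belongs to the nonlocal
      ones with \<delta> \<le> 1, the other entry is the constant of \<open>bound0\<close>.\<close>
    define B' where "B' = max B (t\<^sup>2 + 1 / (1 / 2))"
    have B'_nonneg: "B' \<ge> 0" unfolding B'_def by (rule max.coboundedI2) simp
    show ?thesis
      unfolding U U0
    proof (rule wave_sobolev_tendsto[OF f g s', where B = B'])
      show "\<forall>\<^sub>F \<delta> in at_right 0. \<forall>k. (sinc_freq (w \<delta> k) t)\<^sup>2 \<le> B' * freq_weight k powr (- \<theta>)"
        using eventually_at_right_real[of 0 1, simplified]
      proof eventually_elim
        case (elim \<delta>)
        show ?case
          using elim by (auto simp: B'_def intro!: order_trans[OF B] mult_right_mono)
      qed
      fix k :: "int^'n"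
      \<comment> \<open>The local frequencies decay with exponent 1, at least as fast as the
        \<theta> \<le> 1 required here.\<close>
      have "freq_weight k powr (- 1) \<le> freq_weight k powr (- \<theta>)"
        using \<theta> freq_weight_ge_1 by (intro powr_mono) auto
      then show "(sinc_freq (w0 k) t)\<^sup>2 \<le> B' * freq_weight k powr (- \<theta>)"
        using B'_nonneg by (intro order_trans[OF bound0] mult_mono) (simp_all add: B'_def)
    qed (rule cos_lim sinc_lim)+
  qed
  have limit_large: "sobolev_tendsto s (\<lambda>\<delta>. nonlocal_wave \<delta> \<beta> f g t) (local_wave f g t) (at_right 0)"
    if large: "real CARD('n) + 2 < \<beta>"
    unfolding U U0
  proof (rule wave_sobolev_tendsto[OF f g s _ bound0 cos_lim sinc_lim])
    \<comment> \<open>The nonlocal frequencies dominate the local ones and inherit their bound, so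
      the gain of one derivative is uniform in all \<delta>.\<close>
    have "(w \<delta> k)\<^sup>2 \<ge> 1 / 2 * freq_weight k powr 1" if "k \<noteq> 0" for \<delta> k
      using neg_multiplier_ge_local[OF \<beta> refl, of "real_vec k" \<delta>] large w0_ge[OF that]
      unfolding w_sq w0_def by linarith
    then show "\<forall>\<^sub>F \<delta> in at_right 0. \<forall>k. (sinc_freq (w \<delta> k) t)\<^sup>2 \<le> (t\<^sup>2 + 1 / (1 / 2)) * freq_weight k powr (- 1)"
      by (intro always_eventually allI sinc_freq_weight_bound) auto
  qed
  show ?thesis
    using solution solution0 member member0 limit_small limit_large by blast
qed

end
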